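(* Let $n\geq3$ and $(n-1)/2<p\leq n/2$. Let $C>0$ be a constant such that $$\big\|e^{\beta\langle(x,t),\nu\rangle}v\big\|_{L_{t,x}^2(|W|)} \leq C\,\|W\|_{\mathcal{F}^p}\,\big\|e^{\beta\langle(x,t),\nu\rangle}(i\partial_t+\Delta)v\big\|_{L_{t,x}^2(|W|^{-1})}$$ for all $W\in\mathcal{F}^p$, $\beta\in\mathbb{R}$, $\nu\in\mathbb{R}^{n+1}$ and $v\in C_0^\infty(\mathbb{R}^{n+1})$. Let $V\in\mathcal{F}^p$ with $\|V\|_{\mathcal{F}^p}<1/C$. If $p=n/2$, assume additionally that there is $\delta>0$ such that $|V(x)|\geq\delta/R^2$ for $|x|\leq 2R$ and all sufficiently large $R$. Suppose that $u\in H^1_t\cap H^2_x$ satisfies $$|(i\partial_t+\Delta)u(x,t)|\leq|V(x)u(x,t)|\quad\text{in }\mathbb{R}^{n+1}$$ and that $u$ vanishes in a half space of $\mathbb{R}^{n+1}$. Then $u$ is identically zero.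
   Context: Points of $\mathbb{R}^{n+1}=\mathbb{R}^n\times\mathbb{R}$ are written $(x,t)$; $\Delta$ is the Laplacian in $x\in\mathbb{R}^n$; $\langle\cdot,\cdot\rangle$ is the usual inner product on $\mathbb{R}^{n+1}$. Functions are complex-valued; equalities and pointwise inequalities between measurable functions are understood almost everywhere. A half space of $\mathbb{R}^{n+1}$ is a set $\{(x,t):\langle(x,t),\nu_0\rangle>c\}$ with $\nu_0\in\mathbb{R}^{n+1}$ a unit vector and $c\in\mathbb{R}$. Fefferman-Phong class: for $1\le p\le n/2$, a function $V\in L^p_{\mathrm{loc}}(\mathbb{R}^n)$ belongs to $\mathcal{F}^p$ if $$\|V\|_{\mathcal{F}^p}=\sup_Q|Q|^{2/n}\bigg(\frac1{|Q|}\int_Q|V|^p\,dx\bigg)^{1/p}<\infty,$$ the supremum being over all cubes $Q\subset\mathbb{R}^n$. For a nonnegative weight $w=w(x)$ on $\mathbb{R}^n$, $\|F\|_{L^2_{t,x}(w)}=\big(\int_{\mathbb{R}}\int_{\mathbb{R}^n}|F(x,t)|^2w(x)\,dx\,dt\big)^{1/2}\in[0,\infty]$. Where $W(x)=0$ the weight $|W(x)|^{-1}$ is $+\infty$, with the convention $0\cdot\infty=0$. $H^1_t$ is the space of functions on $\mathbb{R}^{n+1}$ whose (weak) derivatives up to order $1$ with respect to $t$ belong to $L^2(\mathbb{R}^{n+1})$; $H^2_x$ is the space of functions on $\mathbb{R}^{n+1}$ whose (weak) derivatives up to order $2$ with respect to $x$ belong to $L^2(\mathbb{R}^{n+1})$.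 The paper proves that a constant $C$ as in the claim exists. *)

theory Defs
  imports "HOL-Analysis.Analysis"
begin

definition dderiv :: "'a::real_normed_vector \<Rightarrow> ('a \<Rightarrow> 'b::real_normed_vector) \<Rightarrow> 'a \<Rightarrow> 'b" where
  "dderiv h f = (\<lambda>z. frechet_derivative f (at z) h)"

definition dderivs :: "'a::real_normed_vector list \<Rightarrow> ('a \<Rightarrow> 'b::real_normed_vector) \<Rightarrow> 'a \<Rightarrow> 'b" where
  "dderivs hs f = foldr dderiv hs f"

primrec C_k :: "nat \<Rightarrow> ('a::real_normed_vector \<Rightarrow> 'b::real_normed_vector) \<Rightarrow> bool" where
  "C_k 0 f \<longleftrightarrow> continuous_on UNIV f"
| "C_k (Suc k) f \<longleftrightarrow> (\<forall>z. f differentiable (at z)) \<and> (\<forall>h. C_k k (dderiv h f))"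

definition test_functions :: "('a::euclidean_space \<Rightarrow> complex) set" where
  "test_functions = {f. (\<forall>k. C_k k f) \<and> compact (closure {z. f z \<noteq> 0})}"

definition loc_integrable :: "('a::euclidean_space \<Rightarrow> complex) \<Rightarrow> bool" where
  "loc_integrable f \<longleftrightarrow> (\<forall>K. compact K \<longrightarrow> set_integrable lebesgue K f)"

text \<open>A list \<open>hs\<close> of directions stands for the composition of the derivatives along its
  elements.\<close>

definition is_weak_deriv ::
    "'a::euclidean_space list \<Rightarrow> ('a \<Rightarrow> complex) \<Rightarrow> ('a \<Rightarrow> complex) \<Rightarrow> bool" where
  "is_weak_deriv hs u g \<longleftrightarrow> loc_integrable u \<and> loc_integrable g \<and>
     (\<forall>\<phi>\<in>test_functions.
        (LINT z|lebesgue. u z * dderivs hs \<phi> z) =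
        (-1) ^ length hs * (LINT z|lebesgue. g z * \<phi> z))"

text \<open>Weak derivatives are unique almost everywhere, so the choice below is only that of a
  representative.\<close>

definition weak_deriv :: "'a::euclidean_space list \<Rightarrow> ('a \<Rightarrow> complex) \<Rightarrow> 'a \<Rightarrow> complex" where
  "weak_deriv hs u = (SOME g. is_weak_deriv hs u g)"

definition L2 :: "('a::euclidean_space \<Rightarrow> complex) set" where
  "L2 = {g. g \<in> borel_measurable lebesgue \<and> integrable lebesgue (\<lambda>z. (norm (g z))\<^sup>2)}"

text \<open>Functions whose weak derivatives up to order \<open>k\<close> along directions in \<open>D\<close> are in
  \<open>L2\<close>. Order zero is included: for \<open>hs = []\<close> it says that \<open>u\<close> itself is in \<open>L2\<close>.\<close>

definition sobolev :: "'a::euclidean_space set \<Rightarrow> nat \<Rightarrow> ('a \<Rightarrow> complex) set" where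
  "sobolev D k = {u. \<forall>hs. set hs \<subseteq> D \<and> length hs \<le> k \<longrightarrow> (\<exists>g\<in>L2. is_weak_deriv hs u g)}"

definition e_t :: "(real ^ 'n) \<times> real" where
  "e_t = (0, 1)"

definition e_x :: "'n \<Rightarrow> (real ^ 'n) \<times> real" where
  "e_x j = (axis j 1, 0)"

definition H1_t :: "((real ^ 'n) \<times> real \<Rightarrow> complex) set" where
  "H1_t = sobolev {e_t} 1"

definition H2_x :: "((real ^ 'n) \<times> real \<Rightarrow> complex) set" where
  "H2_x = sobolev (range e_x) 2"

definition schroedinger :: "((real ^ 'n) \<times> real \<Rightarrow> complex) \<Rightarrow> (real ^ 'n) \<times> real \<Rightarrow> complex" where
  "schroedinger v = (\<lambda>z. \<i> * dderivs [e_t] v z + (\<Sum>j\<in>UNIV. dderivs [e_x j, e_x j] v z))"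

definition weak_schroedinger ::
    "((real ^ 'n) \<times> real \<Rightarrow> complex) \<Rightarrow> (real ^ 'n) \<times> real \<Rightarrow> complex" where
  "weak_schroedinger u =
     (\<lambda>z. \<i> * weak_deriv [e_t] u z + (\<Sum>j\<in>UNIV. weak_deriv [e_x j, e_x j] u z))"

text \<open>Cubes are not required to have sides parallel to the axes; restricting to such cubes gives a
  comparable norm.\<close>

definition is_cube :: "(real ^ 'n) set \<Rightarrow> bool" where
  "is_cube Q \<longleftrightarrow> (\<exists>(a :: real ^ 'n) (s :: real) (T :: real ^ 'n \<Rightarrow> real ^ 'n). s > 0 \<and> orthogonal_transformation T \<and>
     Q = (\<lambda>x. a + T x) ` cbox 0 (\<chi> i. s))"

definition Lp_loc :: "real \<Rightarrow> (real ^ 'n \<Rightarrow> complex) set" where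
  "Lp_loc p = {V. V \<in> borel_measurable lebesgue \<and>
     (\<forall>K. compact K \<longrightarrow> set_integrable lebesgue K (\<lambda>x. norm (V x) powr p))}"

text \<open>The average over a cube is a real Lebesgue integral, hence meaningful only for \<open>V\<close> in
  \<open>Lp_loc p\<close>; the supremum is taken in \<open>[0,\<infinity>]\<close>.\<close>

definition FP_norm :: "real \<Rightarrow> (real ^ 'n \<Rightarrow> complex) \<Rightarrow> ennreal" where
  "FP_norm p V = (SUP Q\<in>{Q. is_cube Q}.
     ennreal (measure lebesgue Q powr (2 / real CARD('n)) *
       (1 / measure lebesgue Q * (LINT x:Q|lebesgue. norm (V x) powr p)) powr (1 / p)))"

definition FP :: "real \<Rightarrow> (real ^ 'n \<Rightarrow> complex) set" where
  "FP p = {V \<in> Lp_loc p. FP_norm p V < \<infinity>}"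

definition ennreal_sqrt :: "ennreal \<Rightarrow> ennreal" where
  "ennreal_sqrt r = (if r = \<infinity> then \<infinity> else ennreal (sqrt (enn2real r)))"

text \<open>On \<open>ennreal\<close>, \<open>inverse 0 = \<infinity>\<close> and \<open>0 * \<infinity> = 0\<close>, so the weight
  \<open>inverse (ennreal (norm (W x)))\<close> follows the usual convention at the zeros of \<open>W\<close>.\<close>

definition weighted_norm :: "(real ^ 'n \<Rightarrow> ennreal) \<Rightarrow> ((real ^ 'n) \<times> real \<Rightarrow> complex) \<Rightarrow> ennreal" where
  "weighted_norm w F = ennreal_sqrt
     (\<integral>\<^sup>+ t. (\<integral>\<^sup>+ x. ennreal ((norm (F (x, t)))\<^sup>2) * w x \<partial>lebesgue) \<partial>lebesgue)"

end

theory Submission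
  imports Defs
begin

text \<open>Only the case \<open>\<beta> = 0\<close> of the Carleman inequality is needed. Let \<open>W \<ge> |V|\<close> be a weight
  with \<open>C \<parallel>W\<parallel> < 1\<close> that is at least \<open>\<delta> / R\<^sup>2\<close> on balls of radius \<open>2 R\<close>: the maximum of
  \<open>|V|\<close> and \<open>\<epsilon> |x|\<^sup>-\<^sup>2\<close> if \<open>p < n / 2\<close>, and \<open>|V|\<close> itself at the endpoint. Applying the inequality
  to mollifications of \<open>\<psi>(z / R) u\<close> with the truncated weight \<open>w = min W N\<close>, the lower bound makes the
  error of the cutoff vanish as \<open>R\<close> tends to infinity, so that, with some \<open>\<rho> < 1\<close>,
  \<open>\<integral> |u|\<^sup>2 w \<le> \<rho> \<integral> |(i \<partial>\<^sub>t + \<Delta>) u|\<^sup>2 / w\<close>. By the differential inequality the right hand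
  side is at most \<open>\<rho> (\<integral> |u|\<^sup>2 w + N\<^sup>-\<^sup>1 \<integral> |(i \<partial>\<^sub>t + \<Delta>) u|\<^sup>2)\<close>. As \<open>w\<close> is bounded, the left hand side
  is finite and can be absorbed, which avoids the Fefferman-Phong inequality; let \<open>N\<close> tend to
  infinity.\<close>

section \<open>Smooth functions and a bump function\<close>

text \<open>The weight 1/|W| on the right hand side is the obstacle both to localising and to
  mollifying. Cutting off at radius R costs a commutator of size 1/R, whose square is integrated
  against 1/w <= R^2/\<delta>: the powers of R cancel exactly, so an inverse square lower bound is
  the borderline one, and what is left tends to 0 by dominated convergence. The same lower bound
  makes 1/w bounded on the supports of the mollifications. The gap between the norm of V and 1/C
  pays twice: for the competitor \<epsilon> |x|^(-2) in the maximum, and for the factor 1 + \<kappa>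
  lost when the commutator is split off. The function |x|^(-2) belongs to \<open>FP p\<close> only
  if 2 p < n, because |x|^(-2 p) has to be locally integrable; this is why the endpoint has its own
  lower bound for V. Truncation at N does not increase the Fefferman-Phong norm, and once k^2 >=
  \<delta> it preserves the lower bound \<delta> / k^2 as well.\<close>

lemma dderiv_eqI: "(f has_derivative f') (at z) \<Longrightarrow> dderiv h f z = f' h"
  unfolding dderiv_def by (metis frechet_derivative_at)

lemma has_derivative_dderiv:
  "f differentiable (at z) \<Longrightarrow> (f has_derivative (\<lambda>h. dderiv h f z)) (at z)"
  unfolding dderiv_def using frechet_derivative_works by blast

lemma C_k_differentiable: "C_k (Suc k) f \<Longrightarrow> f differentiable (at z)"
  by simp

lemma C_k_continuous: "C_k k f \<Longrightarrow> continuous_on UNIV f"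
  by (cases k) (auto intro!: differentiable_imp_continuous_on simp: differentiable_on_def)

lemma C_k_SucD: "C_k (Suc k) f \<Longrightarrow> C_k k f"
proof (induction k arbitrary: f)
  case 0
  then show ?case using C_k_continuous[of "Suc 0" f] by simp
next
  case (Suc k)
  show ?case
    unfolding C_k.simps(2)[of k] using Suc by (meson C_k.simps(2))
qed

definition smooth :: "('a::real_normed_vector \<Rightarrow> 'b::real_normed_vector) \<Rightarrow> bool" where
  "smooth f \<longleftrightarrow> (\<forall>k. C_k k f)"

lemma smooth_differentiable: "smooth f \<Longrightarrow> f differentiable (at z)"
  unfolding smooth_def using C_k_differentiable by blast

lemma smooth_dderiv: "smooth f \<Longrightarrow> smooth (dderiv h f)"
  unfolding smooth_def by (meson C_k.simps(2))

lemma smooth_continuous: "smooth f \<Longrightarrow> continuous_on UNIV f"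
  unfolding smooth_def using C_k_continuous by blast

lemma C_k_const: "C_k k (\<lambda>_. c)"
proof (induction k arbitrary: c)
  case (Suc k)
  have "dderiv h (\<lambda>_::'a. c) = (\<lambda>_. 0)" for h
    by (intro ext dderiv_eqI) (rule has_derivative_const)
  with Suc show ?case by simp
qed simp

lemma C_k_add:
  assumes "C_k k f" "C_k k g"
  shows "C_k k (\<lambda>z. f z + g z)"
  using assms
proof (induction k arbitrary: f g)
  case 0
  then show ?case by (auto intro: continuous_intros)
next
  case (Suc k)
  have "dderiv h (\<lambda>z. f z + g z) = (\<lambda>z. dderiv h f z + dderiv h g z)" for h
    using Suc.prems by (intro ext dderiv_eqI has_derivative_add has_derivative_dderiv) auto
  with Suc show ?case by simp
qed

lemma dderiv_bounded_linear:
  assumes "bounded_linear L" "\<And>z. f differentiable (at z)"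
  shows "dderiv h (\<lambda>z. L (f z)) = (\<lambda>z. L (dderiv h f z))"
  by (intro ext dderiv_eqI) (rule bounded_linear.has_derivative[OF assms(1) has_derivative_dderiv[OF assms(2)]])

lemma C_k_bounded_linear:
  assumes L: "bounded_linear L" and "C_k k f"
  shows "C_k k (\<lambda>z. L (f z))"
  using assms(2)
proof (induction k arbitrary: f)
  case 0
  then show ?case using bounded_linear.continuous_on[OF L] by auto
next
  case (Suc k)
  then have d: "f differentiable (at z)" for z by auto
  have "(\<lambda>z. L (f z)) differentiable (at z)" for z
    using bounded_linear.has_derivative[OF L has_derivative_dderiv[OF d]]
    by (auto simp: differentiable_def)
  with Suc show ?case
    by (simp add: dderiv_bounded_linear[OF L d])
qed

lemma dderiv_bilinear:
  assumes "bounded_bilinear pr" "\<And>z. f differentiable (at z)" "\<And>z. g differentiable (at z)"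
  shows "dderiv h (\<lambda>z. pr (f z) (g z)) = (\<lambda>z. pr (f z) (dderiv h g z) + pr (dderiv h f z) (g z))"
  by (intro ext dderiv_eqI)
    (use bounded_bilinear.FDERIV[OF assms(1) has_derivative_dderiv has_derivative_dderiv] assms(2,3) in blast)

text \<open>The product rule leaves one factor undifferentiated, and the induction hypothesis wants
  it in \<open>C_k k\<close>; \<open>C_k_SucD\<close> lowers its order.\<close>

lemma C_k_bilinear:
  assumes P: "bounded_bilinear pr" and "C_k k f" "C_k k g"
  shows "C_k k (\<lambda>z. pr (f z) (g z))"
  using assms(2,3)
proof (induction k arbitrary: f g)
  case 0
  then show ?case using bounded_bilinear.continuous_on[OF P] by auto
next
  case (Suc k)
  have d: "f differentiable (at z)" "g differentiable (at z)" for z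
    using Suc.prems by auto
  have "(\<lambda>z. pr (f z) (g z)) differentiable (at z)" for z
    using bounded_bilinear.FDERIV[OF P has_derivative_dderiv[OF d(1)] has_derivative_dderiv[OF d(2)]]
    by (auto simp: differentiable_def)
  moreover have "C_k k f" "C_k k g"
    using Suc.prems C_k_SucD by blast+
  ultimately show ?case
    using Suc by (simp add: dderiv_bilinear[OF P d] C_k_add)
qed

lemma has_derivative_affine_compose:
  assumes A: "bounded_linear A" and "f differentiable (at (A z + c))"
  shows "((\<lambda>z. f (A z + c)) has_derivative (\<lambda>h. dderiv (A h) f (A z + c))) (at z)"
proof -
  have "((\<lambda>z. A z + c) has_derivative A) (at z)"
    using has_derivative_add[OF bounded_linear_imp_has_derivative[OF A] has_derivative_const] by simp
  from diff_chain_at[OF this has_derivative_dderiv[OF assms(2)]]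
  show ?thesis by (simp add: o_def)
qed

lemma dderiv_affine:
  assumes "bounded_linear A" "\<And>z. f differentiable (at z)"
  shows "dderiv h (\<lambda>z. f (A z + c)) = (\<lambda>z. dderiv (A h) f (A z + c))"
  by (intro ext dderiv_eqI) (rule has_derivative_affine_compose[OF assms])

text \<open>Dilations, translations and the reflections \<open>y \<mapsto> z - y\<close> inside a
  convolution are all instances.\<close>

lemma C_k_affine:
  assumes A: "bounded_linear A" and "C_k k f"
  shows "C_k k (\<lambda>z. f (A z + c))"
  using assms(2)
proof (induction k arbitrary: f)
  case 0
  have "continuous_on UNIV (\<lambda>z. A z + c)"
    by (intro continuous_intros linear_continuous_on A)
  with 0 show ?case
    using continuous_on_compose2[of UNIV f UNIV "\<lambda>z. A z + c"] by auto
next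
  case (Suc k)
  have d: "f differentiable (at z)" for z
    using Suc.prems by auto
  have "(\<lambda>z. f (A z + c)) differentiable (at z)" for z
    using has_derivative_affine_compose[OF A d] by (auto simp: differentiable_def)
  with Suc show ?case
    by (simp add: dderiv_affine[OF A d])
qed

lemma C_k_ident_linear:
  assumes A: "bounded_linear A"
  shows "C_k k A"
proof (cases k)
  case 0
  then show ?thesis using linear_continuous_on[OF A] by simp
next
  case (Suc m)
  have "dderiv h A = (\<lambda>_. A h)" for h
    by (intro ext dderiv_eqI bounded_linear_imp_has_derivative A)
  moreover have "A differentiable (at z)" for z
    using bounded_linear_imp_has_derivative[OF A] unfolding differentiable_def by blast
  ultimately show ?thesis
    using Suc by (simp add: C_k_const)
qed

section \<open>Functions flat at 0 and the bump built from them\<close>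

definition flat :: "nat \<Rightarrow> real \<Rightarrow> real" where
  "flat m x = (if x \<le> 0 then 0 else exp (- (1 / x)) / x ^ m)"

text \<open>With y = 1/x this is the decay of y^m / exp y at infinity.\<close>

lemma flat_tendsto_0: "(flat m \<longlongrightarrow> 0) (at_right 0)"
proof -
  have "((\<lambda>y::real. y ^ m / exp y) \<longlongrightarrow> 0) at_top"
    using tendsto_power_div_exp_0[of m] by simp
  then have "((\<lambda>x. (inverse x) ^ m / exp (inverse x)) \<longlongrightarrow> (0::real)) (at_right 0)"
    by (rule filterlim_compose) (rule filterlim_inverse_at_top_right)
  then show ?thesis
    by (rule Lim_transform_eventually)
      (auto simp: eventually_at_filter flat_def field_simps exp_minus)
qed

text \<open>The difference quotient of \<open>flat m\<close> at 0 is \<open>flat (Suc m)\<close> on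
  the right and 0 on the left, so the derivative at 0 is the limit of the next member of the
  family.\<close>

lemma flat_0_deriv: "(flat m has_real_derivative 0) (at 0)"
proof -
  have r: "((\<lambda>x. flat m x / x) \<longlongrightarrow> 0) (at_right 0)"
    by (rule Lim_transform_eventually[OF flat_tendsto_0[of "Suc m"]])
      (auto simp: eventually_at_filter flat_def field_simps)
  have l: "((\<lambda>x. flat m x / x) \<longlongrightarrow> 0) (at_left 0)"
    by (rule Lim_transform_eventually[OF tendsto_const])
      (auto simp: eventually_at_filter flat_def)
  show ?thesis
    using filterlim_split_at[OF l r] by (simp add: has_field_derivative_iff flat_def)
qed

text \<open>The powers of x in the denominator make the family closed under differentiation up to
  linear combinations; the single function exp (-1/x) is not.\<close>

lemma flat_deriv:
  "(flat m has_real_derivative flat (m + 2) x - real m * flat (m + 1) x) (at x)"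
proof -
  consider "x < 0" | "x = 0" | "x > 0" by linarith
  then show ?thesis
  proof cases
    case 1
    have "((\<lambda>_. 0) has_real_derivative 0) (at x)" by simp
    then have "(flat m has_real_derivative 0) (at x)"
      by (rule has_field_derivative_transform_within_open[where S = "{..<0}"])
        (use 1 in \<open>auto simp: flat_def\<close>)
    then show ?thesis using 1 by (simp add: flat_def)
  next
    case 2
    then show ?thesis using flat_0_deriv by (simp add: flat_def)
  next
    case 3
    have e: "((\<lambda>x. exp (- (1 / x))) has_real_derivative exp (- (1 / x)) * (1 / (x * x))) (at x)"
      using 3 by (auto intro!: derivative_eq_intros)
    have p: "((\<lambda>x. x ^ m) has_real_derivative real m * x ^ (m - 1)) (at x)"
      using DERIV_pow[of m x] by simp
    have eq: "(exp (- (1 / x)) * (1 / (x * x)) * x ^ m - exp (- (1 / x)) * (real m * x ^ (m - 1)))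
        / (x ^ m * x ^ m) = flat (m + 2) x - real m * flat (m + 1) x"
      using 3 by (cases m) (simp_all add: flat_def divide_simps power2_eq_square, simp_all add: algebra_simps)
    have "((\<lambda>x. exp (- (1 / x)) / x ^ m) has_real_derivative
        flat (m + 2) x - real m * flat (m + 1) x) (at x)"
      using DERIV_divide[OF e p] 3 unfolding eq by simp
    then show ?thesis
      by (rule has_field_derivative_transform_within_open[where S = "{0<..}"])
        (use 3 in \<open>auto simp: flat_def\<close>)
  qed
qed

text \<open>The argument 1 - |z|^2 instead of 1 - |z| avoids the singularity of the norm at the
  origin.\<close>

definition bumpm :: "nat \<Rightarrow> 'a::euclidean_space \<Rightarrow> real" where
  "bumpm m z = flat m (1 - z \<bullet> z)"

lemma bumpm_has_derivative:
  "(bumpm m has_derivative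
     (\<lambda>h. (bumpm (m + 2) z - real m * bumpm (m + 1) z) * (-2 * (h \<bullet> z)))) (at z)"
proof -
  have "((\<lambda>z. 1 - z \<bullet> z) has_derivative (\<lambda>h. -2 * (h \<bullet> z))) (at z)"
    by (auto intro!: derivative_eq_intros simp: inner_commute)
  from has_derivative_compose[OF this flat_deriv[THEN has_field_derivative_imp_has_derivative]]
  show ?thesis
    unfolding bumpm_def[abs_def] .
qed

text \<open>A derivative of the member m involves the members m + 1 and m + 2 and a linear factor,
  so the induction on the order runs for all m simultaneously.\<close>

lemma C_k_bumpm: "C_k k (bumpm m :: 'a::euclidean_space \<Rightarrow> real)"
proof (induction k arbitrary: m)
  case 0
  show ?case
    unfolding C_k.simps by (rule has_derivative_continuous_on) (rule bumpm_has_derivative)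
next
  case (Suc k)
  have "dderiv h (bumpm m :: 'a \<Rightarrow> real) =
      (\<lambda>z. (bumpm (m + 2) z + (- real m) * bumpm (m + 1) z) * ((-2) * (h \<bullet> z)))" for h
    by (intro ext, subst dderiv_eqI[OF bumpm_has_derivative]) simp
  moreover have "C_k k (\<lambda>z::'a. (bumpm (m + 2) z + (- real m) * bumpm (m + 1) z) * ((-2) * (h \<bullet> z)))" for h
    by (intro C_k_bilinear[OF bounded_bilinear_mult] C_k_add Suc.IH C_k_const C_k_ident_linear
        bounded_linear_inner_right)
  moreover have "(bumpm m :: 'a \<Rightarrow> real) differentiable (at z)" for z
    unfolding differentiable_def using bumpm_has_derivative by blast
  ultimately show ?case
    by simp
qed

text \<open>The factor exp 1 normalises the value at the origin to 1, so that the cutoffs bump (z /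
  k) tend to 1 pointwise.\<close>

definition bump :: "'a::euclidean_space \<Rightarrow> real" where
  "bump z = exp 1 * bumpm 0 z"

lemma smooth_bump: "smooth bump"
  unfolding smooth_def bump_def[abs_def]
  by (intro allI C_k_bilinear[OF bounded_bilinear_mult] C_k_const C_k_bumpm)

lemma bump_0: "bump 0 = 1"
  by (simp add: bump_def bumpm_def flat_def flip: exp_add)

lemma bump_nonneg: "bump z \<ge> 0"
  by (simp add: bump_def bumpm_def flat_def)

lemma bump_le_1: "bump z \<le> 1"
proof (cases "z \<bullet> z < 1")
  case True
  then have "1 \<le> 1 / (1 - z \<bullet> z)"
    using inner_ge_zero[of z] by (simp add: field_simps)
  moreover have "bump z = exp (1 + - (1 / (1 - z \<bullet> z)))"
    using True unfolding exp_add by (simp add: bump_def bumpm_def flat_def)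
  ultimately show ?thesis by simp
qed (simp add: bump_def bumpm_def flat_def)

lemma bump_eq_0: "norm z \<ge> 1 \<Longrightarrow> bump z = 0"
  by (simp add: bump_def bumpm_def flat_def dot_square_norm)

lemma bump_minus: "bump (- z) = bump z"
  by (simp add: bump_def bumpm_def)

lemma dderiv_bump_0: "dderiv h bump 0 = 0"
proof -
  have "(bump has_derivative (\<lambda>h. 0)) (at (0::'a))"
    using has_derivative_mult_right[OF bumpm_has_derivative[of 0 "0::'a"], of "exp 1"]
    unfolding bump_def[abs_def] by simp
  then show ?thesis
    by (rule dderiv_eqI)
qed

section \<open>Continuity of translations in the mean\<close>

lemma nn_integral_lborel_translate:
  assumes [measurable]: "g \<in> borel_measurable borel"
  shows "(\<integral>\<^sup>+ z. g (c + z) \<partial>lborel) = (\<integral>\<^sup>+ z. g (z::'a::euclidean_space) \<partial>lborel)"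
proof -
  have "(\<integral>\<^sup>+ z. g z \<partial>lborel) = (\<integral>\<^sup>+ z. g z \<partial>(distr lborel borel ((+) c)))"
    by (simp add: lborel_distr_plus)
  also have "\<dots> = (\<integral>\<^sup>+ z. g (c + z) \<partial>lborel)"
    by (subst nn_integral_distr) auto
  finally show ?thesis ..
qed

text \<open>For z in the open set U also y + z lies in U once y is small, depending on z. Dominated
  convergence along a sequence tending to 0 that violates the bound removes this dependence.\<close>

lemma open_translation_small:
  fixes U :: "'a::euclidean_space set"
  assumes U: "open U" "emeasure lborel U < \<infinity>" and "e > 0"
  shows "\<exists>d>0. \<forall>y. norm y < d \<longrightarrow>
    (\<integral>\<^sup>+ z. indicator U z * indicator (- U) (y + z) \<partial>lborel) \<le> ennreal e"
proof (rule ccontr)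
  assume "\<not> ?thesis"
  then have "\<forall>n. \<exists>y. norm y < 1 / real (Suc n) \<and>
      (\<integral>\<^sup>+ z. indicator U z * indicator (- U) (y + z) \<partial>lborel) > ennreal e"
    by (metis not_le of_nat_0_less_iff zero_less_Suc zero_less_divide_1_iff)
  then obtain y where y: "\<And>n. norm (y n) < 1 / real (Suc n)"
    and ge: "\<And>n. (\<integral>\<^sup>+ z. indicator U z * indicator (- U) (y n + z) \<partial>lborel) > ennreal e"
    by metis
  have y0: "y \<longlonglongrightarrow> 0"
    by (rule LIMSEQ_norm_0) (use y in auto)
  have [measurable]: "U \<in> sets borel" using U by auto
  have "(\<lambda>n. \<integral>\<^sup>+ z. indicator U z * indicator (- U) (y n + z) \<partial>lborel) \<longlonglongrightarrow> (\<integral>\<^sup>+ z. 0 \<partial>(lborel::'a measure))"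
  proof (rule nn_integral_dominated_convergence[where w = "indicator U"])
    show "AE z in lborel. (\<lambda>n. indicator U z * indicator (- U) (y n + z)) \<longlonglongrightarrow> (0::ennreal)"
    proof (intro AE_I2 tendsto_eventually)
      fix z
      have "(\<lambda>n. y n + z) \<longlonglongrightarrow> z"
        using tendsto_add[OF y0 tendsto_const[of z]] by simp
      from topological_tendstoD[OF this U(1)]
      show "\<forall>\<^sub>F n in sequentially. indicator U z * indicator (- U) (y n + z) = (0::ennreal)"
        by (cases "z \<in> U") (auto elim!: eventually_mono)
    qed
  qed (use U in \<open>auto split: split_indicator\<close>)
  then have "(\<lambda>n. \<integral>\<^sup>+ z. indicator U z * indicator (- U) (y n + z) \<partial>lborel) \<longlonglongrightarrow> 0"
    by simp
  then have "\<forall>\<^sub>F n in sequentially. (\<integral>\<^sup>+ z. indicator U z * indicator (- U) (y n + z) \<partial>lborel) < ennreal e"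
    by (rule order_tendstoD) (use \<open>e > 0\<close> in auto)
  then show False
    using ge by (auto simp: eventually_sequentially dest: order.asym)
qed

text \<open>Approximation by simple functions: indicators are handled through open supersets, where
  continuity of translations is a pointwise matter, and the estimate survives sums and dominated
  limits.\<close>

lemma translation_L1_continuous:
  fixes f :: "'a::euclidean_space \<Rightarrow> 'b::{banach, second_countable_topology}"
  assumes "integrable lborel f" "e > 0"
  shows "\<exists>d>0. \<forall>y. norm y < d \<longrightarrow>
    (\<integral>\<^sup>+ z. ennreal (norm (f (y + z) - f z)) \<partial>lborel) \<le> ennreal e"
  using assms
proof (induct arbitrary: e rule: integrable_induct)
  case (base A c)
  \<comment> \<open>Four error terms of size k occur below; the 1 covers c = 0.\<close>
  define k where "k = e / (4 * (norm c + 1))"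
  have k: "k > 0" unfolding k_def using base by (intro divide_pos_pos mult_pos_pos add_nonneg_pos) auto
  have [measurable]: "A \<in> sets borel" using base by simp
  then have "A \<in> sets lebesgue" by auto
  from sets_lebesgue_outer_open[OF this k]
  obtain U where U: "open U" "A \<subseteq> U" "U - A \<in> lmeasurable" "emeasure lebesgue (U - A) < ennreal k" .
  have [measurable]: "U \<in> sets borel" using U by auto
  have UA: "emeasure lborel (U - A) < ennreal k"
    using U by (simp add: emeasure_completion)
  have "emeasure lborel U \<le> emeasure lborel A + emeasure lborel (U - A)"
    using U(2) by (subst emeasure_Un[symmetric] | simp add: emeasure_subadditive Un_absorb1)+
  also have "\<dots> < \<infinity>"
    using base UA by (simp add: ennreal_add_less_top) (metis ennreal_less_top order_less_trans top.not_eq_extremum less_top)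
  finally have Ufin: "emeasure lborel U < \<infinity>" .
  from open_translation_small[OF U(1) Ufin k]
  obtain d where d: "d > 0" and small: "\<And>y. norm y < d \<Longrightarrow>
    (\<integral>\<^sup>+ z. indicator U z * indicator (- U) (y + z) \<partial>lborel) \<le> ennreal k" by blast
  show ?case
  proof (intro exI[of _ d] conjI d allI impI)
    fix y :: 'a assume y: "norm y < d"
    \<comment> \<open>If exactly one of z and y + z lies in A, then one of the two lies in U - A, or
      one lies in U and the other one does not.\<close>
    let ?I = "\<lambda>z. indicator (U - A) (y + z) + indicator (U - A) z + indicator U z * indicator (- U) (y + z)
        + indicator U (y + z) * indicator (- U) z :: ennreal"
    have 1: "(\<integral>\<^sup>+ z. indicator (U - A) (y + z) \<partial>lborel) \<le> ennreal k"
      using nn_integral_lborel_translate[of "indicator (U - A)" y] UA by simp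
    have 2: "(\<integral>\<^sup>+ z. indicator (U - A) z \<partial>lborel) \<le> ennreal k"
      using UA by simp
    have 3: "(\<integral>\<^sup>+ z. indicator U (y + z) * indicator (- U) z \<partial>lborel) \<le> ennreal k"
      using nn_integral_lborel_translate[of "\<lambda>z. indicator U z * indicator (- U) (- y + z)" y] small[of "- y"] y by simp
    have "(\<integral>\<^sup>+ z. ennreal (norm (indicat_real A (y + z) *\<^sub>R c - indicat_real A z *\<^sub>R c)) \<partial>lborel)
        \<le> (\<integral>\<^sup>+ z. ennreal (norm c) * ?I z \<partial>lborel)"
      using U(2) by (intro nn_integral_mono) (auto simp: indicator_def split: if_splits)
    also have "\<dots> = ennreal (norm c) * (\<integral>\<^sup>+ z. ?I z \<partial>lborel)"
      by (rule nn_integral_cmult) measurable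
    also have "(\<integral>\<^sup>+ z. ?I z \<partial>lborel) = (\<integral>\<^sup>+ z. indicator (U - A) (y + z) \<partial>lborel) + (\<integral>\<^sup>+ z. indicator (U - A) z \<partial>lborel)
       + (\<integral>\<^sup>+ z. indicator U z * indicator (- U) (y + z) \<partial>lborel) + (\<integral>\<^sup>+ z. indicator U (y + z) * indicator (- U) z \<partial>lborel)"
      by (simp add: nn_integral_add)
    also have "\<dots> \<le> ennreal k + ennreal k + ennreal k + ennreal k"
      by (intro add_mono 1 2 3 small y)
    also have "\<dots> = ennreal (4 * k)"
      using k by (simp flip: ennreal_plus)
    also have "ennreal (norm c) * ennreal (4 * k) = ennreal (norm c * (4 * k))"
      by (rule ennreal_mult'[symmetric]) simp
    also have "\<dots> \<le> ennreal e"
      using base by (intro ennreal_leI) (simp add: k_def field_simps add_pos_nonneg)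
    finally show "(\<integral>\<^sup>+ z. ennreal (norm (indicat_real A (y + z) *\<^sub>R c - indicat_real A z *\<^sub>R c)) \<partial>lborel) \<le> ennreal e"
      by (simp add: mult_left_mono)
  qed
next
  case (add f g)
  have [measurable]: "f \<in> borel_measurable borel" "g \<in> borel_measurable borel"
    using add by (auto dest: borel_measurable_integrable)
  from add(2)[of "e/2"] add(4)[of "e/2"] add(5) obtain d1 d2 where d: "d1 > 0" "d2 > 0"
    and b: "\<And>y. norm y < d1 \<Longrightarrow> (\<integral>\<^sup>+ z. ennreal (norm (f (y + z) - f z)) \<partial>lborel) \<le> ennreal (e/2)"
    "\<And>y. norm y < d2 \<Longrightarrow> (\<integral>\<^sup>+ z. ennreal (norm (g (y + z) - g z)) \<partial>lborel) \<le> ennreal (e/2)"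
    by (meson half_gt_zero)
  show ?case
  proof (intro exI[of _ "min d1 d2"] conjI allI impI)
    fix y :: 'a assume y: "norm y < min d1 d2"
    have "(\<integral>\<^sup>+ z. ennreal (norm (f (y + z) + g (y + z) - (f z + g z))) \<partial>lborel)
       \<le> (\<integral>\<^sup>+ z. ennreal (norm (f (y + z) - f z)) + ennreal (norm (g (y + z) - g z)) \<partial>lborel)"
      by (intro nn_integral_mono) (auto simp flip: ennreal_plus intro!: ennreal_leI norm_diff_triangle_ineq)
    also have "\<dots> = (\<integral>\<^sup>+ z. ennreal (norm (f (y + z) - f z)) \<partial>lborel) + (\<integral>\<^sup>+ z. ennreal (norm (g (y + z) - g z)) \<partial>lborel)"
      by (rule nn_integral_add) measurable
    also have "\<dots> \<le> ennreal (e/2) + ennreal (e/2)"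
      using b y by (intro add_mono) auto
    also have "\<dots> = ennreal e"
      using add(5) by (simp flip: ennreal_plus)
    finally show "(\<integral>\<^sup>+ z. ennreal (norm (f (y + z) + g (y + z) - (f z + g z))) \<partial>lborel) \<le> ennreal e" .
  qed (use d in auto)
next
  case (lim f s)
  have [measurable]: "f \<in> borel_measurable borel" "\<And>i. s i \<in> borel_measurable borel"
    using lim by (auto dest: borel_measurable_integrable)
  \<comment> \<open>The approximants satisfy |s i| <= 2 |f|, whence the majorant 3 |f|.\<close>
  have "(\<lambda>i. \<integral>\<^sup>+ z. ennreal (norm (s i z - f z)) \<partial>lborel) \<longlonglongrightarrow> (\<integral>\<^sup>+ z. 0 \<partial>(lborel::'a measure))"
  proof (rule nn_integral_dominated_convergence[where w = "\<lambda>z. ennreal (3 * norm (f z))"])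
    have "integrable lborel (\<lambda>z. 3 * norm (f z))" using lim by simp
    then show "(\<integral>\<^sup>+ z. ennreal (3 * norm (f z)) \<partial>lborel) < \<infinity>"
      by (subst nn_integral_eq_integral) auto
    show "AE z in lborel. ennreal (norm (s i z - f z)) \<le> ennreal (3 * norm (f z))" for i
    proof (intro AE_I2 ennreal_leI)
      fix z :: 'a
      show "norm (s i z - f z) \<le> 3 * norm (f z)"
        using lim(4)[of z i] norm_triangle_ineq4[of "s i z" "f z"] by simp
    qed
    show "AE z in lborel. (\<lambda>i. ennreal (norm (s i z - f z))) \<longlonglongrightarrow> 0"
    proof (intro AE_I2)
      fix z :: 'a
      have "(\<lambda>i. norm (s i z - f z)) \<longlonglongrightarrow> norm (f z - f z)"
        by (intro tendsto_intros lim(3)) simp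
      then have "(\<lambda>i. ennreal (norm (s i z - f z))) \<longlonglongrightarrow> ennreal 0"
        by (intro tendsto_ennrealI) simp
      then show "(\<lambda>i. ennreal (norm (s i z - f z))) \<longlonglongrightarrow> 0" by simp
    qed
  qed auto
  then have "\<forall>\<^sub>F i in sequentially. (\<integral>\<^sup>+ z. ennreal (norm (s i z - f z)) \<partial>lborel) < ennreal (e/3)"
    by (intro order_tendstoD) (use lim(6) in auto)
  then obtain i where i: "(\<integral>\<^sup>+ z. ennreal (norm (s i z - f z)) \<partial>lborel) \<le> ennreal (e/3)"
    using eventually_happens'[OF sequentially_bot] by (blast intro: less_imp_le)
  have "e / 3 > 0" using lim(6) by simp
  from lim(2)[OF this, of i] obtain d where d: "d > 0"
    and b: "\<And>y. norm y < d \<Longrightarrow> (\<integral>\<^sup>+ z. ennreal (norm (s i (y + z) - s i z)) \<partial>lborel) \<le> ennreal (e/3)"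
    by blast
  show ?case
  proof (intro exI[of _ d] conjI d allI impI)
    fix y :: 'a assume y: "norm y < d"
    have tr: "(\<integral>\<^sup>+ z. ennreal (norm (s i (y + z) - f (y + z))) \<partial>lborel) \<le> ennreal (e/3)"
      using i nn_integral_lborel_translate[of "\<lambda>z. ennreal (norm (s i z - f z))" y] by simp
    have tri: "norm (f (y + z) - f z) \<le> norm (s i (y + z) - f (y + z)) + norm (s i z - f z) + norm (s i (y + z) - s i z)" for z
      using norm_triangle_ineq4[of "s i (y + z) - s i z" "(s i (y + z) - f (y + z)) - (s i z - f z)"]
        norm_triangle_ineq4[of "s i (y + z) - f (y + z)" "s i z - f z"] by (simp add: algebra_simps)
    have "(\<integral>\<^sup>+ z. ennreal (norm (f (y + z) - f z)) \<partial>lborel)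
       \<le> (\<integral>\<^sup>+ z. ennreal (norm (s i (y + z) - f (y + z))) + ennreal (norm (s i z - f z)) + ennreal (norm (s i (y + z) - s i z)) \<partial>lborel)"
      by (intro nn_integral_mono) (use tri in \<open>auto simp flip: ennreal_plus intro!: ennreal_leI\<close>)
    also have "\<dots> = (\<integral>\<^sup>+ z. ennreal (norm (s i (y + z) - f (y + z))) \<partial>lborel)
       + (\<integral>\<^sup>+ z. ennreal (norm (s i z - f z)) \<partial>lborel) + (\<integral>\<^sup>+ z. ennreal (norm (s i (y + z) - s i z)) \<partial>lborel)"
      by (subst nn_integral_add; simp)+
    also have "\<dots> \<le> ennreal (e/3) + ennreal (e/3) + ennreal (e/3)"
      using b y i tr by (intro add_mono) auto
    also have "\<dots> = ennreal e"
      using lim by (simp flip: ennreal_plus)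
    finally show "(\<integral>\<^sup>+ z. ennreal (norm (f (y + z) - f z)) \<partial>lborel) \<le> ennreal e" .
  qed
qed

section \<open>Convolution and mollification\<close>

definition real_test :: "('a::euclidean_space \<Rightarrow> real) \<Rightarrow> bool" where
  "real_test \<phi> \<longleftrightarrow> smooth \<phi> \<and> bounded {z. \<phi> z \<noteq> 0}"

lemma bounded_support_iff:
  "bounded {z. \<phi> z \<noteq> 0} \<longleftrightarrow> (\<exists>r. \<forall>z. norm z \<ge> r \<longrightarrow> \<phi> z = 0)"
  (is "?L = ?R")
proof
  assume ?L
  then obtain r where "\<And>z. \<phi> z \<noteq> 0 \<Longrightarrow> norm z \<le> r"
    by (auto simp: bounded_iff)
  then have "\<forall>z. norm z \<ge> r + 1 \<longrightarrow> \<phi> z = 0"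
    by force
  then show ?R ..
next
  assume ?R
  then show ?L
    unfolding bounded_iff by (metis (mono_tags, lifting) mem_Collect_eq nle_le)
qed

lemma real_test_measurable: "real_test \<phi> \<Longrightarrow> \<phi> \<in> borel_measurable borel"
  unfolding real_test_def by (intro borel_measurable_continuous_onI smooth_continuous) auto

lemma real_test_dderiv:
  assumes "real_test \<phi>"
  shows "real_test (dderiv h \<phi>)"
proof -
  obtain r where r: "\<And>z. norm z \<ge> r \<Longrightarrow> \<phi> z = 0"
    using assms unfolding real_test_def bounded_support_iff by blast
  \<comment> \<open>The margin 1 puts z into the open set where \<phi> vanishes identically, so that
    the derivative is 0 as well.\<close>
  have "dderiv h \<phi> z = 0" if "norm z \<ge> r + 1" for z
  proof (rule dderiv_eqI)
    show "(\<phi> has_derivative (\<lambda>_. 0)) (at z)"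
    proof (rule has_derivative_transform_within_open[where s = "{w. norm w > r}"])
      show "open {w::'a. norm w > r}"
        by (intro open_Collect_less continuous_intros)
    qed (use that r in auto)
  qed
  then show ?thesis
    using assms smooth_dderiv unfolding real_test_def bounded_support_iff by blast
qed

lemma real_test_bounded:
  assumes "real_test \<phi>"
  obtains B where "B \<ge> 0" "\<And>z. \<bar>\<phi> z\<bar> \<le> B"
proof -
  obtain r where r: "\<And>z. norm z \<ge> r \<Longrightarrow> \<phi> z = 0"
    using assms unfolding real_test_def bounded_support_iff by blast
  have "compact (\<phi> ` cball 0 r)"
    using assms smooth_continuous unfolding real_test_def
    by (intro compact_continuous_image) (auto intro: continuous_on_subset)
  then obtain B where B: "\<And>z. norm z \<le> r \<Longrightarrow> \<bar>\<phi> z\<bar> \<le> B"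
    by (fastforce dest!: compact_imp_bounded simp: bounded_iff)
  show thesis
  proof (rule that[of "max 0 B"])
    show "\<bar>\<phi> z\<bar> \<le> max 0 B" for z
      using B[of z] r[of z] by (cases "norm z \<le> r") auto
  qed simp
qed

lemma linear_dderiv:
  assumes "f differentiable (at z)"
  shows "linear (\<lambda>h. dderiv h f z)"
  using has_derivative_dderiv[OF assms] has_derivative_linear by blast

text \<open>Expanding h in \<open>Basis\<close> reduces a bound uniform over all directions to
  finitely many bounded derivatives; the mean value inequality turns it into a Lipschitz constant.
  Both serve as majorants when a convolution is differentiated.\<close>

lemma real_test_dderiv_bound:
  assumes "real_test \<phi>"
  obtains L where "L \<ge> 0" "\<And>h z. \<bar>dderiv h \<phi> z\<bar> \<le> L * norm h"
    "\<And>z w. \<bar>\<phi> z - \<phi> w\<bar> \<le> L * norm (z - w)"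
proof -
  have d: "\<phi> differentiable (at z)" for z
    using assms smooth_differentiable unfolding real_test_def by blast
  have "\<forall>b. \<exists>B. B \<ge> 0 \<and> (\<forall>z. \<bar>dderiv b \<phi> z\<bar> \<le> B)"
    using real_test_bounded[OF real_test_dderiv[OF assms]] by metis
  then obtain B where B: "\<And>b. B b \<ge> 0" "\<And>b z. \<bar>dderiv b \<phi> z\<bar> \<le> B b"
    by metis
  define L where "L = (\<Sum>b\<in>Basis. B b)"
  have L: "\<bar>dderiv h \<phi> z\<bar> \<le> L * norm h" for h z
  proof -
    have "dderiv h \<phi> z = dderiv (\<Sum>b\<in>Basis. (h \<bullet> b) *\<^sub>R b) \<phi> z"
      by (simp add: euclidean_representation)
    also have "\<dots> = (\<Sum>b\<in>Basis. (h \<bullet> b) * dderiv b \<phi> z)"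
      by (simp add: linear_sum[OF linear_dderiv[OF d]] linear_cmul[OF linear_dderiv[OF d]])
    finally have "\<bar>dderiv h \<phi> z\<bar> \<le> (\<Sum>b\<in>Basis. \<bar>(h \<bullet> b) * dderiv b \<phi> z\<bar>)"
      by simp
    also have "\<dots> \<le> (\<Sum>b\<in>Basis. norm h * B b)"
      by (intro sum_mono) (auto simp: abs_mult intro!: mult_mono B Basis_le_norm)
    finally show ?thesis
      by (simp add: L_def sum_distrib_left mult.commute)
  qed
  moreover have "L \<ge> 0"
    using B by (auto simp: L_def intro: sum_nonneg)
  moreover have "\<bar>\<phi> z - \<phi> w\<bar> \<le> L * norm (z - w)" for z w
    using differentiable_bound[of UNIV \<phi> "\<lambda>z h. dderiv h \<phi> z" L z w] has_derivative_dderiv[OF d]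
      onorm_le[of "\<lambda>h. dderiv h \<phi> x" L for x] L(1) by auto
  ultimately show thesis using that by blast
qed

lemma integrable_bounded_scaleR:
  fixes f :: "'a \<Rightarrow> 'b::{banach, second_countable_topology}"
  assumes "integrable M f" "g \<in> borel_measurable M" "\<And>x. \<bar>g x\<bar> \<le> B"
  shows "integrable M (\<lambda>x. g x *\<^sub>R f x)"
proof (rule Bochner_Integration.integrable_bound)
  show "integrable M (\<lambda>x. B *\<^sub>R norm (f x))"
    using assms(1) by auto
  show "(\<lambda>x. g x *\<^sub>R f x) \<in> borel_measurable M"
    using assms(1,2) by auto
  have "\<bar>g x\<bar> * norm (f x) \<le> \<bar>B\<bar> * norm (f x)" for x
    using assms(3)[of x] by (intro mult_right_mono) auto
  then show "AE x in M. norm (g x *\<^sub>R f x) \<le> norm (B *\<^sub>R norm (f x))"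
    by (simp add: abs_mult)
qed

section \<open>Convolution with a test function\<close>

definition conv :: "('a::euclidean_space \<Rightarrow> real) \<Rightarrow> ('a \<Rightarrow> 'b::{banach, second_countable_topology}) \<Rightarrow> 'a \<Rightarrow> 'b"
  where "conv \<phi> f z = (LINT y|lborel. \<phi> (z - y) *\<^sub>R f y)"

lemma conv_integrable:
  fixes f :: "'a::euclidean_space \<Rightarrow> 'b::{banach, second_countable_topology}"
  assumes "real_test \<phi>" "integrable lborel f"
  shows "integrable lborel (\<lambda>y. \<phi> (z - y) *\<^sub>R f y)"
proof -
  have [measurable]: "\<phi> \<in> borel_measurable borel"
    by (rule real_test_measurable[OF assms(1)])
  from real_test_bounded[OF assms(1)] obtain B where "\<And>z. \<bar>\<phi> z\<bar> \<le> B" by blast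
  then show ?thesis
    by (intro integrable_bounded_scaleR[OF assms(2)]) auto
qed

lemma conv_add:
  assumes "real_test \<phi>" "integrable lborel f" "integrable lborel g"
  shows "conv \<phi> (\<lambda>y. f y + g y) z = conv \<phi> f z + conv \<phi> g z"
  unfolding conv_def scaleR_add_right
  by (intro Bochner_Integration.integral_add conv_integrable assms)

text \<open>Differentiation under the integral: the derivative falls on the kernel, so that f has to
  be integrable only. The limit is taken along sequences to suit dominated convergence.\<close>

lemma conv_has_derivative:
  fixes f :: "'a::euclidean_space \<Rightarrow> 'b::{banach, second_countable_topology}"
  assumes \<phi>: "real_test \<phi>" and f: "integrable lborel f"
  shows "(conv \<phi> f has_derivative (\<lambda>h. conv (dderiv h \<phi>) f z)) (at z)"
  unfolding has_derivative_at tendsto_at_iff_sequentially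
proof (intro conjI allI impI)
  have d: "\<phi> differentiable (at z)" for z
    using \<phi> smooth_differentiable unfolding real_test_def by blast
  have [measurable]: "\<phi> \<in> borel_measurable borel" "dderiv h \<phi> \<in> borel_measurable borel" for h
    using real_test_measurable real_test_dderiv \<phi> by blast+
  have [measurable]: "f \<in> borel_measurable borel"
    using f by auto
  note int = conv_integrable[OF real_test_dderiv[OF \<phi>] f] conv_integrable[OF \<phi> f]
  from real_test_dderiv_bound[OF \<phi>] obtain L where L: "L \<ge> 0" "\<And>h z. \<bar>dderiv h \<phi> z\<bar> \<le> L * norm h"
    "\<And>z w. \<bar>\<phi> z - \<phi> w\<bar> \<le> L * norm (z - w)" by blast
  show "bounded_linear (\<lambda>h. conv (dderiv h \<phi>) f z)"
  proof (rule bounded_linear_intro[where K = "L * (LINT y|lborel. norm (f y))"])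
    fix h k :: 'a and r :: real
    show "conv (dderiv (h + k) \<phi>) f z = conv (dderiv h \<phi>) f z + conv (dderiv k \<phi>) f z"
      unfolding conv_def using int
      by (simp add: linear_add[OF linear_dderiv[OF d]] scaleR_add_left)
    show "conv (dderiv (r *\<^sub>R h) \<phi>) f z = r *\<^sub>R conv (dderiv h \<phi>) f z"
      unfolding conv_def by (simp add: linear_cmul[OF linear_dderiv[OF d]] flip: scaleR_scaleR)
    have "norm (conv (dderiv h \<phi>) f z) \<le> (LINT y|lborel. norm (dderiv h \<phi> (z - y) *\<^sub>R f y))"
      unfolding conv_def by (rule integral_norm_bound)
    also have "\<dots> \<le> (LINT y|lborel. (L * norm h) * norm (f y))"
    proof (rule integral_mono)
      show "norm (dderiv h \<phi> (z - y) *\<^sub>R f y) \<le> (L * norm h) * norm (f y)" for y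
        using L(2) by (simp add: mult_right_mono)
      show "integrable lborel (\<lambda>y. norm (dderiv h \<phi> (z - y) *\<^sub>R f y))"
        by (intro integrable_norm int)
    qed (use f in auto)
    finally show "norm (conv (dderiv h \<phi>) f z) \<le> norm h * (L * (LINT y|lborel. norm (f y)))"
      by (simp add: mult_ac)
  qed
  fix X :: "nat \<Rightarrow> 'a" assume X: "\<forall>i. X i \<in> UNIV - {0}" "X \<longlonglongrightarrow> 0"
  \<comment> \<open>The remainder in the difference quotient of \<phi>. It tends to 0 pointwise and
    is at most 2 L: one L from the Lipschitz bound, one from the derivative.\<close>
  define q where "q i y = (\<phi> (z + X i - y) - \<phi> (z - y) - dderiv (X i) \<phi> (z - y)) / norm (X i)" for i y
  have [measurable]: "q i \<in> borel_measurable borel" for i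
    unfolding q_def by measurable
  have eq: "norm (conv \<phi> f (z + X i) - conv \<phi> f z - conv (dderiv (X i) \<phi>) f z) / norm (X i)
      = norm (LINT y|lborel. q i y *\<^sub>R f y)" for i
  proof -
    have "(LINT y|lborel. q i y *\<^sub>R f y) = (LINT y|lborel. (1 / norm (X i)) *\<^sub>R
        (\<phi> (z + X i - y) *\<^sub>R f y - \<phi> (z - y) *\<^sub>R f y - dderiv (X i) \<phi> (z - y) *\<^sub>R f y))"
      by (simp only: q_def scaleR_diff_left[symmetric] scaleR_scaleR times_divide_eq_left mult_1_left)
    also have "\<dots> = (1 / norm (X i)) *\<^sub>R (conv \<phi> f (z + X i) - conv \<phi> f z - conv (dderiv (X i) \<phi>) f z)"
      unfolding conv_def by (simp only: integral_scaleR_right Bochner_Integration.integral_diff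
          Bochner_Integration.integrable_diff int)
    finally show ?thesis by simp
  qed
  have "(\<lambda>i. LINT y|lborel. q i y *\<^sub>R f y) \<longlonglongrightarrow> (LINT (y::'a)|lborel. 0)"
  proof (rule integral_dominated_convergence[where w = "\<lambda>y. (2 * L) * norm (f y)"])
    show "AE y in lborel. (\<lambda>i. q i y *\<^sub>R f y) \<longlonglongrightarrow> 0"
    proof (intro AE_I2)
      fix y
      have "(\<lambda>h. norm (\<phi> (z - y + h) - \<phi> (z - y) - dderiv h \<phi> (z - y)) / norm h) \<midarrow>0\<rightarrow> 0"
        using has_derivative_dderiv[OF d, of "z - y"] unfolding has_derivative_at by blast
      then have "((\<lambda>h. norm (\<phi> (z - y + h) - \<phi> (z - y) - dderiv h \<phi> (z - y)) / norm h) \<circ> X) \<longlonglongrightarrow> 0"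
        unfolding tendsto_at_iff_sequentially using X by blast
      then have "(\<lambda>i. norm (q i y)) \<longlonglongrightarrow> 0"
        by (simp add: q_def o_def algebra_simps)
      then have "(\<lambda>i. q i y) \<longlonglongrightarrow> 0"
        by (rule tendsto_norm_zero_cancel)
      from tendsto_scaleR[OF this tendsto_const[of "f y"]] show "(\<lambda>i. q i y *\<^sub>R f y) \<longlonglongrightarrow> 0"
        by simp
    qed
    show "AE y in lborel. norm (q i y *\<^sub>R f y) \<le> 2 * L * norm (f y)" for i
    proof (intro AE_I2)
      fix y
      have "\<bar>\<phi> (z + X i - y) - \<phi> (z - y) - dderiv (X i) \<phi> (z - y)\<bar> \<le> L * norm (X i) + L * norm (X i)"
        using L(2)[of "X i" "z - y"] L(3)[of "z + X i - y" "z - y"] by (auto simp: algebra_simps)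
      then have "\<bar>q i y\<bar> \<le> 2 * L"
        using X(1) by (auto simp: q_def divide_le_eq algebra_simps)
      then show "norm (q i y *\<^sub>R f y) \<le> 2 * L * norm (f y)"
        by (simp add: mult_right_mono)
    qed
  qed (use f in auto)
  then have "(\<lambda>i. norm (LINT y|lborel. q i y *\<^sub>R f y)) \<longlonglongrightarrow> 0"
    by (auto dest: tendsto_norm)
  then show "((\<lambda>h. norm (conv \<phi> f (z + h) - conv \<phi> f z - conv (dderiv h \<phi>) f z) / norm h) \<circ> X) \<longlonglongrightarrow> 0"
    unfolding o_def eq .
qed

lemma dderiv_conv:
  assumes "real_test \<phi>" "integrable lborel f"
  shows "dderiv h (conv \<phi> f) = conv (dderiv h \<phi>) f"
  by (intro ext dderiv_eqI) (rule conv_has_derivative[OF assms])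

lemma C_k_conv:
  assumes "real_test \<phi>" "integrable lborel f"
  shows "C_k k (conv \<phi> f)"
  using assms(1)
proof (induction k arbitrary: \<phi>)
  case 0
  show ?case
    unfolding C_k.simps
    by (rule has_derivative_continuous_on) (rule conv_has_derivative[OF 0 assms(2)])
next
  case (Suc k)
  have "conv \<phi> f differentiable (at z)" for z
    unfolding differentiable_def using conv_has_derivative[OF Suc.prems assms(2)] by blast
  then show ?case
    using Suc.IH[OF real_test_dderiv[OF Suc.prems]] by (simp add: dderiv_conv[OF Suc.prems assms(2)])
qed

lemma conv_measurable [measurable]:
  assumes "real_test \<phi>" "integrable lborel f"
  shows "conv \<phi> f \<in> borel_measurable borel"
  by (intro borel_measurable_continuous_onI C_k_continuous[OF C_k_conv[OF assms, of 0]])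

text \<open>Supports add under convolution: if |y| < r and |z - y| < e, then |z| < r + e.\<close>

lemma conv_eq_0:
  assumes "\<And>y. norm y \<ge> r \<Longrightarrow> f y = 0" "\<And>y. norm y \<ge> e \<Longrightarrow> \<phi> y = 0" "norm z \<ge> r + e"
  shows "conv \<phi> f z = 0"
proof -
  have "(\<lambda>y. \<phi> (z - y) *\<^sub>R f y) = (\<lambda>y. 0)"
  proof
    fix y
    show "\<phi> (z - y) *\<^sub>R f y = 0"
    proof (cases "norm y \<ge> r")
      case False
      then have "norm (z - y) \<ge> e"
        using assms(3) norm_triangle_ineq2[of z y] by simp
      then show ?thesis using assms(2) by simp
    qed (use assms(1) in simp)
  qed
  then show ?thesis by (simp only: conv_def) simp
qed

lemma conv_test_function:
  assumes \<phi>: "real_test \<phi>" and f: "integrable lborel f" and s: "bounded {z. f z \<noteq> 0}"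
  shows "conv \<phi> f \<in> test_functions"
proof -
  obtain r e where re: "\<And>z. norm z \<ge> r \<Longrightarrow> f z = 0" "\<And>z. norm z \<ge> e \<Longrightarrow> \<phi> z = 0"
    using \<phi> s unfolding real_test_def bounded_support_iff by blast
  have "conv \<phi> f z = 0" if "norm z \<ge> r + e" for z
    by (rule conv_eq_0[OF re that])
  then have "bounded {z. conv \<phi> f z \<noteq> 0}"
    unfolding bounded_support_iff by blast
  then show ?thesis
    using C_k_conv[OF \<phi> f] by (simp add: test_functions_def)
qed

section \<open>Rescaling, reflection and products of test functions\<close>

lemma real_test_scaled:
  assumes "real_test \<phi>" "e \<noteq> 0"
  shows "real_test (\<lambda>z. \<phi> (e *\<^sub>R z + c))"
proof -
  obtain r where r: "\<And>z. norm z \<ge> r \<Longrightarrow> \<phi> z = 0"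
    using assms unfolding real_test_def bounded_support_iff by blast
  have "\<phi> (e *\<^sub>R z + c) = 0" if "norm z \<ge> (r + norm c) / \<bar>e\<bar>" for z
  proof (rule r)
    have "r + norm c \<le> norm (e *\<^sub>R z)"
      using that assms(2) by (simp add: divide_le_eq mult.commute)
    then show "norm (e *\<^sub>R z + c) \<ge> r"
      using norm_diff_ineq[of "e *\<^sub>R z" c] by linarith
  qed
  moreover have "smooth (\<lambda>z. \<phi> (e *\<^sub>R z + c))"
    using assms(1) unfolding real_test_def smooth_def
    by (auto intro: C_k_affine[OF bounded_linear_scaleR_right])
  ultimately show ?thesis
    unfolding real_test_def bounded_support_iff by blast
qed

lemma dderiv_scaled:
  assumes "real_test \<phi>"
  shows "dderiv h (\<lambda>z. \<phi> (e *\<^sub>R z + c)) = (\<lambda>z. e * dderiv h \<phi> (e *\<^sub>R z + c))"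
proof -
  have d: "\<phi> differentiable (at z)" for z
    using assms smooth_differentiable unfolding real_test_def by blast
  show ?thesis
    by (subst dderiv_affine[OF bounded_linear_scaleR_right d])
      (simp add: linear_cmul[OF linear_dderiv[OF d]])
qed

lemma real_test_mult:
  assumes "real_test \<phi>" "real_test \<psi>"
  shows "real_test (\<lambda>z. \<phi> z * \<psi> z)"
proof -
  have "bounded {z. \<phi> z * \<psi> z \<noteq> 0}"
    using assms(1) unfolding real_test_def by (auto elim!: bounded_subset)
  then show ?thesis
    using assms unfolding real_test_def smooth_def by (auto intro: C_k_bilinear[OF bounded_bilinear_mult])
qed

lemma dderiv_mult:
  fixes \<phi> \<psi> :: "'a::euclidean_space \<Rightarrow> real"
  assumes "real_test \<phi>" "real_test \<psi>"
  shows "dderiv h (\<lambda>z. \<phi> z * \<psi> z) = (\<lambda>z. \<phi> z * dderiv h \<psi> z + dderiv h \<phi> z * \<psi> z)"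
  using dderiv_bilinear[OF bounded_bilinear_mult] assms smooth_differentiable unfolding real_test_def by blast

lemma real_test_bump: "real_test bump"
  unfolding real_test_def bounded_support_iff using smooth_bump bump_eq_0 by blast

lemma real_test_integrable:
  fixes \<phi> :: "'a::euclidean_space \<Rightarrow> real"
  assumes "real_test \<phi>"
  shows "integrable lborel \<phi>"
proof -
  obtain r where r: "\<And>z. norm z \<ge> r \<Longrightarrow> \<phi> z = 0"
    using assms unfolding real_test_def bounded_support_iff by blast
  have "continuous_on UNIV \<phi>"
    using smooth_continuous assms unfolding real_test_def by blast
  then have "set_integrable lborel (cball 0 r) \<phi>"
    unfolding set_integrable_def
    using borel_integrable_compact[OF compact_cball continuous_on_subset[OF _ subset_UNIV]] by blast
  moreover have "(\<lambda>z. indicator (cball 0 r) z *\<^sub>R \<phi> z) = \<phi>"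
    using r by (auto simp: indicator_def fun_eq_iff)
  ultimately show ?thesis by (simp only: set_integrable_def)
qed

section \<open>Mollifiers\<close>

definition moll :: "real \<Rightarrow> 'a::euclidean_space \<Rightarrow> real" where
  "moll e z = bump ((1 / e) *\<^sub>R z) / (LINT y|lborel. bump ((1 / e) *\<^sub>R y :: 'a))"

context
  fixes e :: real assumes e: "e > 0"
begin

text \<open>The integrand is continuous, nonnegative and positive at the origin, so a vanishing
  integral would make a nonempty open set negligible. This justifies the division in
  \<open>moll\<close>.\<close>

lemma bump_integral_pos: "(LINT y|lborel. bump ((1 / e) *\<^sub>R y :: 'a::euclidean_space)) > 0"
proof -
  have t: "real_test (\<lambda>y::'a. bump ((1 / e) *\<^sub>R y))"
    using real_test_scaled[OF real_test_bump, of "1/e" 0] e by simp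
  define U where "U = {y::'a. bump ((1 / e) *\<^sub>R y) > 0}"
  have "continuous_on UNIV (\<lambda>y::'a. bump ((1 / e) *\<^sub>R y))"
    using t smooth_continuous unfolding real_test_def by blast
  then have U: "open U"
    unfolding U_def by (intro open_Collect_less) auto
  moreover have "0 \<in> U"
    by (simp add: U_def bump_0)
  ultimately have "\<not> negligible U"
    using open_not_negligible by blast
  have "(LINT y|lborel. bump ((1 / e) *\<^sub>R y :: 'a)) \<noteq> 0"
  proof
    assume "(LINT y|lborel. bump ((1 / e) *\<^sub>R y :: 'a)) = 0"
    then have "AE y::'a in lborel. bump ((1 / e) *\<^sub>R y) = 0"
      using integral_nonneg_eq_0_iff_AE[OF real_test_integrable[OF t]] by (simp add: bump_nonneg)
    then have "AE y in lebesgue. y \<notin> U"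
      unfolding U_def by (intro AE_completion) (auto elim: eventually_mono)
    then have "U \<in> null_sets lebesgue"
      using U by (subst AE_iff_null_sets) auto
    then show False
      using \<open>\<not> negligible U\<close> by (simp add: negligible_iff_null_sets)
  qed
  moreover have "(LINT y|lborel. bump ((1 / e) *\<^sub>R y :: 'a)) \<ge> 0"
    by (simp add: bump_nonneg)
  ultimately show ?thesis by simp
qed

lemma real_test_moll: "real_test (moll e :: 'a::euclidean_space \<Rightarrow> real)"
proof -
  have "real_test (\<lambda>y::'a. bump ((1 / e) *\<^sub>R y))"
    using real_test_scaled[OF real_test_bump, of "1/e" 0] e by simp
  moreover have "{y::'a. moll e y \<noteq> 0} \<subseteq> {y. bump ((1 / e) *\<^sub>R y) \<noteq> 0}"
    by (auto simp: moll_def)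
  ultimately show ?thesis
    unfolding real_test_def smooth_def moll_def[abs_def] divide_inverse
    by (auto intro: C_k_bilinear[OF bounded_bilinear_mult] C_k_const bounded_subset)
qed

lemma moll_nonneg: "moll e z \<ge> 0"
  using bump_integral_pos by (simp add: moll_def bump_nonneg)

lemma moll_minus: "moll e (- z) = moll e z"
  by (simp add: moll_def bump_minus)

lemma moll_eq_0: "norm z \<ge> e \<Longrightarrow> moll e z = 0"
  using e by (simp add: moll_def bump_eq_0)

lemma moll_nn_integral: "(\<integral>\<^sup>+ y. ennreal (moll e (y::'a::euclidean_space)) \<partial>lborel) = 1"
proof -
  have "(LINT y|lborel. moll e (y::'a)) = 1"
    using bump_integral_pos[where 'a='a] by (simp add: moll_def)
  then show ?thesis
    by (subst nn_integral_eq_integral) (auto intro: real_test_integrable real_test_moll moll_nonneg)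
qed

text \<open>Symmetry of \<open>moll e\<close> turns z - y into y - z, and translation invariance
  removes z.\<close>

lemma moll_integral_translate: "(LINT y|lborel. moll e (z - y)) = 1"
  and moll_integrable_translate: "integrable lborel (\<lambda>y::'a::euclidean_space. moll e (z - y))"
proof -
  have [measurable]: "moll e \<in> borel_measurable (borel :: 'a measure)"
    by (rule real_test_measurable[OF real_test_moll])
  have nn: "(\<integral>\<^sup>+ y. ennreal (moll e (z - y)) \<partial>lborel) = 1"
    using nn_integral_lborel_translate[of "\<lambda>y. ennreal (moll e (z - y))" z] moll_nn_integral[where 'a='a]
    by (simp add: moll_minus)
  then show *: "integrable lborel (\<lambda>y::'a. moll e (z - y))"
    by (intro integrableI_nonneg) (auto simp: moll_nonneg)
  show "(LINT y|lborel. moll e (z - y)) = 1"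
    using nn by (subst (asm) nn_integral_eq_integral[OF *]) (auto simp: moll_nonneg)
qed

text \<open>As \<open>moll e\<close> is an even probability density,
  \<open>conv (moll e) f z - f z\<close> is an average of f (y + z) - f z over |y| < e. By Tonelli
  its L^1 norm is at most the average of the translation moduli, each of them at most c.\<close>

lemma conv_moll_L1:
  fixes f :: "'a::euclidean_space \<Rightarrow> 'b::{banach, second_countable_topology}"
  assumes f: "integrable lborel f"
    and c: "\<And>y. norm y < e \<Longrightarrow> (\<integral>\<^sup>+ z. ennreal (norm (f (y + z) - f z)) \<partial>lborel) \<le> c"
  shows "(\<integral>\<^sup>+ z. ennreal (norm (conv (moll e) f z - f z)) \<partial>lborel) \<le> c"
proof -
  have [measurable]: "moll e \<in> borel_measurable (borel :: 'a measure)"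
    by (rule real_test_measurable[OF real_test_moll])
  have [measurable]: "f \<in> borel_measurable borel"
    using f by auto
  have pt: "ennreal (norm (conv (moll e) f z - f z)) \<le>
      (\<integral>\<^sup>+ y. ennreal (moll e y) * ennreal (norm (f (y + z) - f z)) \<partial>lborel)" for z
  proof -
    have "conv (moll e) f z - f z = (LINT y|lborel. moll e (z - y) *\<^sub>R f y) - (LINT y|lborel. moll e (z - y) *\<^sub>R f z)"
      by (simp add: conv_def moll_integral_translate moll_integrable_translate)
    also have "\<dots> = (LINT y|lborel. moll e (z - y) *\<^sub>R (f y - f z))"
      by (simp add: scaleR_diff_right conv_integrable[OF real_test_moll f] moll_integrable_translate)
    finally have "ennreal (norm (conv (moll e) f z - f z)) \<le> (\<integral>\<^sup>+ y. ennreal (norm (moll e (z - y) *\<^sub>R (f y - f z))) \<partial>lborel)"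
      using integral_norm_bound_ennreal[of lborel "\<lambda>y. moll e (z - y) *\<^sub>R (f y - f z)"]
      by (simp add: scaleR_diff_right conv_integrable[OF real_test_moll f] moll_integrable_translate)
    also have "\<dots> = (\<integral>\<^sup>+ y. ennreal (moll e (z - y)) * ennreal (norm (f y - f z)) \<partial>lborel)"
      by (simp add: ennreal_mult moll_nonneg)
    also have "\<dots> = (\<integral>\<^sup>+ y. ennreal (moll e (z - (z + y))) * ennreal (norm (f (z + y) - f z)) \<partial>lborel)"
      by (rule nn_integral_lborel_translate[symmetric]) measurable
    finally show ?thesis by (simp add: moll_minus add.commute)
  qed
  have "(\<integral>\<^sup>+ z. ennreal (norm (conv (moll e) f z - f z)) \<partial>lborel)
      \<le> (\<integral>\<^sup>+ z. (\<integral>\<^sup>+ y. ennreal (moll e y) * ennreal (norm (f (y + z) - f z)) \<partial>lborel) \<partial>lborel)"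
    by (intro nn_integral_mono pt)
  also have "\<dots> = (\<integral>\<^sup>+ y. (\<integral>\<^sup>+ z. ennreal (moll e y) * ennreal (norm (f (y + z) - f z)) \<partial>lborel) \<partial>lborel)"
    by (rule lborel_pair.Fubini') measurable
  also have "\<dots> \<le> (\<integral>\<^sup>+ y. ennreal (moll e (y::'a)) * c \<partial>lborel)"
  proof (rule nn_integral_mono)
    fix y :: 'a
    show "(\<integral>\<^sup>+ z. ennreal (moll e y) * ennreal (norm (f (y + z) - f z)) \<partial>lborel) \<le> ennreal (moll e y) * c"
      using c[of y] moll_eq_0[of y]
      by (cases "norm y < e") (auto simp: nn_integral_cmult intro!: mult_left_mono)
  qed
  also have "\<dots> = c"
    by (simp add: nn_integral_multc moll_nn_integral)
  finally show ?thesis .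
qed

text \<open>Jensen's inequality moves the square inside the average, after which only |f|^2 is
  translated. Hence an L^1 modulus for |f|^2 suffices, and the weight m, merely bounded by M, is
  never moved.\<close>

lemma conv_moll_weighted:
  fixes f :: "'a::euclidean_space \<Rightarrow> 'b::{banach, second_countable_topology}"
  assumes f: "integrable lborel f" and f2: "integrable lborel (\<lambda>z. (norm (f z))\<^sup>2)"
    and m[measurable]: "m \<in> borel_measurable borel" and M: "\<And>z. m z \<le> M"
    and c: "\<And>y. norm y < e \<Longrightarrow> (\<integral>\<^sup>+ z. ennreal (norm ((norm (f (y + z)))\<^sup>2 - (norm (f z))\<^sup>2)) \<partial>lborel) \<le> c"
  shows "(\<integral>\<^sup>+ z. ennreal ((norm (conv (moll e) f z))\<^sup>2) * m z \<partial>lborel)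
    \<le> (\<integral>\<^sup>+ z. ennreal ((norm (f z))\<^sup>2) * m z \<partial>lborel) + c * M"
proof -
  have [measurable]: "moll e \<in> borel_measurable (borel :: 'a measure)"
    by (rule real_test_measurable[OF real_test_moll])
  have [measurable]: "f \<in> borel_measurable borel"
    using f by auto
  have pt: "ennreal ((norm (conv (moll e) f z))\<^sup>2) \<le>
      (\<integral>\<^sup>+ y. ennreal (moll e y) * ennreal ((norm (f (y + z)))\<^sup>2) \<partial>lborel)" for z
  proof -
    \<comment> \<open>Jensen's inequality: average \<open>2 s |f| \<le> s\<^sup>2 + |f|\<^sup>2\<close> at \<open>s = |conv (moll e) f z|\<close>.\<close>
    define s where "s = norm (conv (moll e) f z)"
    have i2: "integrable lborel (\<lambda>y. moll e (z - y) * (norm (f y))\<^sup>2)"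
      using conv_integrable[OF real_test_moll f2] by simp
    have i1: "integrable lborel (\<lambda>y. moll e (z - y) * norm (f y))"
      using conv_integrable[OF real_test_moll integrable_norm[OF f]] by simp
    have "s \<le> (LINT y|lborel. norm (moll e (z - y) *\<^sub>R f y))"
      unfolding s_def conv_def by (rule integral_norm_bound)
    then have "s \<le> (LINT y|lborel. moll e (z - y) * norm (f y))"
      by (simp add: moll_nonneg)
    then have "2 * s * s \<le> 2 * s * (LINT y|lborel. moll e (z - y) * norm (f y))"
      by (intro mult_left_mono) (auto simp: s_def)
    also have "\<dots> = (LINT y|lborel. 2 * s * (moll e (z - y) * norm (f y)))"
      by simp
    also have "\<dots> \<le> (LINT y|lborel. s\<^sup>2 * moll e (z - y) + moll e (z - y) * (norm (f y))\<^sup>2)"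
    proof (rule integral_mono)
      fix y
      have "2 * s * norm (f y) \<le> s\<^sup>2 + (norm (f y))\<^sup>2"
        using sum_squares_bound[of s "norm (f y)"] by simp
      from mult_left_mono[OF this moll_nonneg[of "z - y"]]
      show "2 * s * (moll e (z - y) * norm (f y)) \<le> s\<^sup>2 * moll e (z - y) + moll e (z - y) * (norm (f y))\<^sup>2"
        by (simp add: algebra_simps)
    qed (use i1 i2 moll_integrable_translate[of z] in auto)
    also have "\<dots> = s\<^sup>2 + (LINT y|lborel. moll e (z - y) * (norm (f y))\<^sup>2)"
      using i2 by (simp add: moll_integrable_translate moll_integral_translate)
    finally have "s\<^sup>2 \<le> (LINT y|lborel. moll e (z - y) * (norm (f y))\<^sup>2)"
      by (simp add: power2_eq_square)
    then have "ennreal (s\<^sup>2) \<le> (\<integral>\<^sup>+ y. ennreal (moll e (z - y) * (norm (f y))\<^sup>2) \<partial>lborel)"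
      by (subst nn_integral_eq_integral[OF i2]) (auto simp: moll_nonneg intro: ennreal_leI)
    also have "\<dots> = (\<integral>\<^sup>+ y. ennreal (moll e (z - (z + y)) * (norm (f (z + y)))\<^sup>2) \<partial>lborel)"
      by (rule nn_integral_lborel_translate[symmetric]) measurable
    finally show ?thesis
      by (simp add: s_def moll_minus add.commute ennreal_mult moll_nonneg)
  qed
  have "(\<integral>\<^sup>+ z. ennreal ((norm (conv (moll e) f z))\<^sup>2) * m z \<partial>lborel)
      \<le> (\<integral>\<^sup>+ z. (\<integral>\<^sup>+ y. ennreal (moll e y) * ennreal ((norm (f (y + z)))\<^sup>2) \<partial>lborel) * m z \<partial>lborel)"
    by (intro nn_integral_mono mult_right_mono pt) auto
  also have "\<dots> = (\<integral>\<^sup>+ z. (\<integral>\<^sup>+ y. ennreal (moll e y) * ennreal ((norm (f (y + z)))\<^sup>2) * m z \<partial>lborel) \<partial>lborel)"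
    by (simp add: nn_integral_multc)
  also have "\<dots> = (\<integral>\<^sup>+ y. (\<integral>\<^sup>+ z. ennreal (moll e y) * ennreal ((norm (f (y + z)))\<^sup>2) * m z \<partial>lborel) \<partial>lborel)"
    by (rule lborel_pair.Fubini') measurable
  also have "\<dots> \<le> (\<integral>\<^sup>+ y. ennreal (moll e (y::'a)) * ((\<integral>\<^sup>+ z. ennreal ((norm (f z))\<^sup>2) * m z \<partial>lborel) + c * M) \<partial>lborel)"
  proof (rule nn_integral_mono)
    fix y :: 'a
    have "(\<integral>\<^sup>+ z. ennreal ((norm (f (y + z)))\<^sup>2) * m z \<partial>lborel) \<le> (\<integral>\<^sup>+ z. ennreal ((norm (f z))\<^sup>2) * m z \<partial>lborel) + c * M"
      if y: "norm y < e"
    proof -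
      have "(\<integral>\<^sup>+ z. ennreal ((norm (f (y + z)))\<^sup>2) * m z \<partial>lborel)
        \<le> (\<integral>\<^sup>+ z. ennreal ((norm (f z))\<^sup>2) * m z + ennreal (norm ((norm (f (y + z)))\<^sup>2 - (norm (f z))\<^sup>2)) * M \<partial>lborel)"
      proof (rule nn_integral_mono)
        fix z
        have "ennreal ((norm (f (y + z)))\<^sup>2) \<le> ennreal ((norm (f z))\<^sup>2) + ennreal (norm ((norm (f (y + z)))\<^sup>2 - (norm (f z))\<^sup>2))"
          by (subst ennreal_plus[symmetric]) (auto intro!: ennreal_leI simp del: ennreal_plus)
        then have "ennreal ((norm (f (y + z)))\<^sup>2) * m z
          \<le> (ennreal ((norm (f z))\<^sup>2) + ennreal (norm ((norm (f (y + z)))\<^sup>2 - (norm (f z))\<^sup>2))) * m z"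
          by (rule mult_right_mono) simp
        also have "\<dots> \<le> ennreal ((norm (f z))\<^sup>2) * m z + ennreal (norm ((norm (f (y + z)))\<^sup>2 - (norm (f z))\<^sup>2)) * M"
          unfolding distrib_right by (intro add_left_mono mult_left_mono M) simp
        finally show "ennreal ((norm (f (y + z)))\<^sup>2) * m z
          \<le> ennreal ((norm (f z))\<^sup>2) * m z + ennreal (norm ((norm (f (y + z)))\<^sup>2 - (norm (f z))\<^sup>2)) * M" .
      qed
      also have "\<dots> = (\<integral>\<^sup>+ z. ennreal ((norm (f z))\<^sup>2) * m z \<partial>lborel) + (\<integral>\<^sup>+ z. ennreal (norm ((norm (f (y + z)))\<^sup>2 - (norm (f z))\<^sup>2)) \<partial>lborel) * M"
        by (subst nn_integral_add) (auto simp: nn_integral_multc)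
      also have "\<dots> \<le> (\<integral>\<^sup>+ z. ennreal ((norm (f z))\<^sup>2) * m z \<partial>lborel) + c * M"
        by (intro add_left_mono mult_right_mono c y) simp
      finally show ?thesis .
    qed
    then show "(\<integral>\<^sup>+ z. ennreal (moll e y) * ennreal ((norm (f (y + z)))\<^sup>2) * m z \<partial>lborel)
      \<le> ennreal (moll e y) * ((\<integral>\<^sup>+ z. ennreal ((norm (f z))\<^sup>2) * m z \<partial>lborel) + c * M)"
      using moll_eq_0[of y]
      by (cases "norm y < e") (auto simp: nn_integral_cmult mult.assoc intro!: mult_left_mono)
  qed
  also have "\<dots> = (\<integral>\<^sup>+ z. ennreal ((norm (f z))\<^sup>2) * m z \<partial>lborel) + c * M"
    by (simp add: nn_integral_multc moll_nn_integral)
  finally show ?thesis .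
qed

end

section \<open>Weak derivatives\<close>

text \<open>Lebesgue measurable functions are replaced by Borel ones throughout, because translation
  invariance and Tonelli's theorem are applied to \<open>lborel\<close>. Real and imaginary parts
  are treated separately.\<close>

lemma lebesgue_borel_rep:
  fixes g :: "'a::euclidean_space \<Rightarrow> complex"
  assumes "g \<in> borel_measurable lebesgue"
  obtains G where "G \<in> borel_measurable borel" "AE z in lebesgue. g z = G z"
proof -
  have "(\<lambda>z. Re (g z)) \<in> borel_measurable (completion lborel)"
    "(\<lambda>z. Im (g z)) \<in> borel_measurable (completion lborel)"
    using assms by measurable
  from this[THEN completion_ex_borel_measurable_real] obtain a b :: "'a \<Rightarrow> real" where
    ab: "a \<in> borel_measurable lborel" "AE z in lborel. Re (g z) = a z"
      "b \<in> borel_measurable lborel" "AE z in lborel. Im (g z) = b z" by metis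
  show thesis
  proof (rule that[of "\<lambda>z. Complex (a z) (b z)"])
    have "(\<lambda>z. complex_of_real (a z) + \<i> * complex_of_real (b z)) \<in> borel_measurable borel"
      using ab by (intro borel_measurable_add borel_measurable_times) auto
    then show "(\<lambda>z. Complex (a z) (b z)) \<in> borel_measurable borel"
      by (simp add: Complex_eq)
    have "AE z in lborel. g z = Complex (a z) (b z)"
      using ab(2,4) by eventually_elim (simp add: complex_eq_iff)
    then show "AE z in lebesgue. g z = Complex (a z) (b z)"
      by (rule AE_completion)
  qed
qed

lemma bump_pos: "norm z < 1 \<Longrightarrow> bump z > 0"
  by (simp add: bump_def bumpm_def flat_def dot_square_norm not_le abs_square_less_1)

lemma real_test_cutoff: "k > 0 \<Longrightarrow> real_test (\<lambda>z. bump ((1 / k) *\<^sub>R z))"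
  using real_test_scaled[OF real_test_bump, of "1 / k" 0] by simp

text \<open>If the mollifications are 0, then \<open>conv_moll_L1\<close> bounds the L^1 norm of f
  itself by every c > 0.\<close>

lemma integrable_conv_moll_zero:
  fixes f :: "'a::euclidean_space \<Rightarrow> 'b::{banach, second_countable_topology}"
  assumes f: "integrable lborel f" and 0: "\<And>e z. e > 0 \<Longrightarrow> conv (moll e) f z = 0"
  shows "AE z in lborel. f z = 0"
proof -
  have "(\<integral>\<^sup>+ z. ennreal (norm (f z)) \<partial>lborel) \<le> 0"
  proof (rule ennreal_le_epsilon)
    fix c :: real assume "c > 0"
    from translation_L1_continuous[OF f this] obtain d where "d > 0"
      "\<And>y. norm y < d \<Longrightarrow> (\<integral>\<^sup>+ z. ennreal (norm (f (y + z) - f z)) \<partial>lborel) \<le> ennreal c" by blast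
    from conv_moll_L1[OF this(1) f this(2)] 0[OF this(1)]
    show "(\<integral>\<^sup>+ z. ennreal (norm (f z)) \<partial>lborel) \<le> 0 + ennreal c" by simp
  qed
  then show ?thesis
    using f by (simp add: nn_integral_0_iff_AE)
qed

lemma real_test_of_real:
  assumes "real_test \<phi>"
  shows "(\<lambda>z. complex_of_real (\<phi> z)) \<in> test_functions"
  using assms unfolding real_test_def smooth_def test_functions_def
  by (auto intro: C_k_bounded_linear[OF bounded_linear_of_real])

lemma real_test_dderivs: "real_test \<phi> \<Longrightarrow> real_test (dderivs hs \<phi>)"
  by (induction hs) (auto simp: dderivs_def intro: real_test_dderiv)

lemma dderivs_of_real:
  assumes "real_test \<phi>"
  shows "dderivs hs (\<lambda>z. complex_of_real (\<phi> z)) = (\<lambda>z. complex_of_real (dderivs hs \<phi> z))"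
proof (induction hs)
  case (Cons h hs)
  have d: "dderivs hs \<phi> differentiable (at z)" for z
    using real_test_dderivs[OF assms] smooth_differentiable unfolding real_test_def by blast
  have "dderivs (h # hs) (\<lambda>z. complex_of_real (\<phi> z)) = dderiv h (\<lambda>z. complex_of_real (dderivs hs \<phi> z))"
    using Cons by (simp add: dderivs_def)
  also have "\<dots> = (\<lambda>z. complex_of_real (dderivs (h # hs) \<phi> z))"
    using dderiv_bounded_linear[OF bounded_linear_of_real d] by (simp add: dderivs_def)
  finally show ?case .
qed (simp add: dderivs_def)

lemma loc_integrable_measurable:
  assumes "loc_integrable f"
  shows "f \<in> borel_measurable lebesgue"
proof (rule borel_measurable_LIMSEQ_metric)
  have si: "set_integrable lebesgue (cball 0 k) f" for k
    using assms by (auto simp: loc_integrable_def)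
  show "(\<lambda>z. indicator (cball 0 (real k)) z *\<^sub>R f z) \<in> borel_measurable lebesgue" for k
    using si[of "real k"] by (auto simp: set_integrable_def)
  show "(\<lambda>k. indicator (cball 0 (real k)) z *\<^sub>R f z) \<longlonglongrightarrow> f z" for z
  proof (rule tendsto_eventually)
    obtain k0 :: nat where "norm z \<le> real k0"
      using real_arch_simple by blast
    then show "\<forall>\<^sub>F k in sequentially. indicator (cball 0 (real k)) z *\<^sub>R f z = f z"
      by (auto simp: eventually_sequentially intro!: exI[of _ k0])
  qed
qed

text \<open>Testing against the product of y \<mapsto> moll e (z - y) and a cutoff \<psi> says that
  the mollifications of \<psi> F vanish, and \<psi> F is globally integrable. As \<psi> > 0 inside
  its ball, F = 0 there, and the balls of integer radius k exhaust the space.\<close>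

lemma fundamental_lemma:
  assumes f: "loc_integrable f"
    and 0: "\<And>\<phi>. \<phi> \<in> test_functions \<Longrightarrow> (LINT z|lebesgue. f z * \<phi> z) = 0"
  shows "AE z in lebesgue. f z = 0"
proof -
  have si: "set_integrable lebesgue (cball 0 k) f" for k
    using f by (auto simp: loc_integrable_def)
  have "f \<in> borel_measurable lebesgue"
    by (rule loc_integrable_measurable[OF f])
  then obtain F where F[measurable]: "F \<in> borel_measurable borel" and fF: "AE z in lebesgue. f z = F z"
    using lebesgue_borel_rep by blast
  have "AE z in lborel. norm z < real k \<longrightarrow> F z = 0" if k: "k > 0" for k :: nat
  proof -
    define \<psi> where "\<psi> = (\<lambda>z::'a. bump ((1 / real k) *\<^sub>R z))"
    have \<psi>: "real_test \<psi>"
      unfolding \<psi>_def using k by (intro real_test_cutoff) simp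
    have [measurable]: "\<psi> \<in> borel_measurable borel"
      by (rule real_test_measurable[OF \<psi>])
    have m: "(\<lambda>z. indicator (cball 0 (real k)) z *\<^sub>R F z) \<in> borel_measurable lborel"
      using F by (intro borel_measurable_scaleR borel_measurable_indicator) auto
    have "integrable lebesgue (\<lambda>z. indicator (cball 0 (real k)) z *\<^sub>R F z)"
      using si[of "real k"] unfolding set_integrable_def
      by (rule integrable_cong_AE_imp) (use fF measurable_completion[OF m] in \<open>auto elim: eventually_mono\<close>)
    then have "integrable lborel (\<lambda>z. indicator (cball 0 (real k)) z *\<^sub>R F z)"
      using integrable_completion[OF m] by simp
    then have "integrable lborel (\<lambda>z. \<psi> z *\<^sub>R (indicator (cball 0 (real k)) z *\<^sub>R F z))"
      by (rule integrable_bounded_scaleR[where B = 1]) (measurable, simp add: \<psi>_def bump_nonneg bump_le_1)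
    moreover have eq: "\<psi> z *\<^sub>R (indicator (cball 0 (real k)) z *\<^sub>R F z) = \<psi> z *\<^sub>R F z" for z
      using k bump_eq_0[of "(1 / real k) *\<^sub>R z"]
      by (cases "norm z \<le> real k") (auto simp: \<psi>_def indicator_def le_divide_eq)
    ultimately have int: "integrable lborel (\<lambda>z. \<psi> z *\<^sub>R F z)"
      by (simp only: eq)
    have c0: "conv (moll e) (\<lambda>z. \<psi> z *\<^sub>R F z) z = 0" if e: "e > 0" for e z
    proof -
      have t1: "real_test (\<lambda>y. moll e (z - y))"
        using real_test_scaled[OF real_test_moll[OF e], of "-1" z] by simp
      have t: "real_test (\<lambda>y. moll e (z - y) * \<psi> y)"
        by (rule real_test_mult[OF t1 \<psi>])
      have [measurable]: "(\<lambda>y. moll e (z - y)) \<in> borel_measurable borel"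
        by (rule real_test_measurable[OF t1])
      have m: "(\<lambda>y. moll e (z - y) *\<^sub>R \<psi> y *\<^sub>R F y) \<in> borel_measurable lborel"
        by measurable
      have "0 = (LINT y|lebesgue. f y * complex_of_real (moll e (z - y) * \<psi> y))"
        using 0[OF real_test_of_real[OF t]] by simp
      also have "\<dots> = (LINT y|lebesgue. moll e (z - y) *\<^sub>R \<psi> y *\<^sub>R F y)"
      proof (rule integral_cong_AE[OF borel_measurable_times measurable_completion[OF m]])
        show "(\<lambda>y. complex_of_real (moll e (z - y) * \<psi> y)) \<in> borel_measurable lebesgue"
          by (rule measurable_completion) measurable
        show "AE y in lebesgue. f y * complex_of_real (moll e (z - y) * \<psi> y) = moll e (z - y) *\<^sub>R \<psi> y *\<^sub>R F y"
          using fF by eventually_elim (simp add: scaleR_conv_of_real)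
      qed fact
      also have "\<dots> = (LINT y|lborel. moll e (z - y) *\<^sub>R \<psi> y *\<^sub>R F y)"
        by (rule integral_completion[OF m])
      finally show ?thesis by (simp add: conv_def)
    qed
    have "AE z in lborel. \<psi> z *\<^sub>R F z = 0"
      by (rule integrable_conv_moll_zero[OF int]) (rule c0)
    then show ?thesis
    proof eventually_elim
      case (elim z)
      show ?case
      proof
        assume "norm z < real k"
        then have "\<psi> z > 0"
          unfolding \<psi>_def using k by (intro bump_pos) (simp add: divide_less_eq)
        with elim show "F z = 0" by simp
      qed
    qed
  qed
  then have "AE z in lborel. \<forall>k>0. norm z < real k \<longrightarrow> F z = 0"
    by (simp add: AE_all_countable)
  then have "AE z in lborel. F z = 0"
  proof eventually_elim
    case (elim z)
    obtain k where "norm z < real k"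
      using reals_Archimedean2 by blast
    moreover have "k > 0"
      using calculation norm_ge_zero[of z] by (cases k) auto
    ultimately show ?case using elim by blast
  qed
  then have "AE z in lebesgue. F z = 0"
    by (rule AE_completion)
  with fF show ?thesis
    by eventually_elim simp
qed

lemma loc_integrable_mult_test:
  assumes f: "loc_integrable f" and \<phi>: "\<phi> \<in> test_functions"
  shows "integrable lebesgue (\<lambda>z. f z * \<phi> z)"
proof -
  define K where "K = closure {z. \<phi> z \<noteq> 0}"
  have K: "compact K" and c: "continuous_on UNIV \<phi>"
    using \<phi> C_k.simps(1)[of \<phi>] unfolding K_def test_functions_def by blast+
  have si: "integrable lebesgue (\<lambda>z. indicator K z *\<^sub>R f z)"
    using f K by (auto simp: loc_integrable_def set_integrable_def)
  have "compact (\<phi> ` K)"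
    using c K by (intro compact_continuous_image) (auto intro: continuous_on_subset)
  then obtain B where B: "\<And>z. z \<in> K \<Longrightarrow> norm (\<phi> z) \<le> B"
    by (fastforce dest!: compact_imp_bounded simp: bounded_iff)
  have 0: "\<phi> z = 0" if "z \<notin> K" for z
    using that closure_subset[of "{z. \<phi> z \<noteq> 0}"] unfolding K_def by blast
  have m: "\<phi> \<in> borel_measurable lebesgue"
    using borel_measurable_continuous_onI[OF c] by (intro measurable_completion) simp
  have "integrable lebesgue (\<lambda>z. (indicator K z *\<^sub>R f z) * \<phi> z)"
  proof (rule Bochner_Integration.integrable_bound[of _ "\<lambda>z. \<bar>B\<bar> * norm (indicator K z *\<^sub>R f z)"])
    show "integrable lebesgue (\<lambda>z. \<bar>B\<bar> * norm (indicator K z *\<^sub>R f z))"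
      by (intro integrable_mult_right integrable_norm si)
    show "(\<lambda>z. (indicator K z *\<^sub>R f z) * \<phi> z) \<in> borel_measurable lebesgue"
      using si m by (intro borel_measurable_times) auto
    show "AE z in lebesgue. norm ((indicator K z *\<^sub>R f z) * \<phi> z) \<le> norm (\<bar>B\<bar> * norm (indicator K z *\<^sub>R f z))"
    proof (intro AE_I2)
      fix z
      show "norm ((indicator K z *\<^sub>R f z) * \<phi> z) \<le> norm (\<bar>B\<bar> * norm (indicator K z *\<^sub>R f z))"
        using B[of z] mult_right_mono[of "norm (\<phi> z)" "\<bar>B\<bar>" "norm (f z)"]
        by (cases "z \<in> K") (auto simp: norm_mult mult.commute)
    qed
  qed
  moreover have "(indicator K z *\<^sub>R f z) * \<phi> z = f z * \<phi> z" for z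
    using 0[of z] by (cases "z \<in> K") auto
  ultimately show ?thesis by simp
qed

lemma is_weak_deriv_unique:
  assumes "is_weak_deriv hs u g" "is_weak_deriv hs u g'"
  shows "AE z in lebesgue. g z = g' z"
proof -
  have g: "loc_integrable g" "loc_integrable g'"
    using assms by (auto simp: is_weak_deriv_def)
  have "AE z in lebesgue. g z - g' z = 0"
  proof (rule fundamental_lemma)
    show "loc_integrable (\<lambda>z. g z - g' z)"
      using g by (auto simp: loc_integrable_def)
    fix \<phi> :: "'a \<Rightarrow> complex" assume \<phi>: "\<phi> \<in> test_functions"
    have "(LINT z|lebesgue. g z * \<phi> z) = (LINT z|lebesgue. g' z * \<phi> z)"
      using assms \<phi> by (auto simp: is_weak_deriv_def)
    then show "(LINT z|lebesgue. (g z - g' z) * \<phi> z) = 0"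
      using loc_integrable_mult_test[OF g(1) \<phi>] loc_integrable_mult_test[OF g(2) \<phi>]
      by (simp add: left_diff_distrib)
  qed
  then show ?thesis by simp
qed

text \<open>The function chosen by \<open>weak_deriv\<close> may differ from the witness g in
  \<open>sobolev\<close>; uniqueness makes the two agree almost everywhere, so that the choice can
  be replaced by g.\<close>

lemma weak_deriv_L2:
  assumes "g \<in> L2" "is_weak_deriv hs u g"
  shows "is_weak_deriv hs u (weak_deriv hs u)" "AE z in lebesgue. weak_deriv hs u z = g z"
proof -
  show *: "is_weak_deriv hs u (weak_deriv hs u)"
    unfolding weak_deriv_def using someI[of "is_weak_deriv hs u"] assms(2) by blast
  show "AE z in lebesgue. weak_deriv hs u z = g z"
    by (rule is_weak_deriv_unique[OF * assms(2)])
qed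

section \<open>Square integrable Borel functions\<close>

definition sqint :: "('a::euclidean_space \<Rightarrow> 'b::{banach, second_countable_topology}) \<Rightarrow> bool" where
  "sqint f \<longleftrightarrow> f \<in> borel_measurable borel \<and> integrable lborel (\<lambda>z. (norm (f z))\<^sup>2)"

lemma L2_rep:
  assumes "g \<in> L2"
  obtains G where "sqint G" "AE z in lebesgue. g z = G z"
proof -
  have g: "g \<in> borel_measurable lebesgue" "integrable lebesgue (\<lambda>z. (norm (g z))\<^sup>2)"
    using assms by (auto simp: L2_def)
  obtain G where G[measurable]: "G \<in> borel_measurable borel" and eq: "AE z in lebesgue. g z = G z"
    using lebesgue_borel_rep[OF g(1)] by blast
  have m: "(\<lambda>z. (norm (G z))\<^sup>2) \<in> borel_measurable lborel"
    by measurable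
  have "integrable lebesgue (\<lambda>z. (norm (G z))\<^sup>2)"
    using g(2) by (rule integrable_cong_AE_imp)
      (use measurable_completion[OF m] eq in \<open>auto elim: eventually_mono\<close>)
  then have "integrable lborel (\<lambda>z. (norm (G z))\<^sup>2)"
    using integrable_completion[OF m] by simp
  then show thesis
    using eq G by (intro that[of G]) (simp_all add: sqint_def)
qed

lemma sqint_add:
  assumes "sqint f" "sqint g"
  shows "sqint (\<lambda>z. f z + g z)"
proof -
  have [measurable]: "f \<in> borel_measurable borel" "g \<in> borel_measurable borel"
    using assms by (auto simp: sqint_def)
  have "integrable lborel (\<lambda>z. (norm (f z + g z))\<^sup>2)"
  proof (rule Bochner_Integration.integrable_bound)
    show "integrable lborel (\<lambda>z. 2 * (norm (f z))\<^sup>2 + 2 * (norm (g z))\<^sup>2)"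
      using assms by (auto simp: sqint_def)
    show "AE z in lborel. norm ((norm (f z + g z))\<^sup>2) \<le> norm (2 * (norm (f z))\<^sup>2 + 2 * (norm (g z))\<^sup>2)"
    proof (intro AE_I2)
      fix z
      have "(norm (f z + g z))\<^sup>2 \<le> (norm (f z) + norm (g z))\<^sup>2"
        by (intro power_mono norm_triangle_ineq) simp
      also have "\<dots> \<le> 2 * (norm (f z))\<^sup>2 + 2 * (norm (g z))\<^sup>2"
        using sum_squares_bound[of "norm (f z)" "norm (g z)"] by (simp add: power2_sum)
      finally show "norm ((norm (f z + g z))\<^sup>2) \<le> norm (2 * (norm (f z))\<^sup>2 + 2 * (norm (g z))\<^sup>2)"
        by simp
    qed
  qed measurable
  then show ?thesis by (simp add: sqint_def)
qed

lemma sqint_bound: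
  assumes "sqint f" "g \<in> borel_measurable borel" "\<And>z. norm (g z) \<le> B * norm (f z)"
  shows "sqint g"
proof -
  have [measurable]: "g \<in> borel_measurable borel" by fact
  have "integrable lborel (\<lambda>z. (norm (g z))\<^sup>2)"
  proof (rule Bochner_Integration.integrable_bound)
    show "integrable lborel (\<lambda>z. B\<^sup>2 * (norm (f z))\<^sup>2)"
      using assms by (auto simp: sqint_def)
    show "AE z in lborel. norm ((norm (g z))\<^sup>2) \<le> norm (B\<^sup>2 * (norm (f z))\<^sup>2)"
      using assms(3) by (auto simp: power_mult_distrib[symmetric] intro!: power_mono)
  qed measurable
  then show ?thesis by (simp add: sqint_def)
qed

lemma sqint_sum: "(\<And>j. j \<in> J \<Longrightarrow> sqint (f j)) \<Longrightarrow> sqint (\<lambda>z. \<Sum>j\<in>J. f j z)"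
proof (induction J rule: infinite_finite_induct)
  case (insert j J)
  then show ?case by (auto intro!: sqint_add)
qed (auto simp: sqint_def)

lemma sqint_cmult: "sqint f \<Longrightarrow> sqint (\<lambda>z. c * f z :: complex)"
  by (rule sqint_bound[where B = "norm c"]) (auto simp: norm_mult sqint_def)

lemma sqint_norm: "sqint f \<Longrightarrow> sqint (\<lambda>z. norm (f z))"
  by (rule sqint_bound[where B = 1]) (auto simp: sqint_def)

lemma sqint_real_test:
  assumes "real_test \<phi>" "sqint f"
  shows "sqint (\<lambda>z. \<phi> z *\<^sub>R f z)"
proof -
  obtain B where "\<And>z. \<bar>\<phi> z\<bar> \<le> B" using real_test_bounded[OF assms(1)] by blast
  then show ?thesis
    using real_test_measurable[OF assms(1)] assms(2)
    by (intro sqint_bound[OF assms(2), where B = B]) (auto simp: sqint_def intro!: mult_right_mono)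
qed

text \<open>A pointwise form of the Cauchy-Schwarz inequality, 2 |\<phi>| |f| <= \<phi>^2 + |f|^2.
  It brings localised L^2 functions into the scope of convolution, which asks for
  integrability.\<close>

lemma integrable_real_test:
  fixes f :: "'a::euclidean_space \<Rightarrow> 'b::{banach, second_countable_topology}"
  assumes \<phi>: "real_test \<phi>" and f: "sqint f"
  shows "integrable lborel (\<lambda>z. \<phi> z *\<^sub>R f z)"
proof (rule Bochner_Integration.integrable_bound)
  have [measurable]: "\<phi> \<in> borel_measurable borel" "f \<in> borel_measurable borel"
    using real_test_measurable[OF \<phi>] f by (auto simp: sqint_def)
  show "integrable lborel (\<lambda>z. \<phi> z * \<phi> z + (norm (f z))\<^sup>2)"
    using real_test_integrable[OF real_test_mult[OF \<phi> \<phi>]] f by (auto simp: sqint_def)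
  show "(\<lambda>z. \<phi> z *\<^sub>R f z) \<in> borel_measurable lborel"
    by measurable
  show "AE z in lborel. norm (\<phi> z *\<^sub>R f z) \<le> norm (\<phi> z * \<phi> z + (norm (f z))\<^sup>2)"
  proof (intro AE_I2)
    fix z
    have "norm (\<phi> z *\<^sub>R f z) \<le> 2 * \<bar>\<phi> z\<bar> * norm (f z)"
      by simp
    also have "\<dots> \<le> \<phi> z * \<phi> z + (norm (f z))\<^sup>2"
      using sum_squares_bound[of "\<bar>\<phi> z\<bar>" "norm (f z)"] by (simp add: power2_eq_square)
    finally show "norm (\<phi> z *\<^sub>R f z) \<le> norm (\<phi> z * \<phi> z + (norm (f z))\<^sup>2)"
      by simp
  qed
qed

text \<open>\<open>is_weak_deriv\<close> for Borel representatives and \<open>lborel\<close>. Real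
  test functions are enough, since kernels and cutoffs are real.\<close>

definition wder :: "'a::euclidean_space list \<Rightarrow> ('a \<Rightarrow> complex) \<Rightarrow> ('a \<Rightarrow> complex) \<Rightarrow> bool" where
  "wder hs U G \<longleftrightarrow> sqint U \<and> sqint G \<and> (\<forall>\<phi>. real_test \<phi> \<longrightarrow>
    (LINT z|lborel. dderivs hs \<phi> z *\<^sub>R U z) = (-1) ^ length hs * (LINT z|lborel. \<phi> z *\<^sub>R G z))"

lemma wderI:
  assumes w: "is_weak_deriv hs u g"
    and U: "sqint U" "AE z in lebesgue. u z = U z" and G: "sqint G" "AE z in lebesgue. g z = G z"
  shows "wder hs U G"
  unfolding wder_def
proof (intro conjI U(1) G(1) allI impI)
  fix \<phi> :: "'a \<Rightarrow> real" assume \<phi>: "real_test \<phi>"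
  have lu: "loc_integrable u" and lg: "loc_integrable g"
    using w by (auto simp: is_weak_deriv_def)
  have eq: "(LINT z|lebesgue. f z * complex_of_real (\<psi> z)) = (LINT z|lborel. \<psi> z *\<^sub>R F z)"
    if f: "loc_integrable f" and F: "sqint F" "AE z in lebesgue. f z = F z" and \<psi>: "real_test \<psi>" for f F :: "'a \<Rightarrow> complex" and \<psi>
  proof -
    have [measurable]: "F \<in> borel_measurable borel" "\<psi> \<in> borel_measurable borel"
      using F \<psi> real_test_measurable by (auto simp: sqint_def)
    have m: "(\<lambda>z. \<psi> z *\<^sub>R F z) \<in> borel_measurable lborel" by measurable
    have ae: "AE z in lebesgue. f z * complex_of_real (\<psi> z) = \<psi> z *\<^sub>R F z"
      using F(2) by eventually_elim (simp add: scaleR_conv_of_real)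
    have "(\<lambda>z. f z * complex_of_real (\<psi> z)) \<in> borel_measurable lebesgue"
      by (intro borel_measurable_times loc_integrable_measurable f measurable_completion) measurable
    then have "(LINT z|lebesgue. f z * complex_of_real (\<psi> z)) = (LINT z|lebesgue. \<psi> z *\<^sub>R F z)"
      using measurable_completion[OF m] ae by (intro integral_cong_AE) auto
    also have "\<dots> = (LINT z|lborel. \<psi> z *\<^sub>R F z)"
      by (rule integral_completion[OF m])
    finally show ?thesis .
  qed
  have "(LINT z|lebesgue. u z * dderivs hs (\<lambda>z. complex_of_real (\<phi> z)) z) =
        (-1) ^ length hs * (LINT z|lebesgue. g z * complex_of_real (\<phi> z))"
    using w real_test_of_real[OF \<phi>] by (auto simp: is_weak_deriv_def)
  then show "(LINT z|lborel. dderivs hs \<phi> z *\<^sub>R U z) = (-1) ^ length hs * (LINT z|lborel. \<phi> z *\<^sub>R G z)"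
    unfolding dderivs_of_real[OF \<phi>] eq[OF lu U real_test_dderivs[OF \<phi>]] eq[OF lg G \<phi>] .
qed

lemma
  assumes \<eta>: "real_test \<eta>"
  shows real_test_reflect: "real_test (\<lambda>y. \<eta> (z - y))"
    and dderiv_reflect: "dderiv h (\<lambda>y. \<eta> (z - y)) = (\<lambda>y. - dderiv h \<eta> (z - y))"
  using real_test_scaled[OF \<eta>, of "-1" z] dderiv_scaled[OF \<eta>, of h "-1" z] by simp_all

lemma dderiv_add:
  assumes "real_test f" "real_test g"
  shows "dderiv h (\<lambda>z. f z + g z) = (\<lambda>z. dderiv h f z + dderiv h g z)"
  using assms smooth_differentiable unfolding real_test_def
  by (intro ext dderiv_eqI has_derivative_add has_derivative_dderiv) auto

text \<open>Test the weak derivative with the product of \<psi> and y \<mapsto> \<eta> (z - y). The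
  sign from reflecting \<eta> cancels the one from integration by parts, and the Leibniz rule
  produces the term with the derivative of \<psi>.\<close>

lemma conv_wder_1:
  assumes w: "wder [h] U G" and \<eta>: "real_test \<eta>" and \<psi>: "real_test \<psi>"
  shows "conv (dderiv h \<eta>) (\<lambda>y. \<psi> y *\<^sub>R U y) z =
    conv \<eta> (\<lambda>y. \<psi> y *\<^sub>R G y) z + conv \<eta> (\<lambda>y. dderiv h \<psi> y *\<^sub>R U y) z"
proof -
  have U: "sqint U" and G: "sqint G" using w by (auto simp: wder_def)
  note r = real_test_reflect[OF \<eta>, of z] real_test_reflect[OF real_test_dderiv[OF \<eta>], of h z]
  note i1 = integrable_real_test[OF real_test_mult[OF \<psi> r(2)] U]
  note i2 = integrable_real_test[OF real_test_mult[OF real_test_dderiv[OF \<psi>] r(1)] U, of h]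
  have "(LINT y|lborel. dderiv h (\<lambda>y. \<psi> y * \<eta> (z - y)) y *\<^sub>R U y) = - (LINT y|lborel. (\<psi> y * \<eta> (z - y)) *\<^sub>R G y)"
    using w real_test_mult[OF \<psi> r(1)] unfolding wder_def dderivs_def by auto
  also have "dderiv h (\<lambda>y. \<psi> y * \<eta> (z - y)) = (\<lambda>y. \<psi> y * - dderiv h \<eta> (z - y) + dderiv h \<psi> y * \<eta> (z - y))"
    by (simp only: dderiv_mult[OF \<psi> r(1)] dderiv_reflect[OF \<eta>])
  also have "(LINT y|lborel. (\<psi> y * - dderiv h \<eta> (z - y) + dderiv h \<psi> y * \<eta> (z - y)) *\<^sub>R U y)
    = - (LINT y|lborel. (\<psi> y * dderiv h \<eta> (z - y)) *\<^sub>R U y) + (LINT y|lborel. (dderiv h \<psi> y * \<eta> (z - y)) *\<^sub>R U y)"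
    using i1 i2 by (simp add: scaleR_diff_left)
  finally show ?thesis
    by (simp add: conv_def mult.commute algebra_simps)
qed

text \<open>In the second derivative of the product of \<psi> and the reflected kernel, the cross
  term still has one derivative on the kernel. \<open>conv_wder_1\<close>, with the derivative of
  \<psi> as cutoff, moves it to U; this is where the first weak derivative enters.\<close>

lemma conv_wder_2:
  assumes w2: "wder [h, h] U H" and w1: "wder [h] U G" and \<eta>: "real_test \<eta>" and \<psi>: "real_test \<psi>"
  shows "conv (dderiv h (dderiv h \<eta>)) (\<lambda>y. \<psi> y *\<^sub>R U y) z =
    conv \<eta> (\<lambda>y. \<psi> y *\<^sub>R H y) z + 2 *\<^sub>R conv \<eta> (\<lambda>y. dderiv h \<psi> y *\<^sub>R G y) z
      + conv \<eta> (\<lambda>y. dderiv h (dderiv h \<psi>) y *\<^sub>R U y) z"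
proof -
  have U: "sqint U" and H: "sqint H" using w2 by (auto simp: wder_def)
  define \<psi>1 \<psi>2 where "\<psi>1 = dderiv h \<psi>" and "\<psi>2 = dderiv h \<psi>1"
  define \<eta>0 where "\<eta>0 = (\<lambda>y. \<eta> (z - y))"
  define \<eta>1 \<eta>2 where "\<eta>1 = dderiv h \<eta>0" and "\<eta>2 = dderiv h \<eta>1"
  have \<psi>1: "real_test \<psi>1" and \<psi>2: "real_test \<psi>2"
    unfolding \<psi>1_def \<psi>2_def by (intro real_test_dderiv \<psi>)+
  have \<eta>0: "real_test \<eta>0" unfolding \<eta>0_def by (rule real_test_reflect[OF \<eta>])
  have \<eta>1: "real_test \<eta>1" and \<eta>2: "real_test \<eta>2"
    unfolding \<eta>1_def \<eta>2_def by (intro real_test_dderiv \<eta>0)+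
  have e1: "\<eta>1 = (\<lambda>y. - dderiv h \<eta> (z - y))"
    unfolding \<eta>1_def \<eta>0_def by (rule dderiv_reflect[OF \<eta>])
  have "(\<lambda>y. dderiv h \<eta> (z - y)) differentiable (at y)" for y
    using real_test_reflect[OF real_test_dderiv[OF \<eta>]] smooth_differentiable unfolding real_test_def by blast
  then have e2: "\<eta>2 = (\<lambda>y. dderiv h (dderiv h \<eta>) (z - y))"
    unfolding \<eta>2_def e1 by (subst dderiv_bounded_linear[OF bounded_linear_minus[OF bounded_linear_ident]])
      (simp_all add: dderiv_reflect[OF real_test_dderiv[OF \<eta>]])
  note i = integrable_real_test[OF real_test_mult[OF \<psi> \<eta>2] U]
    integrable_real_test[OF real_test_mult[OF \<psi>1 \<eta>1] U]
    integrable_real_test[OF real_test_mult[OF \<psi>2 \<eta>0] U]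
  have "dderiv h (dderiv h (\<lambda>y. \<psi> y * \<eta>0 y)) = dderiv h (\<lambda>y. \<psi> y * \<eta>1 y + \<psi>1 y * \<eta>0 y)"
    by (simp only: dderiv_mult[OF \<psi> \<eta>0] \<eta>1_def \<psi>1_def)
  also have "\<dots> = (\<lambda>y. (\<psi> y * \<eta>2 y + \<psi>1 y * \<eta>1 y) + (\<psi>1 y * \<eta>1 y + \<psi>2 y * \<eta>0 y))"
    by (simp only: dderiv_add[OF real_test_mult[OF \<psi> \<eta>1] real_test_mult[OF \<psi>1 \<eta>0]]
        dderiv_mult[OF \<psi> \<eta>1] dderiv_mult[OF \<psi>1 \<eta>0] \<eta>1_def[symmetric] \<eta>2_def[symmetric]
        \<psi>1_def[symmetric] \<psi>2_def[symmetric])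
  finally have D: "dderiv h (dderiv h (\<lambda>y. \<psi> y * \<eta>0 y)) = \<dots>" .
  have "(LINT y|lborel. dderiv h (dderiv h (\<lambda>y. \<psi> y * \<eta>0 y)) y *\<^sub>R U y)
      = (LINT y|lborel. (\<psi> y * \<eta>0 y) *\<^sub>R H y)"
    using w2 real_test_mult[OF \<psi> \<eta>0] unfolding wder_def dderivs_def by auto
  also have "(LINT y|lborel. dderiv h (dderiv h (\<lambda>y. \<psi> y * \<eta>0 y)) y *\<^sub>R U y)
     = (LINT y|lborel. (\<psi> y * \<eta>2 y) *\<^sub>R U y) + 2 *\<^sub>R (LINT y|lborel. (\<psi>1 y * \<eta>1 y) *\<^sub>R U y)
       + (LINT y|lborel. (\<psi>2 y * \<eta>0 y) *\<^sub>R U y)"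
    unfolding D scaleR_add_left
    by (simp only: Bochner_Integration.integral_add Bochner_Integration.integrable_add i) (simp add: scaleR_2)
  also have "(LINT y|lborel. (\<psi>1 y * \<eta>1 y) *\<^sub>R U y) = - conv (dderiv h \<eta>) (\<lambda>y. \<psi>1 y *\<^sub>R U y) z"
    by (simp add: e1 conv_def mult.commute)
  \<comment> \<open>With the factor 2 in front this contributes -2 times the term with \<psi>2,
    against +1 from the Leibniz rule; solving for the main term leaves exactly one.\<close>
  also have "\<dots> = - (conv \<eta> (\<lambda>y. \<psi>1 y *\<^sub>R G y) z + conv \<eta> (\<lambda>y. \<psi>2 y *\<^sub>R U y) z)"
    by (simp only: conv_wder_1[OF w1 \<eta> \<psi>1] \<psi>2_def)
  also have "(LINT y|lborel. (\<psi> y * \<eta>2 y) *\<^sub>R U y) = conv (dderiv h (dderiv h \<eta>)) (\<lambda>y. \<psi> y *\<^sub>R U y) z"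
    by (simp add: e2 conv_def mult.commute)
  also have "(LINT y|lborel. (\<psi>2 y * \<eta>0 y) *\<^sub>R U y) = conv \<eta> (\<lambda>y. \<psi>2 y *\<^sub>R U y) z"
    by (simp add: \<eta>0_def conv_def mult.commute)
  also have "(LINT y|lborel. (\<psi> y * \<eta>0 y) *\<^sub>R H y) = conv \<eta> (\<lambda>y. \<psi> y *\<^sub>R H y) z"
    by (simp add: \<eta>0_def conv_def mult.commute)
  finally show ?thesis
    unfolding \<psi>1_def[symmetric] \<psi>2_def[symmetric] by (simp add: algebra_simps scaleR_2)
qed

section \<open>Localised weak solutions\<close>

lemma conv_cmult: "conv \<eta> (\<lambda>y. c * f y :: complex) z = c * conv \<eta> f z"
  by (simp add: conv_def flip: mult_scaleR_right)

lemma conv_scaleR_right: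
  fixes f :: "'a::euclidean_space \<Rightarrow> 'b::{banach, second_countable_topology}"
  shows "conv \<eta> (\<lambda>y. c *\<^sub>R f y) z = c *\<^sub>R conv \<eta> f z"
proof -
  have "(\<lambda>y. \<eta> (z - y) *\<^sub>R c *\<^sub>R f y) = (\<lambda>y. c *\<^sub>R \<eta> (z - y) *\<^sub>R f y)"
    by (simp add: mult.commute)
  then show ?thesis
    unfolding conv_def by (simp only: integral_scaleR_right)
qed

lemma conv_sum:
  fixes f :: "'j \<Rightarrow> 'a::euclidean_space \<Rightarrow> 'b::{banach, second_countable_topology}"
  assumes "real_test \<eta>" "\<And>j. j \<in> J \<Longrightarrow> integrable lborel (f j)"
  shows "conv \<eta> (\<lambda>y. \<Sum>j\<in>J. f j y) z = (\<Sum>j\<in>J. conv \<eta> (f j) z)"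
  unfolding conv_def scaleR_sum_right
  by (rule Bochner_Integration.integral_sum) (rule conv_integrable[OF assms])

text \<open>Squares an inequality between weighted norms. The delicate case is b infinite with
  \<theta> = 0: the product is then 0 by convention, so a vanishes.\<close>

lemma ennreal_sqrt_le_cmult:
  assumes "ennreal_sqrt a \<le> ennreal \<theta> * ennreal_sqrt b" "\<theta> \<ge> 0"
  shows "a \<le> ennreal (\<theta>\<^sup>2) * b"
proof (cases b)
  case (real b')
  have b: "ennreal_sqrt b = ennreal (sqrt b')"
    using real by (simp add: ennreal_sqrt_def)
  have "ennreal_sqrt a \<le> ennreal (\<theta> * sqrt b')"
    using assms b real by (simp add: ennreal_mult)
  then have "a \<noteq> \<infinity>"
    by (auto simp: ennreal_sqrt_def top_unique)
  then obtain a' where a': "a = ennreal a'" "a' \<ge> 0"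
    by (cases a) auto
  have "sqrt a' \<le> \<theta> * sqrt b'"
    using \<open>ennreal_sqrt a \<le> ennreal (\<theta> * sqrt b')\<close> a' assms(2) real
    by (simp add: ennreal_sqrt_def)
  then have "(sqrt a')\<^sup>2 \<le> (\<theta> * sqrt b')\<^sup>2"
    by (rule power_mono) (use a' in simp)
  then show ?thesis
    using a' real assms(2) by (simp add: power_mult_distrib flip: ennreal_mult)
next
  case top
  show ?thesis
  proof (cases "\<theta> = 0")
    case True
    then have "ennreal_sqrt a = 0" using assms by simp
    then have "a = 0"
      by (cases a) (auto simp: ennreal_sqrt_def split: if_splits)
    then show ?thesis by simp
  qed (use top assms(2) in \<open>simp add: ennreal_mult_top\<close>)
qed

text \<open>Tonelli's theorem; completing the measure does not change the inner and outer
  integrals.\<close>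

lemma weighted_norm_eq:
  fixes F :: "(real ^ 'n) \<times> real \<Rightarrow> complex"
  assumes [measurable]: "F \<in> borel_measurable borel" "w \<in> borel_measurable borel"
  shows "weighted_norm w F = ennreal_sqrt (\<integral>\<^sup>+ z. ennreal ((norm (F z))\<^sup>2) * w (fst z) \<partial>lborel)"
proof -
  have [measurable]: "F \<in> borel_measurable (borel \<Otimes>\<^sub>M borel)"
    by (simp add: borel_prod)
  have "(\<integral>\<^sup>+ z. ennreal ((norm (F z))\<^sup>2) * w (fst z) \<partial>(lborel \<Otimes>\<^sub>M lborel))
     = (\<integral>\<^sup>+ t. (\<integral>\<^sup>+ x. ennreal ((norm (F (x, t)))\<^sup>2) * w x \<partial>lborel) \<partial>lborel)"
    by (subst lborel_pair.nn_integral_snd[symmetric]) (auto simp: split_beta')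
  then show ?thesis
    unfolding weighted_norm_def by (simp add: nn_integral_completion lborel_prod)
qed

lemma norm_fst_le_norm: "norm (fst z) \<le> norm z"
  using norm_fst_le[of "fst z" "snd z"] by simp

text \<open>The cylinder over a null set is a null set. This transports properties of V and W, which
  depend on x alone, to space-time.\<close>

lemma AE_lborel_fst:
  assumes "AE x in lborel. P x"
  shows "AE z in lborel. P (fst (z :: 'a::euclidean_space \<times> 'b::euclidean_space))"
proof -
  from assms obtain N where N: "N \<in> null_sets lborel" "{x. \<not> P x} \<subseteq> N"
    by (auto simp: eventually_ae_filter)
  have [measurable]: "N \<in> sets borel" using N by auto
  have "emeasure (lborel \<Otimes>\<^sub>M lborel) (N \<times> (UNIV :: 'b set)) = 0"
    using N by (subst lborel.emeasure_pair_measure_Times) auto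
  then have "N \<times> UNIV \<in> null_sets (lborel :: ('a \<times> 'b) measure)"
    by (auto simp: lborel_prod null_sets_def intro!: borel_Times)
  then show ?thesis
    by (rule AE_I') (use N in auto)
qed

text \<open>What is left of the Schroedinger operator applied to \<psi> U after subtracting \<psi>
  times the operator applied to U; \<open>Ux j\<close> stands for the weak derivative of U along
  \<open>e_x j\<close>.\<close>

definition commutator ::
    "((real ^ 'n) \<times> real \<Rightarrow> real) \<Rightarrow> ((real ^ 'n) \<times> real \<Rightarrow> complex) \<Rightarrow>
     ('n \<Rightarrow> (real ^ 'n) \<times> real \<Rightarrow> complex) \<Rightarrow> (real ^ 'n) \<times> real \<Rightarrow> complex" where
  "commutator \<psi> U Ux z = \<i> * (dderiv e_t \<psi> z *\<^sub>R U z) +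
     (\<Sum>j\<in>UNIV. 2 *\<^sub>R dderiv (e_x j) \<psi> z *\<^sub>R Ux j z + dderiv (e_x j) (dderiv (e_x j) \<psi>) z *\<^sub>R U z)"

text \<open>Borel representatives of u and of those weak derivatives that occur in the operator or
  in its commutator with a cutoff; \<open>SU\<close> below is the operator applied to u.\<close>

locale weak_derivs =
  fixes U Ut :: "(real ^ 'n) \<times> real \<Rightarrow> complex"
    and Ux Uxx :: "'n \<Rightarrow> (real ^ 'n) \<times> real \<Rightarrow> complex"
  assumes wt: "wder [e_t] U Ut"
    and wx: "\<And>j. wder [e_x j] U (Ux j)"
    and wxx: "\<And>j. wder [e_x j, e_x j] U (Uxx j)"
begin

definition SU :: "(real ^ 'n) \<times> real \<Rightarrow> complex" where
  "SU z = \<i> * Ut z + (\<Sum>j\<in>UNIV. Uxx j z)"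

lemma U: "sqint U" and Ut: "sqint Ut" and Ux: "sqint (Ux j)" and Uxx: "sqint (Uxx j)"
  using wt wx wxx by (auto simp: wder_def)

lemma SU: "sqint SU"
  unfolding SU_def[abs_def] by (intro sqint_add sqint_cmult sqint_sum Ut Uxx)

lemma commutator_sqint:
  assumes "real_test \<psi>"
  shows "sqint (commutator \<psi> U Ux)"
proof -
  have "sqint (\<lambda>z. dderiv (e_x j) \<psi> z *\<^sub>R Ux j z + dderiv (e_x j) \<psi> z *\<^sub>R Ux j z)" for j
    by (intro sqint_add sqint_real_test real_test_dderiv assms Ux)
  then have "sqint (\<lambda>z. 2 *\<^sub>R dderiv (e_x j) \<psi> z *\<^sub>R Ux j z)" for j
    unfolding scaleR_2 .
  then show ?thesis
    unfolding commutator_def[abs_def]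
    by (intro sqint_add[OF sqint_cmult sqint_sum] sqint_add[of "\<lambda>z. 2 *\<^sub>R _ z"]
        sqint_real_test[OF real_test_dderiv U] sqint_real_test[OF real_test_dderiv[OF real_test_dderiv] U] assms)
qed

lemma commutator_integrable:
  assumes "real_test \<psi>"
  shows "integrable lborel (commutator \<psi> U Ux)"
  unfolding commutator_def[abs_def]
  by (intro Bochner_Integration.integrable_add integrable_mult_right Bochner_Integration.integrable_sum
      integrable_scaleR_right integrable_real_test real_test_dderiv assms U Ux)

text \<open>Convolution commutes with a constant coefficient operator. The localised and mollified u
  is therefore a test function whose right hand side in the Carleman inequality is again a
  mollification.\<close>

lemma schroedinger_conv:
  assumes \<eta>: "real_test \<eta>" and \<psi>: "real_test \<psi>"
  shows "schroedinger (conv \<eta> (\<lambda>y. \<psi> y *\<^sub>R U y)) =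
    conv \<eta> (\<lambda>y. \<psi> y *\<^sub>R SU y + commutator \<psi> U Ux y)"
proof
  fix z
  note i = integrable_real_test[OF \<psi> U]
  note ij = integrable_real_test[OF \<psi> Uxx] integrable_real_test[OF real_test_dderiv[OF \<psi>] Ux]
    integrable_real_test[OF real_test_dderiv[OF real_test_dderiv[OF \<psi>]] U]
    integrable_real_test[OF \<psi> Ut] integrable_real_test[OF real_test_dderiv[OF \<psi>] U]
  have "schroedinger (conv \<eta> (\<lambda>y. \<psi> y *\<^sub>R U y)) z =
     \<i> * conv (dderiv e_t \<eta>) (\<lambda>y. \<psi> y *\<^sub>R U y) z +
     (\<Sum>j\<in>UNIV. conv (dderiv (e_x j) (dderiv (e_x j) \<eta>)) (\<lambda>y. \<psi> y *\<^sub>R U y) z)"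
    by (simp add: schroedinger_def dderivs_def dderiv_conv[OF \<eta> i] dderiv_conv[OF real_test_dderiv[OF \<eta>] i])
  also have "\<dots> = \<i> * (conv \<eta> (\<lambda>y. \<psi> y *\<^sub>R Ut y) z + conv \<eta> (\<lambda>y. dderiv e_t \<psi> y *\<^sub>R U y) z)
     + (\<Sum>j\<in>UNIV. conv \<eta> (\<lambda>y. \<psi> y *\<^sub>R Uxx j y) z + 2 *\<^sub>R conv \<eta> (\<lambda>y. dderiv (e_x j) \<psi> y *\<^sub>R Ux j y) z
      + conv \<eta> (\<lambda>y. dderiv (e_x j) (dderiv (e_x j) \<psi>) y *\<^sub>R U y) z)"
    by (simp only: conv_wder_1[OF wt \<eta> \<psi>] conv_wder_2[OF wxx wx \<eta> \<psi>])
  also have "\<dots> = conv \<eta> (\<lambda>y. \<i> * (\<psi> y *\<^sub>R Ut y + dderiv e_t \<psi> y *\<^sub>R U y)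
      + (\<Sum>j\<in>UNIV. \<psi> y *\<^sub>R Uxx j y + 2 *\<^sub>R dderiv (e_x j) \<psi> y *\<^sub>R Ux j y
      + dderiv (e_x j) (dderiv (e_x j) \<psi>) y *\<^sub>R U y)) z"
    by (simp only: conv_add[OF \<eta>] conv_cmult conv_sum[OF \<eta>] conv_scaleR_right ij
        Bochner_Integration.integrable_add integrable_mult_right Bochner_Integration.integrable_sum integrable_scaleR_right)
  also have "(\<lambda>y. \<i> * (\<psi> y *\<^sub>R Ut y + dderiv e_t \<psi> y *\<^sub>R U y)
      + (\<Sum>j\<in>UNIV. \<psi> y *\<^sub>R Uxx j y + 2 *\<^sub>R dderiv (e_x j) \<psi> y *\<^sub>R Ux j y
      + dderiv (e_x j) (dderiv (e_x j) \<psi>) y *\<^sub>R U y)) = (\<lambda>y. \<psi> y *\<^sub>R SU y + commutator \<psi> U Ux y)"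
    by (simp add: SU_def commutator_def scaleR_sum_right sum.distrib algebra_simps)
  finally show "schroedinger (conv \<eta> (\<lambda>y. \<psi> y *\<^sub>R U y)) z =
    conv \<eta> (\<lambda>y. \<psi> y *\<^sub>R SU y + commutator \<psi> U Ux y) z" .
qed

end

text \<open>Fatou's lemma with upper bounds that converge themselves; it serves both the limit of
  the mollifications and that of the cutoffs.\<close>

lemma nn_integral_Fatou_le:
  fixes u :: "nat \<Rightarrow> 'a \<Rightarrow> ennreal"
  assumes m: "\<And>k. u k \<in> borel_measurable M" and lim: "AE z in M. (\<lambda>k. u k z) \<longlonglongrightarrow> u' z"
    and le: "\<forall>\<^sub>F k in sequentially. (\<integral>\<^sup>+ z. u k z \<partial>M) \<le> B k" and B: "B \<longlonglongrightarrow> B0"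
  shows "(\<integral>\<^sup>+ z. u' z \<partial>M) \<le> B0"
proof -
  have "(\<integral>\<^sup>+ z. u' z \<partial>M) = (\<integral>\<^sup>+ z. liminf (\<lambda>k. u k z) \<partial>M)"
    by (rule nn_integral_cong_AE) (use lim in \<open>auto elim!: eventually_mono simp: lim_imp_Liminf\<close>)
  also have "\<dots> \<le> liminf (\<lambda>k. \<integral>\<^sup>+ z. u k z \<partial>M)"
    by (rule nn_integral_liminf[OF m])
  also have "\<dots> \<le> liminf B"
    by (rule Liminf_mono[OF le])
  also have "\<dots> = B0"
    by (rule lim_imp_Liminf[OF _ B]) simp
  finally show ?thesis .
qed

lemma dderiv_eq_0:
  fixes f :: "'a::euclidean_space \<Rightarrow> 'b::real_normed_vector"
  assumes "\<And>w. norm w > r \<Longrightarrow> f w = 0" "norm z > r"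
  shows "dderiv h f z = 0"
proof (rule dderiv_eqI)
  show "(f has_derivative (\<lambda>_. 0)) (at z)"
  proof (rule has_derivative_transform_within_open[where s = "{w. norm w > r}"])
    show "open {w::'a. norm w > r}"
      by (intro open_Collect_less continuous_intros)
  qed (use assms in auto)
qed

text \<open>The factor c allows a second application to the derivative just computed.\<close>

lemma dderiv_rescaled:
  assumes "real_test \<phi>"
  shows "dderiv h (\<lambda>z. c * \<phi> (e *\<^sub>R z)) = (\<lambda>z. c * e * dderiv h \<phi> (e *\<^sub>R z))"
proof -
  have d: "\<phi> differentiable (at z)" for z
    using assms smooth_differentiable unfolding real_test_def by blast
  have "((\<lambda>z. \<phi> (e *\<^sub>R z)) has_derivative (\<lambda>h. dderiv (e *\<^sub>R h) \<phi> (e *\<^sub>R z))) (at z)" for z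
    using has_derivative_affine_compose[OF bounded_linear_scaleR_right[of e] d, where z = z and c = 0] by simp
  then show ?thesis
    by (intro ext dderiv_eqI)
      (use has_derivative_mult_right in \<open>fastforce simp: linear_cmul[OF linear_dderiv[OF d]] mult.assoc\<close>)
qed

context weak_derivs
begin

text \<open>The weight 1/w may be unbounded, so the limit cannot be taken in it directly. But the
  mollified functions live in the ball of radius 2 R, where 1/w <= 1/d; there 1/w equals its minimum
  with 1/d, to which \<open>conv_moll_weighted\<close> applies. On the left, Fatou's lemma along an
  almost everywhere convergent subsequence suffices for any w.\<close>

lemma carleman_cutoff:
  assumes carl: "\<And>v. v \<in> test_functions \<Longrightarrow> weighted_norm (\<lambda>x. ennreal (w x)) v
      \<le> ennreal \<theta> * weighted_norm (\<lambda>x. inverse (ennreal (w x))) (schroedinger v)"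
    and \<theta>: "\<theta> \<ge> 0" and w[measurable]: "w \<in> borel_measurable borel"
    and \<psi>: "real_test \<psi>" and R: "R > 0" "\<And>z. norm z > R \<Longrightarrow> \<psi> z = 0"
    and d: "d > 0" "AE x in lborel. norm x \<le> 2 * R \<longrightarrow> w x \<ge> d"
  shows "(\<integral>\<^sup>+ z. ennreal ((norm (\<psi> z *\<^sub>R U z))\<^sup>2) * ennreal (w (fst z)) \<partial>lborel) \<le>
    ennreal (\<theta>\<^sup>2) * (\<integral>\<^sup>+ z. ennreal ((norm (\<psi> z *\<^sub>R SU z + commutator \<psi> U Ux z))\<^sup>2) *
      min (inverse (ennreal (w (fst z)))) (ennreal (1 / d)) \<partial>lborel)"
proof -
  define K where "K = ennreal (1 / d)"
  define m where "m z = min (inverse (ennreal (w (fst z)))) K" for z :: "(real ^ 'n) \<times> real"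
  define f where "f z = \<psi> z *\<^sub>R U z" for z
  define g where "g z = \<psi> z *\<^sub>R SU z + commutator \<psi> U Ux z" for z
  have f: "integrable lborel f" "sqint f" and g: "integrable lborel g" "sqint g"
    unfolding f_def[abs_def] g_def[abs_def]
    by (intro Bochner_Integration.integrable_add integrable_real_test sqint_add sqint_real_test
        commutator_sqint commutator_integrable \<psi> U SU)+
  have [measurable]: "f \<in> borel_measurable borel" "g \<in> borel_measurable borel"
    using f(2) g(2) by (auto simp: sqint_def)
  have [measurable]: "(\<lambda>z::(real ^ 'n) \<times> real. w (fst z)) \<in> borel_measurable borel"
    by (rule measurable_compose[OF _ w]) (simp add: borel_prod[symmetric])
  have m[measurable]: "m \<in> borel_measurable borel"
    unfolding m_def[abs_def] by measurable
  have f0: "f z = 0" if "norm z > R" for z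
    using that R by (simp add: f_def)
  have g0: "g z = 0" if "norm z > R" for z
    using that R dderiv_eq_0[of R \<psi> z] dderiv_eq_0[of R "dderiv _ \<psi>" z] dderiv_eq_0[of R \<psi>]
    by (simp add: g_def commutator_def)
  define A where "A = (\<integral>\<^sup>+ z. ennreal ((norm (g z))\<^sup>2) * m z \<partial>lborel)"
  \<comment> \<open>One mollification radius has to serve three purposes: L^1 approximation of f,
    the weighted bound for g, and a support inside the ball of radius 2 R.\<close>
  have ex: "\<exists>e. 0 < e \<and> e \<le> R / 2 \<and> (\<integral>\<^sup>+ z. ennreal (norm (conv (moll e) f z - f z)) \<partial>lborel) \<le> ennreal (1 / real (Suc k))
      \<and> (\<integral>\<^sup>+ z. ennreal ((norm (conv (moll e) g z))\<^sup>2) * m z \<partial>lborel) \<le> A + ennreal (1 / real (Suc k)) * K" for k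
  proof -
    let ?c = "1 / real (Suc k)"
    have c: "?c > 0" by simp
    obtain d1 where d1: "d1 > 0" "\<And>y. norm y < d1 \<Longrightarrow> (\<integral>\<^sup>+ z. ennreal (norm (f (y + z) - f z)) \<partial>lborel) \<le> ennreal ?c"
      using translation_L1_continuous[OF f(1) c] by blast
    have g2: "integrable lborel (\<lambda>z. (norm (g z))\<^sup>2)"
      using g(2) by (simp add: sqint_def)
    obtain d2 where d2: "d2 > 0" "\<And>y. norm y < d2 \<Longrightarrow>
        (\<integral>\<^sup>+ z. ennreal (norm ((norm (g (y + z)))\<^sup>2 - (norm (g z))\<^sup>2)) \<partial>lborel) \<le> ennreal ?c"
      using translation_L1_continuous[OF g2 c] by blast
    define e where "e = min (R / 2) (min d1 d2)"
    have e: "e > 0" using d1 d2 R by (simp add: e_def)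
    have "(\<integral>\<^sup>+ z. ennreal (norm (conv (moll e) f z - f z)) \<partial>lborel) \<le> ennreal ?c"
      by (rule conv_moll_L1[OF e f(1)]) (use d1 e_def in auto)
    moreover have "(\<integral>\<^sup>+ z. ennreal ((norm (conv (moll e) g z))\<^sup>2) * m z \<partial>lborel) \<le> A + ennreal ?c * K"
      unfolding A_def by (rule conv_moll_weighted[OF e g(1) g2 m]) (use d2 e_def in \<open>auto simp: m_def\<close>)
    moreover have "e \<le> R / 2" by (simp add: e_def)
    ultimately show ?thesis using e by blast
  qed
  from choice[OF allI[OF ex]] obtain e where e': "\<forall>k. 0 < e k \<and> e k \<le> R / 2 \<and>
      (\<integral>\<^sup>+ z. ennreal (norm (conv (moll (e k)) f z - f z)) \<partial>lborel) \<le> ennreal (1 / real (Suc k)) \<and>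
      (\<integral>\<^sup>+ z. ennreal ((norm (conv (moll (e k)) g z))\<^sup>2) * m z \<partial>lborel) \<le> A + ennreal (1 / real (Suc k)) * K" ..
  note e = e'[rule_format, THEN conjunct1] e'[rule_format, THEN conjunct2, THEN conjunct1]
    and ef = e'[rule_format, THEN conjunct2, THEN conjunct2, THEN conjunct1]
    and eg = e'[rule_format, THEN conjunct2, THEN conjunct2, THEN conjunct2]
  define v where "v k = conv (moll (e k)) f" for k
  have fs: "bounded {z. f z \<noteq> 0}"
    unfolding bounded_iff using f0 by (intro exI[of _ R]) (auto simp: not_less[symmetric])
  have v: "v k \<in> test_functions" for k
    unfolding v_def by (rule conv_test_function[OF real_test_moll[OF e(1)] f(1) fs])
  have [measurable]: "v k \<in> borel_measurable borel" "conv (moll (e k)) g \<in> borel_measurable borel" for k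
    unfolding v_def by (rule conv_measurable[OF real_test_moll[OF e(1)] f(1)] conv_measurable[OF real_test_moll[OF e(1)] g(1)])+
  have Sv: "schroedinger (v k) = conv (moll (e k)) g" for k
    unfolding v_def f_def[abs_def] g_def[abs_def] by (rule schroedinger_conv[OF real_test_moll[OF e(1)] \<psi>])
  have step: "(\<integral>\<^sup>+ z. ennreal ((norm (v k z))\<^sup>2) * ennreal (w (fst z)) \<partial>lborel)
      \<le> ennreal (\<theta>\<^sup>2) * (A + ennreal (1 / real (Suc k)) * K)" for k
  proof -
    have "(\<integral>\<^sup>+ z. ennreal ((norm (v k z))\<^sup>2) * ennreal (w (fst z)) \<partial>lborel)
      \<le> ennreal (\<theta>\<^sup>2) * (\<integral>\<^sup>+ z. ennreal ((norm (conv (moll (e k)) g z))\<^sup>2) * inverse (ennreal (w (fst z))) \<partial>lborel)"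
      by (rule ennreal_sqrt_le_cmult[OF _ \<theta>]) (use carl[OF v[of k]] in \<open>simp add: weighted_norm_eq Sv\<close>)
    also have "(\<integral>\<^sup>+ z. ennreal ((norm (conv (moll (e k)) g z))\<^sup>2) * inverse (ennreal (w (fst z))) \<partial>lborel)
        = (\<integral>\<^sup>+ z. ennreal ((norm (conv (moll (e k)) g z))\<^sup>2) * m z \<partial>lborel)"
    proof (rule nn_integral_cong_AE)
      from AE_lborel_fst[OF d(2)]
      show "AE z in lborel. ennreal ((norm (conv (moll (e k)) g z))\<^sup>2) * inverse (ennreal (w (fst z)))
          = ennreal ((norm (conv (moll (e k)) g z))\<^sup>2) * m z"
      proof eventually_elim
        case (elim z)
        show ?case
        proof (cases "norm z \<ge> 2 * R")
          case True
          \<comment> \<open>g is known to vanish for |z| > R, so the closed condition in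
            \<open>conv_eq_0\<close> is met with radius 3 R / 2; the mollifier adds at most R /
            2.\<close>
          have "conv (moll (e k)) g z = 0"
            by (rule conv_eq_0[where r = "3 / 2 * R" and e = "e k"])
              (use True R(1) e(2)[of k] g0 moll_eq_0[OF e(1)] in auto)
          then show ?thesis by simp
        next
          case False
          then have "w (fst z) \<ge> d"
            using elim norm_fst_le_norm[of z] by linarith
          then have "inverse (ennreal (w (fst z))) \<le> K"
            using d(1) by (simp add: K_def inverse_ennreal inverse_eq_divide[symmetric] le_imp_inverse_le)
          then show ?thesis by (simp add: m_def)
        qed
      qed
    qed
    also have "ennreal (\<theta>\<^sup>2) * \<dots> \<le> ennreal (\<theta>\<^sup>2) * (A + ennreal (1 / real (Suc k)) * K)"
      by (intro mult_left_mono eg) simp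
    finally show ?thesis .
  qed
  have c0: "(\<lambda>k. ennreal (1 / real (Suc k))) \<longlonglongrightarrow> 0"
    using tendsto_ennrealI[OF LIMSEQ_Suc[OF lim_1_over_n]] by simp
  have vi: "integrable lborel (\<lambda>z. v k z - f z)" for k
  proof (rule integrableI_bounded)
    show "(\<integral>\<^sup>+ z. ennreal (norm (v k z - f z)) \<partial>lborel) < \<infinity>"
      using ef[of k] unfolding v_def by (rule order.strict_trans1) simp
  qed measurable
  have "(\<lambda>k. LINT z|lborel. norm (v k z - f z)) \<longlonglongrightarrow> 0"
  proof (rule tendsto_sandwich[OF _ _ tendsto_const LIMSEQ_Suc[OF lim_1_over_n]])
    show "\<forall>\<^sub>F k in sequentially. (LINT z|lborel. norm (v k z - f z)) \<le> 1 / real (Suc k)"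
    proof (intro always_eventually allI)
      fix k
      have "ennreal (LINT z|lborel. norm (v k z - f z)) \<le> ennreal (1 / real (Suc k))"
        using ef[of k] unfolding v_def[symmetric] by (subst (asm) nn_integral_eq_integral) (auto intro: vi)
      then show "(LINT z|lborel. norm (v k z - f z)) \<le> 1 / real (Suc k)"
        by (subst (asm) ennreal_le_iff) auto
    qed
  qed auto
  \<comment> \<open>Convergence in L^1 yields pointwise convergence along a subsequence only, which
    is enough for Fatou's lemma.\<close>
  from tendsto_L1_AE_subseq[OF vi this] obtain r where r: "strict_mono r"
    "AE z in lborel. (\<lambda>n. v (r n) z - f z) \<longlonglongrightarrow> 0" by blast
  have "(\<integral>\<^sup>+ z. ennreal ((norm (f z))\<^sup>2) * ennreal (w (fst z)) \<partial>lborel) \<le> ennreal (\<theta>\<^sup>2) * A"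
  proof (rule nn_integral_Fatou_le)
    show "AE z in lborel. (\<lambda>n. ennreal ((norm (v (r n) z))\<^sup>2) * ennreal (w (fst z)))
       \<longlonglongrightarrow> ennreal ((norm (f z))\<^sup>2) * ennreal (w (fst z))"
      using r(2)
    proof eventually_elim
      case (elim z)
      then have "(\<lambda>n. v (r n) z) \<longlonglongrightarrow> f z"
        by (simp add: LIM_zero_iff)
      then have "(\<lambda>n. ennreal ((norm (v (r n) z))\<^sup>2)) \<longlonglongrightarrow> ennreal ((norm (f z))\<^sup>2)"
        by (intro tendsto_intros)
      then show ?case
        by (intro tendsto_mult_ennreal tendsto_const) auto
    qed
    show "\<forall>\<^sub>F n in sequentially. (\<integral>\<^sup>+ z. ennreal ((norm (v (r n) z))\<^sup>2) * ennreal (w (fst z)) \<partial>lborel)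
      \<le> ennreal (\<theta>\<^sup>2) * (A + ennreal (1 / real (Suc (r n))) * K)"
      using step by simp
    have "(\<lambda>n. ennreal (1 / real (Suc (r n)))) \<longlonglongrightarrow> 0"
      using LIMSEQ_subseq_LIMSEQ[OF c0 r(1)] by (simp add: o_def)
    then have "(\<lambda>n. ennreal (1 / real (Suc (r n))) * K) \<longlonglongrightarrow> 0 * K"
      by (intro tendsto_mult_ennreal tendsto_const) (auto simp: K_def)
    then have "(\<lambda>n. A + ennreal (1 / real (Suc (r n))) * K) \<longlonglongrightarrow> A + 0"
      by (intro tendsto_add tendsto_const) simp
    then show "(\<lambda>n. ennreal (\<theta>\<^sup>2) * (A + ennreal (1 / real (Suc (r n))) * K)) \<longlonglongrightarrow> ennreal (\<theta>\<^sup>2) * A"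
      by (intro ennreal_tendsto_cmult) auto
  qed measurable
  then show ?thesis
    by (simp add: f_def A_def g_def m_def K_def)
qed

end

section \<open>Removing the cutoff\<close>

text \<open>Expand the square of sqrt \<kappa> |a| - |b| / sqrt \<kappa>. A small \<kappa> keeps the
  main term almost unchanged at the price of a large constant for the commutator.\<close>

lemma norm_add_sq_le:
  fixes a b :: "'a::real_normed_vector"
  assumes "\<kappa> > 0"
  shows "(norm (a + b))\<^sup>2 \<le> (1 + \<kappa>) * (norm a)\<^sup>2 + (1 + 1 / \<kappa>) * (norm b)\<^sup>2"
proof -
  have "0 \<le> (sqrt \<kappa> * norm a - norm b / sqrt \<kappa>)\<^sup>2"
    by simp
  also have "\<dots> = \<kappa> * (norm a)\<^sup>2 + (norm b)\<^sup>2 / \<kappa> - 2 * norm a * norm b"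
    using assms by (simp add: power2_diff power_mult_distrib power_divide)
  finally have "2 * norm a * norm b \<le> \<kappa> * (norm a)\<^sup>2 + (norm b)\<^sup>2 / \<kappa>"
    by simp
  moreover have "(norm (a + b))\<^sup>2 \<le> (norm a + norm b)\<^sup>2"
    by (intro power_mono norm_triangle_ineq) simp
  ultimately show ?thesis
    by (simp add: power2_sum algebra_simps)
qed

context weak_derivs
begin

text \<open>The commutator with the cutoff at radius \<open>k\<close>, multiplied by \<open>k\<close>. Since the gradient of
  \<^const>\<open>bump\<close> vanishes at the origin, it tends to 0 pointwise without a plateau of the cutoff.\<close>

definition scaled_commutator :: "real \<Rightarrow> (real ^ 'n) \<times> real \<Rightarrow> complex" where
  "scaled_commutator k z = \<i> * (dderiv e_t bump ((1 / k) *\<^sub>R z) *\<^sub>R U z) +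
     (\<Sum>j\<in>UNIV. 2 *\<^sub>R dderiv (e_x j) bump ((1 / k) *\<^sub>R z) *\<^sub>R Ux j z +
       (1 / k * dderiv (e_x j) (dderiv (e_x j) bump) ((1 / k) *\<^sub>R z)) *\<^sub>R U z)"

lemma commutator_rescaled:
  assumes "k > 0"
  shows "commutator (\<lambda>z. bump ((1 / k) *\<^sub>R z)) U Ux z = (1 / k) *\<^sub>R scaled_commutator k z"
proof -
  have d1: "dderiv h (\<lambda>z. bump ((1 / k) *\<^sub>R z)) = (\<lambda>z. 1 / k * dderiv h bump ((1 / k) *\<^sub>R z))" for h :: "(real ^ 'n) \<times> real"
    using dderiv_rescaled[OF real_test_bump, of h 1 "1 / k"] by simp
  have d2: "dderiv h (\<lambda>z. 1 / k * dderiv h bump ((1 / k) *\<^sub>R z)) =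
      (\<lambda>z. 1 / k * (1 / k) * dderiv h (dderiv h bump) ((1 / k) *\<^sub>R z))" for h :: "(real ^ 'n) \<times> real"
    by (rule dderiv_rescaled[OF real_test_dderiv[OF real_test_bump]])
  show ?thesis
    unfolding commutator_def scaled_commutator_def d1 d2
    by (simp add: scaleR_add_right scaleR_sum_right mult_scaleR_right mult.commute mult.left_commute)
qed

text \<open>Dominated convergence: first derivatives of the bump are evaluated at z / k, which tends
  to the origin, where they vanish; second derivatives carry the extra factor 1 / k. The majorant H
  is square integrable because U and \<open>Ux j\<close> are.\<close>

lemma scaled_commutator_tendsto_0:
  "(\<lambda>k. \<integral>\<^sup>+ z. ennreal ((norm (scaled_commutator (real k) z))\<^sup>2) \<partial>lborel) \<longlonglongrightarrow> 0"
proof -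
  have [measurable]: "U \<in> borel_measurable borel" "Ux j \<in> borel_measurable borel" for j
    using U Ux by (auto simp: sqint_def)
  have [measurable]: "dderiv h bump \<in> borel_measurable borel" "dderiv h (dderiv h bump) \<in> borel_measurable borel"
    for h :: "(real ^ 'n) \<times> real"
    by (intro real_test_measurable real_test_dderiv real_test_bump)+
  have [measurable]: "scaled_commutator k \<in> borel_measurable borel" for k
    unfolding scaled_commutator_def[abs_def] by measurable
  obtain L :: real where L: "L \<ge> 0" "\<And>h z. \<bar>dderiv h bump (z :: (real ^ 'n) \<times> real)\<bar> \<le> L * norm h"
    by (rule real_test_dderiv_bound[OF real_test_bump[where 'a = "(real ^ 'n) \<times> real"]]) (rule that)
  have "\<forall>h. \<exists>B\<ge>0. \<forall>z. \<bar>dderiv h (dderiv h bump) (z :: (real ^ 'n) \<times> real)\<bar> \<le> B"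
    by (meson real_test_bounded[OF real_test_dderiv[OF real_test_dderiv[OF real_test_bump]]])
  from choice[OF this] obtain B where
    "\<forall>h. B h \<ge> 0 \<and> (\<forall>z. \<bar>dderiv h (dderiv h bump) (z :: (real ^ 'n) \<times> real)\<bar> \<le> B h)" ..
  then have B: "B h \<ge> 0" "\<bar>dderiv h (dderiv h bump) z\<bar> \<le> B h" for h and z :: "(real ^ 'n) \<times> real"
    by blast+
  define H where "H z = L * norm (e_t :: (real ^ 'n) \<times> real) * norm (U z) +
     (\<Sum>j\<in>UNIV. 2 * (L * norm (e_x j :: (real ^ 'n) \<times> real)) * norm (Ux j z) + B (e_x j) * norm (U z))" for z
  have sc: "sqint (\<lambda>z. c * f z)" if "sqint f" for c :: real and f :: "(real ^ 'n) \<times> real \<Rightarrow> real"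
    by (rule sqint_bound[OF that, where B = "\<bar>c\<bar>"]) (use that in \<open>auto simp: sqint_def abs_mult\<close>)
  have H: "sqint H"
    unfolding H_def[abs_def] by (intro sqint_add sqint_sum sc sqint_norm U Ux)
  have bd: "norm (scaled_commutator (real k) z) \<le> H z" if k: "k \<ge> 1" for k z
  proof -
    have 1: "norm (dderiv h bump ((1 / real k) *\<^sub>R z) *\<^sub>R x) \<le> L * norm h * norm x" for h and x :: complex
      using L(2)[of h "(1 / real k) *\<^sub>R z"] by (simp add: mult_right_mono)
    have 2: "norm ((1 / real k * dderiv h (dderiv h bump) ((1 / real k) *\<^sub>R z)) *\<^sub>R x) \<le> B h * norm x" for h and x :: complex
    proof -
      have "\<bar>1 / real k\<bar> * \<bar>dderiv h (dderiv h bump) ((1 / real k) *\<^sub>R z)\<bar> \<le> 1 * B h"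
        using k by (intro mult_mono B) auto
      then show ?thesis by (simp only: norm_scaleR abs_mult mult_1_left mult_right_mono norm_ge_zero)
    qed
    have "norm (scaled_commutator (real k) z) \<le> norm (dderiv e_t bump ((1 / real k) *\<^sub>R z) *\<^sub>R U z) +
       (\<Sum>j\<in>UNIV. norm (2 *\<^sub>R dderiv (e_x j) bump ((1 / real k) *\<^sub>R z) *\<^sub>R Ux j z +
       (1 / real k * dderiv (e_x j) (dderiv (e_x j) bump) ((1 / real k) *\<^sub>R z)) *\<^sub>R U z))"
      unfolding scaled_commutator_def
      by (rule order_trans[OF norm_triangle_ineq]) (intro add_mono norm_sum, simp add: norm_mult)
    also have "\<dots> \<le> H z"
      unfolding H_def
    proof (intro add_mono sum_mono 1)
      fix j
      have "norm (2 *\<^sub>R dderiv (e_x j) bump ((1 / real k) *\<^sub>R z) *\<^sub>R Ux j z) \<le> 2 * (L * norm (e_x j :: (real ^ 'n) \<times> real)) * norm (Ux j z)"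
        using 1[of "e_x j" "Ux j z"] by simp
      then show "norm (2 *\<^sub>R dderiv (e_x j) bump ((1 / real k) *\<^sub>R z) *\<^sub>R Ux j z +
         (1 / real k * dderiv (e_x j) (dderiv (e_x j) bump) ((1 / real k) *\<^sub>R z)) *\<^sub>R U z)
         \<le> 2 * (L * norm (e_x j :: (real ^ 'n) \<times> real)) * norm (Ux j z) + B (e_x j) * norm (U z)"
        by (intro order_trans[OF norm_triangle_ineq] add_mono 2)
    qed
    finally show ?thesis .
  qed
  \<comment> \<open>The bound by H holds for k >= 1, where 1 / k <= 1; hence the shift of the
    sequence.\<close>
  have "(\<lambda>k. \<integral>\<^sup>+ z. ennreal ((norm (scaled_commutator (real (Suc k)) z))\<^sup>2) \<partial>lborel) \<longlonglongrightarrow> (\<integral>\<^sup>+ z. 0 \<partial>(lborel :: ((real ^ 'n) \<times> real) measure))"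
  proof (rule nn_integral_dominated_convergence[where w = "\<lambda>z. ennreal ((norm (H z))\<^sup>2)"])
    show "(\<integral>\<^sup>+ z. ennreal ((norm (H z))\<^sup>2) \<partial>lborel) < \<infinity>"
      using H by (subst nn_integral_eq_integral) (auto simp: sqint_def)
    show "AE z in lborel. ennreal ((norm (scaled_commutator (real (Suc k)) z))\<^sup>2) \<le> ennreal ((norm (H z))\<^sup>2)" for k
    proof (intro AE_I2 ennreal_leI power_mono)
      fix z
      show "norm (scaled_commutator (real (Suc k)) z) \<le> norm (H z)"
        using bd[of "Suc k" z] by simp
    qed simp
    show "AE z in lborel. (\<lambda>k. ennreal ((norm (scaled_commutator (real (Suc k)) z))\<^sup>2)) \<longlonglongrightarrow> 0"
    proof (intro AE_I2)
      fix z :: "(real ^ 'n) \<times> real"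
      have r: "(\<lambda>k. 1 / real (Suc k)) \<longlonglongrightarrow> 0"
        by (rule LIMSEQ_Suc[OF lim_1_over_n])
      have z: "(\<lambda>k. (1 / real (Suc k)) *\<^sub>R z) \<longlonglongrightarrow> 0"
        using tendsto_scaleR[OF r tendsto_const[of z]] by simp
      have lim: "(\<lambda>k. \<phi> ((1 / real (Suc k)) *\<^sub>R z)) \<longlonglongrightarrow> \<phi> 0" if "real_test \<phi>" for \<phi>
      proof -
        have "isCont \<phi> 0"
          using that smooth_continuous unfolding real_test_def by (auto simp: continuous_on_eq_continuous_at)
        then show ?thesis
          by (rule isCont_tendsto_compose[OF _ z])
      qed
      note l1 = lim[OF real_test_dderiv[OF real_test_bump], unfolded dderiv_bump_0]
      note l2 = lim[OF real_test_dderiv[OF real_test_dderiv[OF real_test_bump]]]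
      have "(\<lambda>k. scaled_commutator (real (Suc k)) z) \<longlonglongrightarrow> \<i> * (0 *\<^sub>R U z) +
          (\<Sum>j\<in>(UNIV::'n set). 2 *\<^sub>R 0 *\<^sub>R Ux j z + (0 * dderiv (e_x j) (dderiv (e_x j) bump) 0) *\<^sub>R U z)"
        unfolding scaled_commutator_def by (intro tendsto_intros l1 l2 r)
      then have "(\<lambda>k. norm (scaled_commutator (real (Suc k)) z)) \<longlonglongrightarrow> 0"
        by (intro tendsto_norm_zero) simp
      then have "(\<lambda>k. ennreal ((norm (scaled_commutator (real (Suc k)) z))\<^sup>2)) \<longlonglongrightarrow> ennreal (0\<^sup>2)"
        by (intro tendsto_intros)
      then show "(\<lambda>k. ennreal ((norm (scaled_commutator (real (Suc k)) z))\<^sup>2)) \<longlonglongrightarrow> 0"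
        by simp
    qed
  qed (use H in \<open>auto simp: sqint_def\<close>)
  then show ?thesis
    by (subst filterlim_sequentially_Suc[symmetric]) simp
qed

text \<open>On the ball of radius 2 k the weight 1/w is at most k^2 / \<delta>, and the squared
  commutator is k^(-2) times the square of \<open>scaled_commutator k\<close>. The powers of k
  cancel, and the rest tends to 0.\<close>

lemma carleman_weak:
  assumes carl: "\<And>v. v \<in> test_functions \<Longrightarrow> weighted_norm (\<lambda>x. ennreal (w x)) v
      \<le> ennreal \<theta> * weighted_norm (\<lambda>x. inverse (ennreal (w x))) (schroedinger v)"
    and \<theta>: "\<theta> \<ge> 0" and w[measurable]: "w \<in> borel_measurable borel"
    and d: "\<delta> > 0" "\<forall>\<^sub>F k in sequentially. AE x in lborel. norm x \<le> 2 * real k \<longrightarrow> w x \<ge> \<delta> / (real k)\<^sup>2"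
    and \<kappa>: "\<kappa> > 0"
  shows "(\<integral>\<^sup>+ z. ennreal ((norm (U z))\<^sup>2) * ennreal (w (fst z)) \<partial>lborel) \<le>
    ennreal (\<theta>\<^sup>2 * (1 + \<kappa>)) * (\<integral>\<^sup>+ z. ennreal ((norm (SU z))\<^sup>2) * inverse (ennreal (w (fst z))) \<partial>lborel)"
proof -
  define S where "S = (\<integral>\<^sup>+ z. ennreal ((norm (SU z))\<^sup>2) * inverse (ennreal (w (fst z))) \<partial>lborel)"
  define J where "J k = (\<integral>\<^sup>+ z. ennreal ((norm (scaled_commutator (real k) z))\<^sup>2) \<partial>lborel)" for k
  define c where "c = (1 + 1 / \<kappa>) / \<delta>"
  have c: "c \<ge> 0" using \<kappa> d by (simp add: c_def)
  have [measurable]: "U \<in> borel_measurable borel" "Ux j \<in> borel_measurable borel" "SU \<in> borel_measurable borel" for j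
    using U Ux SU by (auto simp: sqint_def)
  have [measurable]: "dderiv h bump \<in> borel_measurable borel" "dderiv h (dderiv h bump) \<in> borel_measurable borel"
    "bump \<in> borel_measurable borel" for h :: "(real ^ 'n) \<times> real"
    by (intro real_test_measurable real_test_dderiv real_test_bump)+
  have [measurable]: "scaled_commutator k \<in> borel_measurable borel" for k
    unfolding scaled_commutator_def[abs_def] by measurable
  have [measurable]: "(\<lambda>z::(real ^ 'n) \<times> real. w (fst z)) \<in> borel_measurable borel"
    by (rule measurable_compose[OF _ w]) (simp add: borel_prod[symmetric])
  have step: "\<forall>\<^sub>F k in sequentially.
      (\<integral>\<^sup>+ z. ennreal ((norm (bump ((1 / real k) *\<^sub>R z) *\<^sub>R U z))\<^sup>2) * ennreal (w (fst z)) \<partial>lborel)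
      \<le> ennreal (\<theta>\<^sup>2) * (ennreal (1 + \<kappa>) * S + ennreal c * J k)"
    using d(2) eventually_gt_at_top[of 0]
  proof eventually_elim
    case (elim k)
    then have k: "real k > 0" by simp
    define \<psi> where "\<psi> = (\<lambda>z::(real ^ 'n) \<times> real. bump ((1 / real k) *\<^sub>R z))"
    have \<psi>: "real_test \<psi>"
      unfolding \<psi>_def by (rule real_test_cutoff[OF k])
    have \<psi>0: "\<psi> z = 0" if "norm z > real k" for z
      unfolding \<psi>_def using that k by (intro bump_eq_0) (simp add: le_divide_eq)
    have "\<delta> / (real k)\<^sup>2 > 0" using k d by simp
    note carleman_cutoff[OF carl \<theta> w \<psi> k \<psi>0 this elim(1)]
    also have "(\<integral>\<^sup>+ z. ennreal ((norm (\<psi> z *\<^sub>R SU z + commutator \<psi> U Ux z))\<^sup>2) *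
      min (inverse (ennreal (w (fst z)))) (ennreal (1 / (\<delta> / (real k)\<^sup>2))) \<partial>lborel)
      \<le> (\<integral>\<^sup>+ z. ennreal (1 + \<kappa>) * (ennreal ((norm (SU z))\<^sup>2) * inverse (ennreal (w (fst z))))
        + ennreal c * ennreal ((norm (scaled_commutator (real k) z))\<^sup>2) \<partial>lborel)"
    proof (rule nn_integral_mono)
      fix z :: "(real ^ 'n) \<times> real"
      let ?m = "min (inverse (ennreal (w (fst z)))) (ennreal (1 / (\<delta> / (real k)\<^sup>2)))"
      let ?E = "scaled_commutator (real k) z"
      have "(norm (\<psi> z *\<^sub>R SU z + commutator \<psi> U Ux z))\<^sup>2
          \<le> (1 + \<kappa>) * (norm (\<psi> z *\<^sub>R SU z))\<^sup>2 + (1 + 1 / \<kappa>) * (norm ((1 / real k) *\<^sub>R ?E))\<^sup>2"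
        using norm_add_sq_le[OF \<kappa>] commutator_rescaled[OF k, of z] unfolding \<psi>_def by metis
      also have "\<dots> \<le> (1 + \<kappa>) * (norm (SU z))\<^sup>2 + (1 + 1 / \<kappa>) * (norm ?E)\<^sup>2 / (real k)\<^sup>2"
      proof (intro add_mono mult_left_mono power_mono)
        have "\<bar>\<psi> z\<bar> \<le> 1" by (simp add: \<psi>_def bump_nonneg bump_le_1)
        then show "norm (\<psi> z *\<^sub>R SU z) \<le> norm (SU z)"
          by (simp add: mult_left_le_one_le)
      qed (use \<kappa> in \<open>auto simp: power_divide\<close>)
      finally have "ennreal ((norm (\<psi> z *\<^sub>R SU z + commutator \<psi> U Ux z))\<^sup>2)
         \<le> ennreal ((1 + \<kappa>) * (norm (SU z))\<^sup>2) + ennreal ((1 + 1 / \<kappa>) * (norm ?E)\<^sup>2 / (real k)\<^sup>2)"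
        using \<kappa> by (subst ennreal_plus[symmetric]) (auto intro!: ennreal_leI simp del: ennreal_plus)
      then have "ennreal ((norm (\<psi> z *\<^sub>R SU z + commutator \<psi> U Ux z))\<^sup>2) * ?m
         \<le> (ennreal ((1 + \<kappa>) * (norm (SU z))\<^sup>2) + ennreal ((1 + 1 / \<kappa>) * (norm ?E)\<^sup>2 / (real k)\<^sup>2)) * ?m"
        by (rule mult_right_mono) simp
      \<comment> \<open>The minimum is estimated by 1/w in the main term and by k^2 / \<delta> in
        the commutator term.\<close>
      also have "\<dots> \<le> ennreal ((1 + \<kappa>) * (norm (SU z))\<^sup>2) * inverse (ennreal (w (fst z)))
          + ennreal ((1 + 1 / \<kappa>) * (norm ?E)\<^sup>2 / (real k)\<^sup>2) * ennreal (1 / (\<delta> / (real k)\<^sup>2))"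
        unfolding distrib_right by (intro add_mono mult_left_mono) auto
      also have "\<dots> = ennreal (1 + \<kappa>) * (ennreal ((norm (SU z))\<^sup>2) * inverse (ennreal (w (fst z))))
          + ennreal c * ennreal ((norm ?E)\<^sup>2)"
      proof -
        have "(1 + 1 / \<kappa>) * (norm ?E)\<^sup>2 / (real k)\<^sup>2 * (1 / (\<delta> / (real k)\<^sup>2)) = c * (norm ?E)\<^sup>2"
          using k by (simp add: c_def)
        then have "ennreal ((1 + 1 / \<kappa>) * (norm ?E)\<^sup>2 / (real k)\<^sup>2) * ennreal (1 / (\<delta> / (real k)\<^sup>2))
            = ennreal c * ennreal ((norm ?E)\<^sup>2)"
          using \<kappa> d(1) c by (subst (1 2) ennreal_mult[symmetric]) auto
        moreover have "ennreal ((1 + \<kappa>) * (norm (SU z))\<^sup>2) = ennreal (1 + \<kappa>) * ennreal ((norm (SU z))\<^sup>2)"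
          using \<kappa> by (intro ennreal_mult) auto
        ultimately show ?thesis by (simp add: mult.assoc)
      qed
      finally show "ennreal ((norm (\<psi> z *\<^sub>R SU z + commutator \<psi> U Ux z))\<^sup>2) * ?m
         \<le> ennreal (1 + \<kappa>) * (ennreal ((norm (SU z))\<^sup>2) * inverse (ennreal (w (fst z)))) + ennreal c * ennreal ((norm ?E)\<^sup>2)" .
    qed
    also have "\<dots> = ennreal (1 + \<kappa>) * S + ennreal c * J k"
      unfolding S_def J_def by (subst nn_integral_add) (auto simp: nn_integral_cmult)
    finally show ?case
      by (simp add: \<psi>_def mult_left_mono)
  qed
  have "(\<integral>\<^sup>+ z. ennreal ((norm (U z))\<^sup>2) * ennreal (w (fst z)) \<partial>lborel)
     \<le> ennreal (\<theta>\<^sup>2) * (ennreal (1 + \<kappa>) * S)"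
  proof (rule nn_integral_Fatou_le[OF _ _ step])
    show "AE z in lborel. (\<lambda>k. ennreal ((norm (bump ((1 / real k) *\<^sub>R z) *\<^sub>R U z))\<^sup>2) * ennreal (w (fst z)))
      \<longlonglongrightarrow> ennreal ((norm (U z))\<^sup>2) * ennreal (w (fst z))"
    proof (intro AE_I2)
      fix z :: "(real ^ 'n) \<times> real"
      have "(\<lambda>k. (1 / real k) *\<^sub>R z) \<longlonglongrightarrow> 0"
        using tendsto_scaleR[OF lim_1_over_n tendsto_const[of z]] by simp
      moreover have "isCont bump (0 :: (real ^ 'n) \<times> real)"
        using smooth_continuous[OF smooth_bump] by (auto simp: continuous_on_eq_continuous_at)
      ultimately have "(\<lambda>k. bump ((1 / real k) *\<^sub>R z)) \<longlonglongrightarrow> 1"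
        using isCont_tendsto_compose[of 0 bump] bump_0 by metis
      then have "(\<lambda>k. ennreal ((norm (bump ((1 / real k) *\<^sub>R z) *\<^sub>R U z))\<^sup>2)) \<longlonglongrightarrow> ennreal ((norm (1 *\<^sub>R U z))\<^sup>2)"
        by (intro tendsto_intros)
      then show "(\<lambda>k. ennreal ((norm (bump ((1 / real k) *\<^sub>R z) *\<^sub>R U z))\<^sup>2) * ennreal (w (fst z)))
        \<longlonglongrightarrow> ennreal ((norm (U z))\<^sup>2) * ennreal (w (fst z))"
        by (intro tendsto_mult_ennreal tendsto_const) auto
    qed
    have "(\<lambda>k. ennreal c * J k) \<longlonglongrightarrow> ennreal c * 0"
      unfolding J_def by (intro ennreal_tendsto_cmult scaled_commutator_tendsto_0) simp
    then have "(\<lambda>k. ennreal (1 + \<kappa>) * S + ennreal c * J k) \<longlonglongrightarrow> ennreal (1 + \<kappa>) * S + 0"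
      by (intro tendsto_add tendsto_const) simp
    then show "(\<lambda>k. ennreal (\<theta>\<^sup>2) * (ennreal (1 + \<kappa>) * S + ennreal c * J k)) \<longlonglongrightarrow> ennreal (\<theta>\<^sup>2) * (ennreal (1 + \<kappa>) * S)"
      by (intro ennreal_tendsto_cmult) auto
  qed measurable
  then show ?thesis
    unfolding S_def using \<kappa> by (simp add: ennreal_mult mult.assoc)
qed

end

section \<open>Fefferman-Phong weights\<close>

lemma compact_is_cube:
  fixes Q :: "(real ^ 'n) set"
  assumes "is_cube Q"
  shows "compact Q"
proof -
  obtain a s and T :: "real ^ 'n \<Rightarrow> real ^ 'n" where T: "orthogonal_transformation T" and Q: "Q = (\<lambda>x. a + T x) ` cbox 0 (\<chi> i. s)"
    using assms unfolding is_cube_def by blast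
  have "bounded_linear T"
    using T by (simp add: orthogonal_transformation_def linear_conv_bounded_linear)
  then have "continuous_on A (\<lambda>x. a + T x)" for A
    by (intro continuous_on_add continuous_on_const linear_continuous_on)
  then show ?thesis
    unfolding Q by (intro compact_continuous_image compact_cbox)
qed

lemma Lp_loc_integrable:
  assumes "V \<in> Lp_loc p" "compact K"
  shows "set_integrable lebesgue K (\<lambda>x. norm (V x) powr p)"
  using assms by (auto simp: Lp_loc_def)

lemma Lp_loc_mono:
  fixes V W :: "real ^ 'n \<Rightarrow> complex"
  assumes V: "V \<in> Lp_loc p" and W: "W \<in> borel_measurable lebesgue" and p: "p \<ge> 0"
    and le: "AE x in lebesgue. norm (W x) \<le> norm (V x)"
  shows "W \<in> Lp_loc p"
  unfolding Lp_loc_def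
proof (intro CollectI conjI allI impI W)
  fix K :: "(real ^ 'n) set" assume K: "compact K"
  have pm: "(\<lambda>y::real. y powr p) \<in> borel_measurable borel" by measurable
  show "set_integrable lebesgue K (\<lambda>x. norm (W x) powr p)"
  proof (rule set_integrable_bound[OF Lp_loc_integrable[OF V K]])
    show "set_borel_measurable lebesgue K (\<lambda>x. norm (W x) powr p)"
      unfolding set_borel_measurable_def using K W
      by (intro borel_measurable_scaleR borel_measurable_indicator measurable_compose[OF borel_measurable_norm pm])
        (auto dest: lmeasurable_compact)
    show "AE x in lebesgue. x \<in> K \<longrightarrow> norm (norm (W x) powr p) \<le> norm (norm (V x) powr p)"
      using le by eventually_elim (auto intro: powr_mono2 p)
  qed
qed

text \<open>Makes truncations of the weight admissible in the Carleman inequality. Local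
  integrability of W is settled first, as monotonicity of the real integral depends on it.\<close>

lemma FP_mono:
  fixes V W :: "real ^ 'n \<Rightarrow> complex"
  assumes V: "V \<in> FP p" and W: "W \<in> borel_measurable lebesgue" and p: "p > 0"
    and le: "AE x in lebesgue. norm (W x) \<le> norm (V x)"
  shows "W \<in> FP p" "FP_norm p W \<le> FP_norm p V"
proof -
  have VL: "V \<in> Lp_loc p" using V by (simp add: FP_def)
  have WL: "W \<in> Lp_loc p" by (rule Lp_loc_mono[OF VL W _ le]) (use p in simp)
  show *: "FP_norm p W \<le> FP_norm p V"
    unfolding FP_norm_def
  proof (rule SUP_mono, intro bexI)
    fix Q :: "(real ^ 'n) set" assume Q: "Q \<in> {Q. is_cube Q}"
    then have c: "compact Q" using compact_is_cube by auto
    have "(LINT x:Q|lebesgue. norm (W x) powr p) \<le> (LINT x:Q|lebesgue. norm (V x) powr p)"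
      unfolding set_lebesgue_integral_def
    proof (rule integral_mono_AE)
      show "AE x in lebesgue. indicat_real Q x *\<^sub>R norm (W x) powr p \<le> indicat_real Q x *\<^sub>R norm (V x) powr p"
        using le by eventually_elim (use p in \<open>auto intro!: mult_left_mono powr_mono2\<close>)
    qed (use Lp_loc_integrable[OF VL c] Lp_loc_integrable[OF WL c] in \<open>auto simp: set_integrable_def\<close>)
    moreover have "0 \<le> (LINT x:Q|lebesgue. norm (W x) powr p)"
      unfolding set_lebesgue_integral_def by (intro integral_nonneg_AE) auto
    ultimately show "ennreal (measure lebesgue Q powr (2 / real CARD('n)) * (1 / measure lebesgue Q * (LINT x:Q|lebesgue. norm (W x) powr p)) powr (1 / p))
      \<le> ennreal (measure lebesgue Q powr (2 / real CARD('n)) * (1 / measure lebesgue Q * (LINT x:Q|lebesgue. norm (V x) powr p)) powr (1 / p))"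
      using p by (intro ennreal_leI mult_left_mono powr_mono2) auto
  qed
  show "W \<in> FP p"
    using V WL * by (auto simp: FP_def intro: order.strict_trans1)
qed

text \<open>Cut the ball into dyadic shells: for s / 2^(k+1) < |x| <= s / 2^k the integrand is at
  most its value on the inner sphere, and the shell has at most the volume of its outer ball. The
  resulting series is geometric with ratio 2^(a - n) < 1.\<close>

lemma nn_integral_norm_powr_cball:
  fixes a :: real
  assumes a: "0 \<le> a" "a < DIM('a::euclidean_space)"
  obtains K where "K \<ge> 0" "\<And>s. s > 0 \<Longrightarrow>
    (\<integral>\<^sup>+ x. ennreal (norm (x::'a) powr (- a)) * indicator (cball 0 s) x \<partial>lborel)
      \<le> ennreal (K * s powr (real DIM('a) - a))"
proof -
  let ?n = "DIM('a)"
  define \<omega> where "\<omega> = unit_ball_vol (real ?n)"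
  have \<omega>: "\<omega> \<ge> 0" by (simp add: \<omega>_def)
  define q where "q = 2 powr (a - real ?n)"
  have q: "0 < q" "q < 1"
    using a powr_less_mono[of "a - real ?n" 0 2] by (auto simp: q_def)
  define K where "K = \<omega> * 2 powr a * (1 / (1 - q))"
  have "(\<integral>\<^sup>+ x. ennreal (norm (x::'a) powr (- a)) * indicator (cball 0 s) x \<partial>lborel)
      \<le> ennreal (K * s powr (real ?n - a))" if s: "s > 0" for s :: real
  proof -
    define r where "r k = s / 2 ^ k" for k :: nat
    have r: "r k > 0" for k using s by (simp add: r_def)
    have pt: "ennreal (norm x powr (- a)) * indicator (cball 0 s) x
        \<le> (\<Sum>k. ennreal (r (Suc k) powr (- a)) * indicator (cball 0 (r k)) x)" for x :: 'a
    \<comment> \<open>At the origin the integrand is 0, because \<open>0 powr y = 0\<close>.\<close>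
    proof (cases "x \<noteq> 0 \<and> norm x \<le> s")
      case True
      have "\<exists>k. r k < norm x"
      proof -
        have "(\<lambda>k. s * (1 / 2) ^ k) \<longlonglongrightarrow> s * 0"
          by (intro tendsto_mult tendsto_const LIMSEQ_realpow_zero) auto
        then have "\<forall>\<^sub>F k in sequentially. s * (1 / 2) ^ k < norm x"
          by (rule order_tendstoD) (use True in auto)
        then show ?thesis
          using eventually_happens'[OF sequentially_bot] by (fastforce simp: r_def power_divide)
      qed
      \<comment> \<open>The least index with r k < |x| is not 0, as r 0 = s >= |x|; its predecessor
        numbers the shell of x.\<close>
      then have l: "r (LEAST k. r k < norm x) < norm x" (is "r ?l < _")
        by (rule LeastI_ex)
      have "?l \<noteq> 0"
        using l True by (intro notI) (simp add: r_def)
      then obtain k where k: "?l = Suc k"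
        by (cases ?l) auto
      have "\<not> r k < norm x"
        by (rule not_less_Least) (use k in simp)
      then have in': "x \<in> cball 0 (r k)" by simp
      have "norm x powr (- a) \<le> r (Suc k) powr (- a)"
        using l k r[of "Suc k"] a by (intro powr_mono2') auto
      then have "ennreal (norm x powr (- a)) * indicator (cball 0 s) x
        \<le> (\<Sum>k\<in>{k}. ennreal (r (Suc k) powr (- a)) * indicator (cball 0 (r k)) x)"
        using in' True by (simp add: ennreal_leI)
      also have "\<dots> \<le> (\<Sum>k. ennreal (r (Suc k) powr (- a)) * indicator (cball 0 (r k)) x)"
        by (rule sum_le_suminf) auto
      finally show ?thesis .
    qed auto
    have "(\<integral>\<^sup>+ x. ennreal (norm x powr (- a)) * indicator (cball 0 s) x \<partial>(lborel :: 'a measure))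
        \<le> (\<integral>\<^sup>+ x. (\<Sum>k. ennreal (r (Suc k) powr (- a)) * indicator (cball 0 (r k)) x) \<partial>(lborel :: 'a measure))"
      by (intro nn_integral_mono pt)
    also have "\<dots> = (\<Sum>k. \<integral>\<^sup>+ x. ennreal (r (Suc k) powr (- a)) * indicator (cball 0 (r k)) x \<partial>(lborel :: 'a measure))"
      by (intro nn_integral_suminf borel_measurable_times_ennreal borel_measurable_const borel_measurable_indicator) simp
    also have "\<dots> = (\<Sum>k. ennreal (\<omega> * 2 powr a * s powr (real ?n - a) * q ^ k))"
    proof (rule suminf_cong)
      fix k
      have q1: "r (Suc k) powr (- a) = 2 powr a * r k powr (- a)"
      proof -
        have "r (Suc k) powr (- a) = (r k / 2) powr (- a)"
          by (simp add: r_def mult.commute)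
        also have "\<dots> = r k powr (- a) / 2 powr (- a)"
          using r[of k] by (simp add: powr_divide)
        finally show ?thesis by (simp add: powr_minus_divide)
      qed
      have q2: "r k ^ ?n = r k powr real ?n"
        using r[of k] by (simp add: powr_realpow)
      have q3: "2 powr a * r k powr (- a) * (\<omega> * r k powr real ?n) = \<omega> * 2 powr a * r k powr (real ?n - a)"
        by (simp add: powr_add[symmetric])
      have q4: "r k powr (real ?n - a) = s powr (real ?n - a) * q ^ k"
      proof -
        define b where "b = real ?n - a"
        have "(2 ^ k) powr b = (2 powr b) ^ k"
          by (simp add: powr_realpow[symmetric] powr_powr mult.commute)
        then have "r k powr b = s powr b / (2 powr b) ^ k"
          using s by (simp add: r_def powr_divide)
        moreover have "q = 1 / 2 powr b"
          by (simp add: q_def b_def powr_minus_divide[symmetric])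
        ultimately show ?thesis
          by (simp add: b_def[symmetric] power_divide)
      qed
      have "(\<integral>\<^sup>+ x. ennreal (r (Suc k) powr (- a)) * indicator (cball 0 (r k)) x \<partial>(lborel :: 'a measure))
        = ennreal (r (Suc k) powr (- a)) * ennreal (\<omega> * r k ^ ?n)"
        using r[of k] by (subst nn_integral_cmult_indicator) (simp_all add: emeasure_cball \<omega>_def)
      also have "\<dots> = ennreal (r (Suc k) powr (- a) * (\<omega> * r k ^ ?n))"
        using \<omega> r[of k] by (intro ennreal_mult[symmetric]) auto
      also have "\<dots> = ennreal (\<omega> * 2 powr a * s powr (real ?n - a) * q ^ k)"
        by (simp only: q1 q2 q3 q4 mult.assoc[of _ _ "q ^ k"])
      finally show "(\<integral>\<^sup>+ x. ennreal (r (Suc k) powr (- a)) * indicator (cball 0 (r k)) x \<partial>(lborel :: 'a measure))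
        = ennreal (\<omega> * 2 powr a * s powr (real ?n - a) * q ^ k)" .
    qed
    also have "\<dots> = ennreal (\<omega> * 2 powr a * s powr (real ?n - a) * (1 / (1 - q)))"
      using q \<omega> by (intro suminf_ennreal_eq sums_mult geometric_sums) auto
    also have "\<dots> = ennreal (K * s powr (real ?n - a))"
      by (simp add: K_def mult_ac)
    finally show ?thesis .
  qed
  moreover have "K \<ge> 0" using \<omega> q by (simp add: K_def)
  ultimately show thesis using that by blast
qed

text \<open>The power 1 - 2 p / n is the one for which |Q|^(2/n) times the L^p average of |x|^(-2)
  over Q is bounded independently of the size of Q. Arguing for compact sets disposes of the
  position and orientation of the cubes.\<close>

lemma inverse_square_cube_bound:
  assumes p: "0 < p" "2 * p < real CARD('n)"
  obtains K where "K \<ge> 0"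
    "\<And>Q. compact Q \<Longrightarrow> set_integrable lebesgue Q (\<lambda>x :: real ^ 'n. norm x powr (- (2 * p)))"
    "\<And>Q. compact Q \<Longrightarrow> (LINT x:Q|lebesgue. norm (x :: real ^ 'n) powr (- (2 * p)))
      \<le> K * measure lebesgue Q powr (1 - 2 * p / real CARD('n))"
proof -
  let ?n = "real CARD('n)"
  let ?g = "\<lambda>x :: real ^ 'n. norm x powr (- (2 * p))"
  have n: "?n > 0" by simp
  obtain K where K: "K \<ge> 0" "\<And>s. s > 0 \<Longrightarrow>
    (\<integral>\<^sup>+ x. ennreal (?g x) * indicator (cball 0 s) x \<partial>lborel) \<le> ennreal (K * s powr (?n - 2 * p))"
    using nn_integral_norm_powr_cball[where 'a = "real ^ 'n" and a = "2 * p"] p by auto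
  have gm: "?g \<in> borel_measurable lebesgue"
    by (intro measurable_completion) simp
  have int: "set_integrable lebesgue Q ?g" if Q: "compact Q" for Q
  proof -
    obtain s where s: "s > 0" "Q \<subseteq> cball 0 s"
      using compact_imp_bounded[OF Q] by (metis bounded_pos mem_cball_0 subsetI)
    have "integrable lborel (\<lambda>x. ?g x * indicator (cball 0 s) x)"
    proof (rule integrableI_nonneg)
      have "(\<integral>\<^sup>+ x. ennreal (?g x * indicator (cball 0 s) x) \<partial>lborel) = (\<integral>\<^sup>+ x. ennreal (?g x) * indicator (cball 0 s) x \<partial>lborel)"
        by (intro nn_integral_cong) (auto simp: indicator_def)
      also have "\<dots> \<le> ennreal (K * s powr (?n - 2 * p))" by (rule K(2)[OF s(1)])
      finally show "(\<integral>\<^sup>+ x. ennreal (?g x * indicator (cball 0 s) x) \<partial>lborel) < \<infinity>"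
        by (rule order.strict_trans1) simp
      show "(\<lambda>x. ?g x * indicator (cball 0 s) x) \<in> borel_measurable lborel"
        by (intro borel_measurable_times borel_measurable_indicator) simp_all
    qed auto
    then have "set_integrable lborel (cball 0 s) ?g"
      by (simp add: set_integrable_def mult.commute)
    then have "set_integrable lebesgue (cball 0 s) ?g"
      unfolding set_integrable_def by (subst integrable_completion) auto
    then show ?thesis
      by (rule set_integrable_subset) (use s Q lmeasurable_compact in auto)
  qed
  \<comment> \<open>K accounts for the part of Q inside the ball of radius s, the 1 for the part
    outside.\<close>
  have bound: "(LINT x:Q|lebesgue. ?g x) \<le> (K + 1) * measure lebesgue Q powr (1 - 2 * p / ?n)" if Q: "compact Q" for Q
  proof (cases "measure lebesgue Q = 0")
    case True
    then have "Q \<in> null_sets lebesgue"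
      using lmeasurable_compact[OF Q] emeasure_eq_measure2[OF lmeasurable_compact[OF Q]]
      by (intro null_setsI fmeasurableD) simp_all
    then have "AE x in lebesgue. indicat_real Q x *\<^sub>R ?g x = 0"
      by (auto dest!: AE_not_in elim!: eventually_mono)
    then have "(LINT x:Q|lebesgue. ?g x) = 0"
      unfolding set_lebesgue_integral_def by (rule integral_eq_zero_AE)
    then show ?thesis using K(1) by simp
  next
    case False
    define m where "m = measure lebesgue Q"
    have m: "m > 0" using False by (simp add: m_def zero_less_measure_iff)
    \<comment> \<open>Off the ball of the radius \<open>s\<close> with \<open>s\<^sup>n = |Q|\<close> the integrand is at most \<open>s powr (- 2 p)\<close>,
      so that the shape of \<open>Q\<close> is irrelevant.\<close>
    define s where "s = m powr (1 / ?n)"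
    have s: "s > 0" using m by (simp add: s_def)
    have Ql: "Q \<in> sets lebesgue" "emeasure lebesgue Q = ennreal m"
      using lmeasurable_compact[OF Q] by (auto simp: m_def emeasure_eq_measure2 fmeasurableD)
    have "ennreal (LINT x:Q|lebesgue. ?g x) = (\<integral>\<^sup>+ x. ennreal (indicator Q x *\<^sub>R ?g x) \<partial>lebesgue)"
      unfolding set_lebesgue_integral_def using int[OF Q]
      by (subst nn_integral_eq_integral) (auto simp: set_integrable_def)
    also have "\<dots> \<le> (\<integral>\<^sup>+ x. ennreal (?g x) * indicator (cball 0 s) x + ennreal (s powr (- (2 * p))) * indicator Q x \<partial>lebesgue)"
    proof (rule nn_integral_mono)
      fix x :: "real ^ 'n"
      show "ennreal (indicator Q x *\<^sub>R ?g x) \<le> ennreal (?g x) * indicator (cball 0 s) x + ennreal (s powr (- (2 * p))) * indicator Q x"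
      proof (cases "norm x \<le> s")
        case False
        then have "?g x \<le> s powr (- (2 * p))"
          using p s by (intro powr_mono2') auto
        then show ?thesis using False by (auto simp: indicator_def intro: ennreal_leI)
      qed (auto simp: indicator_def)
    qed
    also have "\<dots> = (\<integral>\<^sup>+ x. ennreal (?g x) * indicator (cball 0 s) x \<partial>lebesgue) + (\<integral>\<^sup>+ x. ennreal (s powr (- (2 * p))) * indicator Q x \<partial>lebesgue)"
      using gm Ql by (intro nn_integral_add borel_measurable_times_ennreal borel_measurable_indicator) auto
    also have "(\<integral>\<^sup>+ x. ennreal (?g x) * indicator (cball 0 s) x \<partial>lebesgue) = (\<integral>\<^sup>+ x. ennreal (?g x) * indicator (cball 0 s) x \<partial>lborel)"
      by (rule nn_integral_completion)
    also have "(\<integral>\<^sup>+ x. ennreal (s powr (- (2 * p))) * indicator Q x \<partial>lebesgue) = ennreal (s powr (- (2 * p))) * ennreal m"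
      using Ql by (subst nn_integral_cmult_indicator) simp_all
    also have "(\<integral>\<^sup>+ x. ennreal (?g x) * indicator (cball 0 s) x \<partial>lborel) + ennreal (s powr (- (2 * p))) * ennreal m
       \<le> ennreal (K * s powr (?n - 2 * p)) + ennreal (s powr (- (2 * p)) * m)"
      using K(2)[OF s] m by (intro add_mono) (auto simp: ennreal_mult)
    also have "s powr (?n - 2 * p) = m powr (1 - 2 * p / ?n)"
      by (simp add: s_def powr_powr diff_divide_distrib)
    also have "s powr (- (2 * p)) * m = m powr (1 - 2 * p / ?n)"
      using m powr_add[of m "- (2 * p / ?n)" 1] by (simp add: s_def powr_powr)
    also have "ennreal (K * m powr (1 - 2 * p / ?n)) + ennreal (m powr (1 - 2 * p / ?n)) = ennreal ((K + 1) * m powr (1 - 2 * p / ?n))"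
      using K(1) by (subst ennreal_plus[symmetric]) (auto simp: algebra_simps)
    finally show ?thesis
      unfolding m_def[symmetric] using K(1) by (subst (asm) ennreal_le_iff) auto
  qed
  show thesis
    by (rule that[of "K + 1"]) (use K(1) int bound in auto)
qed

text \<open>The p-th power of the cube expression is m^(2 p / N - 1) I, which is linear in I; thus
  the two contributions add up as p-th powers, and the second one becomes b, independently of the
  cube.\<close>

lemma cube_value_le:
  fixes m I J M A b p N :: real
  assumes p: "p > 0" and N: "N > 0" and m: "m > 0" and A: "m powr (2 / N) * (1 / m * J) powr (1 / p) \<le> A"
    and J: "J \<ge> 0" and I: "I \<ge> 0" "I \<le> J + b * m powr (1 - 2 * p / N)"
    and M: "A powr p + b \<le> M powr p" "M \<ge> 0"
  shows "m powr (2 / N) * (1 / m * I) powr (1 / p) \<le> M"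
proof -
  have pw: "(m powr (2 / N) * (1 / m * X) powr (1 / p)) powr p = m powr (2 * p / N - 1) * X" if "X \<ge> 0" for X
  proof -
    have "(m powr (2 / N) * (1 / m * X) powr (1 / p)) powr p = m powr (2 / N * p) * (1 / m * X)"
      using that p m by (simp add: powr_mult powr_powr)
    also have "\<dots> = m powr (2 * p / N - 1) * X"
      using m by (simp add: powr_diff mult.commute)
    finally show ?thesis .
  qed
  have "m powr (2 * p / N - 1) * I \<le> m powr (2 * p / N - 1) * (J + b * m powr (1 - 2 * p / N))"
    by (intro mult_left_mono I) simp
  also have "\<dots> = m powr (2 * p / N - 1) * J + b * (m powr (2 * p / N - 1) * m powr (1 - 2 * p / N))"
    by (simp add: algebra_simps)
  also have "m powr (2 * p / N - 1) * m powr (1 - 2 * p / N) = 1"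
    using m by (simp add: powr_add[symmetric])
  also have "m powr (2 * p / N - 1) * J \<le> A powr p"
    unfolding pw[OF J, symmetric] using A p J by (intro powr_mono2) auto
  finally have "(m powr (2 / N) * (1 / m * I) powr (1 / p)) powr p \<le> M powr p"
    using M(1) unfolding pw[OF I(1)] by simp
  then show ?thesis
    using p M(2) by (meson not_less powr_less_mono2)
qed

text \<open>The p-th power of a maximum is at most the sum of the p-th powers, so the p-th power of
  the norm grows by at most \<open>\<epsilon> powr p * K\<close>, which fits into the gap between
  the norm of V and M. As V is merely Lebesgue measurable, the Borel function W is prescribed up to
  null sets.\<close>

lemma FP_max_inverse_square:
  fixes V :: "real ^ 'n \<Rightarrow> complex" and W :: "real ^ 'n \<Rightarrow> real"
  assumes p: "0 < p" "2 * p < real CARD('n)" and V: "V \<in> FP p" "FP_norm p V < ennreal M"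
  obtains \<epsilon> where "\<epsilon> > 0" "\<And>W. W \<in> borel_measurable borel \<Longrightarrow>
      AE x in lebesgue. W x = max (norm (V x)) (\<epsilon> * norm x powr (-2)) \<Longrightarrow>
      (\<lambda>x. complex_of_real (W x)) \<in> FP p \<and> FP_norm p (\<lambda>x. complex_of_real (W x)) \<le> ennreal M"
proof -
  let ?n = "real CARD('n)"
  let ?g = "\<lambda>x :: real ^ 'n. norm x powr (- (2 * p))"
  define A where "A = enn2real (FP_norm p V)"
  have A: "FP_norm p V = ennreal A" "A \<ge> 0"
    using V(1) by (auto simp: FP_def A_def)
  have AM: "A < M" "M > 0"
    using V(2) A by (auto simp: ennreal_less_iff) 
  obtain K where K: "K \<ge> 0" "\<And>Q. compact Q \<Longrightarrow> set_integrable lebesgue Q ?g"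
    "\<And>Q. compact Q \<Longrightarrow> (LINT x:Q|lebesgue. ?g x) \<le> K * measure lebesgue Q powr (1 - 2 * p / ?n)"
    using inverse_square_cube_bound[OF p] by blast
  \<comment> \<open>Solves \<open>\<epsilon> powr p * (K + 1) = M powr p - A powr p\<close>; the 1
    excludes division by 0.\<close>
  define \<epsilon> where "\<epsilon> = ((M powr p - A powr p) / (K + 1)) powr (1 / p)"
  have d: "M powr p - A powr p > 0"
    using AM A p by (simp add: powr_less_mono2)
  have \<epsilon>: "\<epsilon> > 0"
    using d K(1) by (simp add: \<epsilon>_def)
  have \<epsilon>p: "\<epsilon> powr p * K \<le> M powr p - A powr p"
  proof -
    have "\<epsilon> powr p = (M powr p - A powr p) / (K + 1)"
      using d p K(1) by (simp add: \<epsilon>_def powr_powr)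
    moreover have "(M powr p - A powr p) * K \<le> (M powr p - A powr p) * (K + 1)"
      using d by (intro mult_left_mono) auto
    ultimately show ?thesis
      using K(1) by (simp add: divide_le_eq)
  qed
  have VL: "V \<in> Lp_loc p" using V by (simp add: FP_def)
  have "(\<lambda>x. complex_of_real (W x)) \<in> FP p \<and> FP_norm p (\<lambda>x. complex_of_real (W x)) \<le> ennreal M"
    if W: "W \<in> borel_measurable borel" and eq: "AE x in lebesgue. W x = max (norm (V x)) (\<epsilon> * norm x powr (-2))" for W
  proof -
    have pt: "AE x in lebesgue. norm (complex_of_real (W x)) powr p \<le> norm (V x) powr p + \<epsilon> powr p * ?g x"
      using eq
    proof eventually_elim
      case (elim x)
      have "(\<epsilon> * norm x powr (-2)) powr p = \<epsilon> powr p * ?g x"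
        using \<epsilon> by (simp add: powr_mult powr_powr)
      moreover have "W x \<ge> 0" using elim by (simp add: le_max_iff_disj)
      ultimately show ?case
        using elim \<epsilon> by (auto simp: max_def)
    qed
    have gI: "set_integrable lebesgue Q (\<lambda>x. norm (V x) powr p + \<epsilon> powr p * ?g x)" if "compact Q" for Q
      by (intro set_integral_add set_integrable_mult_right Lp_loc_integrable[OF VL that] K(2)[OF that])
    have Wm: "(\<lambda>x. norm (complex_of_real (W x)) powr p) \<in> borel_measurable lebesgue"
      by (rule measurable_completion) (use W in simp)
    have WI: "set_integrable lebesgue Q (\<lambda>x. norm (complex_of_real (W x)) powr p)" if Q: "compact Q" for Q
    proof (rule set_integrable_bound[OF gI[OF Q]])
      show "set_borel_measurable lebesgue Q (\<lambda>x. norm (complex_of_real (W x)) powr p)"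
        unfolding set_borel_measurable_def using Q
        by (intro borel_measurable_scaleR borel_measurable_indicator Wm) (auto dest: lmeasurable_compact)
      show "AE x in lebesgue. x \<in> Q \<longrightarrow> norm (norm (complex_of_real (W x)) powr p) \<le> norm (norm (V x) powr p + \<epsilon> powr p * ?g x)"
        using pt by eventually_elim auto
    qed
    have Wc: "(\<lambda>x. complex_of_real (W x)) \<in> borel_measurable lebesgue"
      by (rule measurable_completion) (use W in simp)
    have WL: "(\<lambda>x. complex_of_real (W x)) \<in> Lp_loc p"
      unfolding Lp_loc_def using WI Wc by blast
    moreover have "FP_norm p (\<lambda>x. complex_of_real (W x)) \<le> ennreal M"
      unfolding FP_norm_def
    proof (rule SUP_least)
      fix Q :: "(real ^ 'n) set" assume Q: "Q \<in> {Q. is_cube Q}"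
      then have c: "compact Q" using compact_is_cube by auto
      define m where "m = measure lebesgue Q"
      define I where "I = (LINT x:Q|lebesgue. norm (complex_of_real (W x)) powr p)"
      define J where "J = (LINT x:Q|lebesgue. norm (V x) powr p)"
      have IJ: "I \<ge> 0" "J \<ge> 0"
        unfolding I_def J_def set_lebesgue_integral_def by (auto intro!: integral_nonneg_AE)
      have "I \<le> (LINT x:Q|lebesgue. norm (V x) powr p + \<epsilon> powr p * ?g x)"
        unfolding I_def set_lebesgue_integral_def
      proof (rule integral_mono_AE)
        show "AE x in lebesgue. indicat_real Q x *\<^sub>R norm (complex_of_real (W x)) powr p
            \<le> indicat_real Q x *\<^sub>R (norm (V x) powr p + \<epsilon> powr p * ?g x)"
          using pt by eventually_elim (auto intro!: mult_left_mono)
      qed (use gI[OF c] WI[OF c] in \<open>auto simp: set_integrable_def\<close>)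
      also have "\<dots> = J + \<epsilon> powr p * (LINT x:Q|lebesgue. ?g x)"
        unfolding J_def
        by (subst set_integral_add) (auto intro!: set_integrable_mult_right Lp_loc_integrable[OF VL c] K(2)[OF c])
      also have "\<dots> \<le> J + \<epsilon> powr p * (K * m powr (1 - 2 * p / ?n))"
        unfolding m_def by (intro add_left_mono mult_left_mono K(3)[OF c]) simp
      finally have I: "I \<le> J + (\<epsilon> powr p * K) * m powr (1 - 2 * p / ?n)"
        by (simp add: mult.assoc)
      have "m powr (2 / ?n) * (1 / m * I) powr (1 / p) \<le> M"
      \<comment> \<open>For m = 0 the value is 0, as \<open>0 powr y = 0\<close>; this spares the
        computation of the volume of a cube.\<close>
      proof (cases "m = 0")
        case False
        then have m: "m > 0" by (simp add: m_def zero_less_measure_iff)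
        have "ennreal (m powr (2 / ?n) * (1 / m * J) powr (1 / p)) \<le> FP_norm p V"
          unfolding FP_norm_def m_def J_def using Q by (rule SUP_upper)
        then have "m powr (2 / ?n) * (1 / m * J) powr (1 / p) \<le> A"
          using A by simp
        then show ?thesis
          using cube_value_le[OF p(1) _ m _ IJ(2,1) I] \<epsilon>p AM by simp
      qed (use AM in simp)
      then show "ennreal (measure lebesgue Q powr (2 / ?n) * (1 / measure lebesgue Q *
          (LINT x:Q|lebesgue. norm (complex_of_real (W x)) powr p)) powr (1 / p)) \<le> ennreal M"
        unfolding m_def I_def by (rule ennreal_leI)
    qed
    ultimately show ?thesis
      by (auto simp: FP_def intro: order.strict_trans1)
  qed
  with \<epsilon> show thesis using that by blast
qed

text \<open>Away from the endpoint the inverse square potential supplies the lower bound at the cost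
  of a small part of the gap; at the endpoint the Borel representative of |V| inherits the assumed
  bound. Integer radii make it possible for one null set to serve all of them later.\<close>

lemma exists_weight:
  fixes V :: "real ^ 'n \<Rightarrow> complex"
  assumes p: "0 < p" "p \<le> real CARD('n) / 2" and C: "C > 0"
    and V: "V \<in> FP p" "FP_norm p V < ennreal (1 / C)"
    and endpoint: "p = real CARD('n) / 2 \<Longrightarrow>
      \<exists>\<delta>>0. \<forall>\<^sub>F R in at_top. AE x in lebesgue. norm x \<le> 2 * R \<longrightarrow> norm (V x) \<ge> \<delta> / R\<^sup>2"
  obtains W M \<delta> where "W \<in> borel_measurable borel" "\<And>x. W x \<ge> 0" "AE x in lborel. norm (V x) \<le> W x"
    "(\<lambda>x. complex_of_real (W x)) \<in> FP p" "FP_norm p (\<lambda>x. complex_of_real (W x)) \<le> ennreal M"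
    "M \<ge> 0" "C * M < 1" "\<delta> > 0"
    "\<forall>\<^sub>F k in sequentially. AE x in lborel. norm x \<le> 2 * real k \<longrightarrow> W x \<ge> \<delta> / (real k)\<^sup>2"
proof -
  have "V \<in> borel_measurable lebesgue"
    using V by (simp add: FP_def Lp_loc_def)
  then obtain V' where V'[measurable]: "V' \<in> borel_measurable borel" and eq: "AE x in lebesgue. V x = V' x"
    using lebesgue_borel_rep by blast
  define A where "A = enn2real (FP_norm p V)"
  have A: "FP_norm p V = ennreal A" "A \<ge> 0"
    using V(1) by (auto simp: FP_def A_def)
  have AC: "A < 1 / C"
    using V(2) A by (simp add: ennreal_less_iff)
  show thesis
  proof (cases "p = real CARD('n) / 2")
    case True
    from endpoint[OF True] obtain \<delta> where \<delta>: "\<delta> > 0"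
      "\<forall>\<^sub>F R in at_top. AE x in lebesgue. norm x \<le> 2 * R \<longrightarrow> norm (V x) \<ge> \<delta> / R\<^sup>2" by blast
    have W: "(\<lambda>x. complex_of_real (norm (V' x))) \<in> borel_measurable lebesgue"
      by (rule measurable_completion) simp
    have le: "AE x in lebesgue. norm (complex_of_real (norm (V' x))) \<le> norm (V x)"
      using eq by eventually_elim simp
    show thesis
    proof (rule that[of "\<lambda>x. norm (V' x)" A \<delta>])
      show "AE x in lborel. norm (V x) \<le> norm (V' x)"
        by (rule AE_completion_iff[THEN iffD1]) (use eq in \<open>auto elim: eventually_mono\<close>)
      show "\<forall>\<^sub>F k in sequentially. AE x in lborel. norm x \<le> 2 * real k \<longrightarrow> norm (V' x) \<ge> \<delta> / (real k)\<^sup>2"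
        using eventually_compose_filterlim[OF \<delta>(2) filterlim_real_sequentially]
      proof eventually_elim
        case (elim k)
        then have "AE x in lebesgue. norm x \<le> 2 * real k \<longrightarrow> norm (V' x) \<ge> \<delta> / (real k)\<^sup>2"
          using eq by eventually_elim simp
        then show ?case
          by (rule AE_completion_iff[THEN iffD1])
      qed
      show "C * A < 1" using AC C by (simp add: less_divide_eq mult.commute)
    qed (use FP_mono[OF V(1) W p(1) le] A \<delta>(1) in auto)
  next
    case False
    then have p2: "2 * p < real CARD('n)" using p by simp
    \<comment> \<open>Any value strictly between A and 1 / C leaves room on both sides.\<close>
    define M where "M = (A + 1 / C) / 2"
    have M: "A < M" "M < 1 / C" using AC by (auto simp: M_def)
    then have VM: "FP_norm p V < ennreal M" using A by (simp add: ennreal_less_iff)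
    obtain \<epsilon> where \<epsilon>: "\<epsilon> > 0"
      "\<And>W. W \<in> borel_measurable borel \<Longrightarrow>
        AE x in lebesgue. W x = max (norm (V x)) (\<epsilon> * norm x powr (-2)) \<Longrightarrow>
        (\<lambda>x. complex_of_real (W x)) \<in> FP p \<and> FP_norm p (\<lambda>x. complex_of_real (W x)) \<le> ennreal M"
      by (rule FP_max_inverse_square[OF p(1) p2 V(1) VM]) (rule that)
    define W where "W x = max (norm (V' x)) (\<epsilon> * norm x powr (-2))" for x
    have W: "W \<in> borel_measurable borel"
      unfolding W_def[abs_def] by measurable
    have WV: "AE x in lebesgue. W x = max (norm (V x)) (\<epsilon> * norm x powr (-2))"
      using eq by eventually_elim (simp add: W_def)
    show thesis
    \<comment> \<open>|x| <= 2 k gives |x|^(-2) >= 1 / (4 k^2), whence \<epsilon> / 4.\<close>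
    proof (rule that[of W M "\<epsilon> / 4"])
      show "AE x in lborel. norm (V x) \<le> W x"
        by (rule AE_completion_iff[THEN iffD1]) (use WV in \<open>auto elim: eventually_mono\<close>)
      show "\<forall>\<^sub>F k in sequentially. AE x in lborel. norm x \<le> 2 * real k \<longrightarrow> W x \<ge> \<epsilon> / 4 / (real k)\<^sup>2"
        using eventually_gt_at_top[of 0]
      proof eventually_elim
        case (elim k)
        \<comment> \<open>The origin is excluded because \<open>0 powr (-2)\<close> is 0 and not
          infinite.\<close>
        have "AE x in lborel. x \<noteq> (0 :: real ^ 'n)"
          by (rule AE_lborel_singleton)
        then show ?case
        proof eventually_elim
          case (elim x)
          show ?case
          proof
            assume "norm x \<le> 2 * real k"
            then have "(2 * real k) powr (-2) \<le> norm x powr (-2)"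
              using elim by (intro powr_mono2') auto
            moreover have "(2 * real k) powr (-2) = 1 / 4 / (real k)\<^sup>2"
              using \<open>0 < k\<close> by (simp add: powr_minus_divide powr_numeral power_mult_distrib)
            ultimately have "\<epsilon> * (1 / 4 / (real k)\<^sup>2) \<le> \<epsilon> * norm x powr (-2)"
              using \<epsilon>(1) by (intro mult_left_mono) auto
            then show "W x \<ge> \<epsilon> / 4 / (real k)\<^sup>2"
              by (simp add: W_def)
          qed
        qed
      qed
      show "C * M < 1" using M C by (simp add: less_divide_eq mult.commute)
    qed (use \<epsilon>(2)[OF W WV] \<epsilon>(1) W M A in \<open>auto simp: W_def max_def\<close>)
  qed
qed

section \<open>Unique continuation\<close>

text \<open>Connects the chosen \<open>weak_deriv\<close>, which occurs in the differential
  inequality, with a square integrable Borel function that can be mollified. U is prescribed, so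
  that all derivatives refer to one representative of u.\<close>

lemma sobolev_wder:
  assumes u: "u \<in> sobolev D k" and hs: "set hs \<subseteq> D" "length hs \<le> k"
    and U: "sqint U" "AE z in lebesgue. u z = U z"
  shows "\<exists>G. (AE z in lebesgue. weak_deriv hs u z = G z) \<and> wder hs U G"
proof -
  obtain g where g: "g \<in> L2" "is_weak_deriv hs u g"
    using u hs unfolding sobolev_def by blast
  obtain G where G: "sqint G" "AE z in lebesgue. g z = G z"
    using L2_rep[OF g(1)] by blast
  have "AE z in lebesgue. weak_deriv hs u z = G z"
    using weak_deriv_L2(2)[OF g] G(2) by eventually_elim simp
  then show ?thesis
    using wderI[OF g(2) U G] by blast
qed

text \<open>The order zero condition provides an L^2 function that acts on test functions like u,
  and u is a weak derivative of itself along the empty list; uniqueness identifies the two.\<close>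

lemma sobolev_rep_self:
  assumes "u \<in> sobolev D k"
  obtains U where "sqint U" "AE z in lebesgue. u z = U z"
proof -
  obtain g where g: "g \<in> L2" "is_weak_deriv [] u g"
    using assms[unfolded sobolev_def mem_Collect_eq, rule_format, of "[]"] by auto
  have "is_weak_deriv [] u u"
    using g(2) by (simp add: is_weak_deriv_def dderivs_def)
  from is_weak_deriv_unique[OF this g(2)] have ug: "AE z in lebesgue. u z = g z" .
  obtain U where U: "sqint U" "AE z in lebesgue. g z = U z"
    using L2_rep[OF g(1)] by blast
  have "AE z in lebesgue. u z = U z"
    using ug U(2) by eventually_elim simp
  then show thesis using that U(1) by blast
qed

text \<open>Absorption of \<open>\<rho> * a\<close> into the left side, legitimate because a is
  finite. If d is infinite, the right side is infinite too unless \<rho> = 0, and then a =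
  0.\<close>

lemma ennreal_contraction:
  fixes a d :: ennreal
  assumes le: "a \<le> ennreal \<rho> * (a + d)" and \<rho>: "0 \<le> \<rho>" "\<rho> < 1" and a: "a < \<infinity>"
  shows "a \<le> ennreal (\<rho> / (1 - \<rho>)) * d"
proof (cases "d = \<infinity>")
  case True
  show ?thesis
  proof (cases "\<rho> = 0")
    case False
    then show ?thesis using True \<rho> by (simp add: ennreal_mult_top)
  qed (use le in simp)
next
  case False
  then obtain a' d' where ad: "a = ennreal a'" "a' \<ge> 0" "d = ennreal d'" "d' \<ge> 0"
    using a by (metis ennreal_cases less_irrefl infinity_ennreal_def)
  have "ennreal a' \<le> ennreal (\<rho> * (a' + d'))"
    using le ad \<rho> by (simp add: ennreal_mult)
  then have "a' \<le> \<rho> * (a' + d')"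
    using ad \<rho> by (subst (asm) ennreal_le_iff) auto
  then have "a' \<le> \<rho> / (1 - \<rho>) * d'"
    using \<rho> by (simp add: le_divide_eq algebra_simps)
  then have "ennreal a' \<le> ennreal (\<rho> / (1 - \<rho>) * d')"
    by (rule ennreal_leI)
  also have "\<dots> = ennreal (\<rho> / (1 - \<rho>)) * ennreal d'"
    using ad \<rho> by (intro ennreal_mult) auto
  finally show ?thesis
    by (simp only: ad)
qed

theorem theorem1p2:
  fixes p C :: real
    and V :: "real ^ 'n \<Rightarrow> complex"
    and u :: "(real ^ 'n) \<times> real \<Rightarrow> complex"
  assumes n: "CARD('n) \<ge> 3"
    and p: "(real CARD('n) - 1) / 2 < p" "p \<le> real CARD('n) / 2"
    and C: "C > 0"
    and carleman:
      "\<And>(W :: real ^ 'n \<Rightarrow> complex) (\<beta> :: real) (\<nu> :: (real ^ 'n) \<times> real) v.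
         W \<in> FP p \<Longrightarrow> v \<in> test_functions \<Longrightarrow>
         weighted_norm (\<lambda>x. ennreal (norm (W x))) (\<lambda>z. exp (\<beta> * (z \<bullet> \<nu>)) *\<^sub>R v z)
         \<le> ennreal C * FP_norm p W *
           weighted_norm (\<lambda>x. inverse (ennreal (norm (W x))))
             (\<lambda>z. exp (\<beta> * (z \<bullet> \<nu>)) *\<^sub>R schroedinger v z)"
    and V: "V \<in> FP p" "FP_norm p V < ennreal (1 / C)"
    and endpoint: "p = real CARD('n) / 2 \<Longrightarrow>
      \<exists>\<delta>>0. \<forall>\<^sub>F R in at_top. AE x in lebesgue. norm x \<le> 2 * R \<longrightarrow> norm (V x) \<ge> \<delta> / R\<^sup>2"
    and u: "u \<in> H1_t" "u \<in> H2_x"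
    and ineq: "AE (x, t) in lebesgue. norm (weak_schroedinger u (x, t)) \<le> norm (V x * u (x, t))"
    and vanish: "\<exists>\<nu>\<^sub>0 c. norm \<nu>\<^sub>0 = 1 \<and> (AE z in lebesgue. z \<bullet> \<nu>\<^sub>0 > c \<longrightarrow> u z = 0)"
  shows "AE z in lebesgue. u z = 0"
proof -
  have p0: "0 < p" using p(1) n by simp
  obtain W M \<delta> where W[measurable]: "W \<in> borel_measurable borel" and W0: "\<And>x. W x \<ge> 0"
    and VW: "AE x in lborel. norm (V x) \<le> W x"
    and WFP: "(\<lambda>x. complex_of_real (W x)) \<in> FP p" "FP_norm p (\<lambda>x. complex_of_real (W x)) \<le> ennreal M"
    and M: "M \<ge> 0" "C * M < 1" and \<delta>: "\<delta> > 0"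
    and low: "\<forall>\<^sub>F k in sequentially. AE x in lborel. norm x \<le> 2 * real k \<longrightarrow> W x \<ge> \<delta> / (real k)\<^sup>2"
    by (rule exists_weight[OF p0 p(2) C V endpoint]) (assumption, rule that)
  obtain U where U: "sqint U" and uU: "AE z in lebesgue. u z = U z"
    using sobolev_rep_self u(1) unfolding H1_t_def by blast
  note H = u[unfolded H1_t_def H2_x_def]
  have "\<exists>G. (AE z in lebesgue. weak_deriv [e_t] u z = G z) \<and> wder [e_t] U G"
    by (rule sobolev_wder[OF H(1) _ _ U uU]) auto
  then obtain Ut where Ut': "AE z in lebesgue. weak_deriv [e_t] u z = Ut z" "wder [e_t] U Ut"
    by blast
  have "\<forall>j. \<exists>G. (AE z in lebesgue. weak_deriv [e_x j] u z = G z) \<and> wder [e_x j] U G"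
    by (intro allI sobolev_wder[OF H(2) _ _ U uU]) auto
  from choice[OF this] obtain Ux where
    "\<forall>j. (AE z in lebesgue. weak_deriv [e_x j] u z = Ux j z) \<and> wder [e_x j] U (Ux j)" ..
  then have Ux': "wder [e_x j] U (Ux j)" for j
    by blast
  have "\<forall>j. \<exists>G. (AE z in lebesgue. weak_deriv [e_x j, e_x j] u z = G z) \<and> wder [e_x j, e_x j] U G"
    by (intro allI sobolev_wder[OF H(2) _ _ U uU]) auto
  from choice[OF this] obtain Uxx where
    "\<forall>j. (AE z in lebesgue. weak_deriv [e_x j, e_x j] u z = Uxx j z) \<and> wder [e_x j, e_x j] U (Uxx j)" ..
  then have Uxx': "AE z in lebesgue. weak_deriv [e_x j, e_x j] u z = Uxx j z"
    "wder [e_x j, e_x j] U (Uxx j)" for j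
    by blast+
  interpret weak_derivs U Ut Ux Uxx
    by unfold_locales (rule Ut'(2) Ux' Uxx'(2))+
  have [measurable]: "U \<in> borel_measurable borel" "SU \<in> borel_measurable borel"
    using U SU by (auto simp: sqint_def)
  have [measurable]: "(\<lambda>z::(real ^ 'n) \<times> real. W (fst z)) \<in> borel_measurable borel"
    by (rule measurable_compose[OF _ W]) (simp add: borel_prod[symmetric])
  have "AE z in lebesgue. \<forall>j\<in>(UNIV::'n set). weak_deriv [e_x j, e_x j] u z = Uxx j z"
    by (rule AE_finite_allI) (use Uxx'(1) in auto)
  then have "AE z in lebesgue. weak_schroedinger u z = SU z"
    using Ut'(1) by eventually_elim (simp add: weak_schroedinger_def SU_def)
  moreover have "AE z in lebesgue. norm (V (fst z)) \<le> W (fst (z :: (real ^ 'n) \<times> real))"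
    by (rule AE_completion[OF AE_lborel_fst[OF VW]])
  ultimately have "AE z in lebesgue. norm (SU z) \<le> W (fst z) * norm (U z)"
    using uU ineq
  proof eventually_elim
    case (elim z)
    then have "norm (SU z) \<le> norm (V (fst z)) * norm (U z)"
      by (cases z) (simp add: norm_mult)
    also have "\<dots> \<le> W (fst z) * norm (U z)"
      using elim by (intro mult_right_mono) auto
    finally show ?case .
  qed
  then have SUle: "AE z in lborel. norm (SU z) \<le> W (fst z) * norm (U z)"
    by (rule AE_completion_iff[THEN iffD1])
  define \<theta> where "\<theta> = C * M"
  have \<theta>: "0 \<le> \<theta>" "\<theta> < 1" using C M by (auto simp: \<theta>_def)
  have \<theta>2: "\<theta>\<^sup>2 < 1" using \<theta> by (simp add: abs_square_less_1)
  \<comment> \<open>This choice gives \<rho> = (1 - \<kappa>) (1 + \<kappa>) = 1 - \<kappa>^2 <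
    1.\<close>
  define \<kappa> where "\<kappa> = 1 - \<theta>\<^sup>2"
  define \<rho> where "\<rho> = \<theta>\<^sup>2 * (1 + \<kappa>)"
  have \<kappa>: "\<kappa> > 0" using \<theta>2 by (simp add: \<kappa>_def)
  have "\<rho> = 1 - \<kappa>\<^sup>2"
    by (simp add: \<rho>_def \<kappa>_def power2_eq_square algebra_simps)
  then have "\<rho> < 1"
    using \<kappa> by simp
  moreover have "0 \<le> \<rho>"
    using \<kappa> by (simp add: \<rho>_def)
  ultimately have \<rho>: "0 \<le> \<rho>" "\<rho> < 1" by blast+
  define w where "w N x = min (W x) (real N)" for N x
  define A where "A N = (\<integral>\<^sup>+ z. ennreal ((norm (U z))\<^sup>2) * ennreal (w N (fst z)) \<partial>lborel)" for N
  define D where "D = (\<integral>\<^sup>+ z. ennreal ((norm (SU z))\<^sup>2) \<partial>lborel)"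
  have Dfin: "D < \<infinity>"
    unfolding D_def using SU by (subst nn_integral_eq_integral) (auto simp: sqint_def)
  have Ufin: "(\<integral>\<^sup>+ z. ennreal ((norm (U z))\<^sup>2) \<partial>lborel) < \<infinity>"
    using U by (subst nn_integral_eq_integral) (auto simp: sqint_def)
  have AN: "A N \<le> ennreal (\<rho> / (1 - \<rho>)) * (ennreal (1 / real N) * D)" if N: "N \<ge> 1" for N
  proof (rule ennreal_contraction[OF _ \<rho>])
    have wm[measurable]: "w N \<in> borel_measurable borel"
      unfolding w_def[abs_def] by measurable
    have [measurable]: "(\<lambda>z::(real ^ 'n) \<times> real. w N (fst z)) \<in> borel_measurable borel"
      unfolding w_def by measurable
    have w0: "w N x \<ge> 0" for x using W0 by (simp add: w_def)
    have wc: "(\<lambda>x. complex_of_real (w N x)) \<in> borel_measurable lebesgue"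
      by (rule measurable_completion) simp
    have "AE x in lebesgue. norm (complex_of_real (w N x)) \<le> norm (complex_of_real (W x))"
      using W0 by (auto simp: w_def)
    note wFP = FP_mono[OF WFP(1) wc p0 this]
    have carl: "weighted_norm (\<lambda>x. ennreal (w N x)) v
      \<le> ennreal \<theta> * weighted_norm (\<lambda>x. inverse (ennreal (w N x))) (schroedinger v)"
      if v: "v \<in> test_functions" for v
    proof -
      have "weighted_norm (\<lambda>x. ennreal (w N x)) v \<le> ennreal C * FP_norm p (\<lambda>x. complex_of_real (w N x)) *
          weighted_norm (\<lambda>x. inverse (ennreal (w N x))) (schroedinger v)"
        using carleman[OF wFP(1) v, of 0] w0 by simp
      also have "\<dots> \<le> ennreal \<theta> * weighted_norm (\<lambda>x. inverse (ennreal (w N x))) (schroedinger v)"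
        unfolding \<theta>_def using C M(1) order_trans[OF wFP(2) WFP(2)]
        by (intro mult_right_mono) (auto simp: ennreal_mult intro!: mult_left_mono)
      finally show ?thesis .
    qed
    \<comment> \<open>Truncation does no harm to the lower bound as soon as \<delta> / k^2 <= 1 <=
      N, for which k >= max 1 \<delta> is enough.\<close>
    have wlow: "\<forall>\<^sub>F k in sequentially. AE x in lborel. norm x \<le> 2 * real k \<longrightarrow> w N x \<ge> \<delta> / (real k)\<^sup>2"
      using low eventually_ge_at_top[of "max 1 (nat \<lceil>\<delta>\<rceil>)"]
    proof eventually_elim
      case (elim k)
      then have k: "real k \<ge> 1" "real k \<ge> \<delta>" by auto
      have "real k * 1 \<le> real k * real k"
        using k by (intro mult_left_mono) auto
      then have "\<delta> \<le> real k * real k"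
        using k by linarith
      then have "\<delta> / (real k)\<^sup>2 \<le> 1"
        using k by (simp add: power2_eq_square)
      then have "\<delta> / (real k)\<^sup>2 \<le> real N" using N by simp
      then show ?case
        using elim(1) by (auto simp: w_def elim: eventually_mono)
    qed
    have "A N \<le> ennreal \<rho> * (\<integral>\<^sup>+ z. ennreal ((norm (SU z))\<^sup>2) * inverse (ennreal (w N (fst z))) \<partial>lborel)"
      unfolding A_def \<rho>_def by (rule carleman_weak[OF carl \<theta>(1) wm \<delta> wlow \<kappa>])
    also have "(\<integral>\<^sup>+ z. ennreal ((norm (SU z))\<^sup>2) * inverse (ennreal (w N (fst z))) \<partial>lborel)
      \<le> (\<integral>\<^sup>+ z. ennreal ((norm (U z))\<^sup>2) * ennreal (w N (fst z)) + ennreal (1 / real N) * ennreal ((norm (SU z))\<^sup>2) \<partial>lborel)"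
    proof (rule nn_integral_mono_AE)
      show "AE z in lborel. ennreal ((norm (SU z))\<^sup>2) * inverse (ennreal (w N (fst z)))
        \<le> ennreal ((norm (U z))\<^sup>2) * ennreal (w N (fst z)) + ennreal (1 / real N) * ennreal ((norm (SU z))\<^sup>2)"
        using SUle
      proof eventually_elim
        case (elim z)
        let ?W = "W (fst z)"
        \<comment> \<open>At zeros of W the bound on SU gives SU = 0, and 0 times infinity is 0. For
          0 < W <= N it bounds |SU|^2 / W by W |U|^2. For W > N the weight is 1 / N, and square
          integrability of SU takes over.\<close>
        consider "?W = 0" | "0 < ?W" "?W \<le> real N" | "?W > real N"
          using W0[of "fst z"] by linarith
        then show ?case
        proof cases
          case 1
          then show ?thesis using elim by simp
        next
          case 2
          have "(norm (SU z))\<^sup>2 * inverse ?W \<le> (?W * norm (U z))\<^sup>2 * inverse ?W"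
            using elim 2 by (intro mult_right_mono power_mono) auto
          also have "\<dots> = (norm (U z))\<^sup>2 * ?W"
            using 2 by (simp add: power2_eq_square field_simps)
          finally have "ennreal ((norm (SU z))\<^sup>2 * inverse ?W) \<le> ennreal ((norm (U z))\<^sup>2 * ?W)"
            by (rule ennreal_leI)
          then have "ennreal ((norm (SU z))\<^sup>2) * inverse (ennreal ?W) \<le> ennreal ((norm (U z))\<^sup>2) * ennreal ?W"
            using 2 by (simp add: inverse_ennreal ennreal_mult)
          then show ?thesis
            using 2 by (simp add: w_def add_increasing2)
        next
          case 3
          then have "inverse (ennreal (w N (fst z))) = ennreal (1 / real N)"
            using N by (simp add: w_def inverse_ennreal inverse_eq_divide)
          then show ?thesis by (simp add: mult.commute add_increasing)
        qed
      qed
    qed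
    also have "\<dots> = A N + ennreal (1 / real N) * D"
      unfolding A_def D_def by (subst nn_integral_add) (auto simp: nn_integral_cmult)
    finally show "A N \<le> ennreal \<rho> * (A N + ennreal (1 / real N) * D)"
      by (simp add: mult_left_mono)
    \<comment> \<open>Finite because w <= N and U is square integrable; this permits the
      absorption.\<close>
    have "A N \<le> (\<integral>\<^sup>+ z. ennreal (real N) * ennreal ((norm (U z))\<^sup>2) \<partial>lborel)"
      unfolding A_def by (intro nn_integral_mono) (auto simp: w_def mult.commute intro!: mult_right_mono ennreal_leI)
    also have "\<dots> < \<infinity>"
      using Ufin by (simp add: nn_integral_cmult ennreal_mult_less_top)
    finally show "A N < \<infinity>" .
  qed
  \<comment> \<open>\<open>A\<close> increases with N whereas its bound tends to 0, so already
    \<open>A 1\<close> vanishes.\<close>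
  have "A 1 \<le> ennreal (\<rho> / (1 - \<rho>)) * (0 * D)"
  proof (rule LIMSEQ_le_const)
    show "(\<lambda>k. ennreal (\<rho> / (1 - \<rho>)) * (ennreal (1 / real (Suc k)) * D)) \<longlonglongrightarrow> ennreal (\<rho> / (1 - \<rho>)) * (0 * D)"
    proof (intro ennreal_tendsto_cmult tendsto_mult_ennreal tendsto_const)
      show "(\<lambda>k. ennreal (1 / real (Suc k))) \<longlonglongrightarrow> 0"
        using tendsto_ennrealI[OF LIMSEQ_Suc[OF lim_1_over_n]] by simp
    qed (use Dfin in auto)
    have "A 1 \<le> ennreal (\<rho> / (1 - \<rho>)) * (ennreal (1 / real (Suc k)) * D)" for k
    proof -
      have "A 1 \<le> A (Suc k)"
        unfolding A_def by (intro nn_integral_mono mult_left_mono ennreal_leI) (auto simp: w_def)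
      also have "\<dots> \<le> ennreal (\<rho> / (1 - \<rho>)) * (ennreal (1 / real (Suc k)) * D)"
        by (rule AN) simp
      finally show ?thesis .
    qed
    then show "\<exists>K. \<forall>k\<ge>K. A 1 \<le> ennreal (\<rho> / (1 - \<rho>)) * (ennreal (1 / real (Suc k)) * D)"
      by blast
  qed
  then have "A 1 = 0" by simp
  then have A1: "AE z in lborel. ennreal ((norm (U z))\<^sup>2) * ennreal (w 1 (fst z)) = 0"
    unfolding A_def w_def by (subst (asm) nn_integral_0_iff_AE) auto
  \<comment> \<open>The lower bounds at integer radii share one null set and show W > 0 almost
    everywhere; hence the vanishing of \<open>A 1\<close> forces U = 0.\<close>
  obtain K where K: "\<And>k. k \<ge> K \<Longrightarrow> AE x in lborel. norm x \<le> 2 * real k \<longrightarrow> W x \<ge> \<delta> / (real k)\<^sup>2"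
    using low unfolding eventually_sequentially by blast
  have "AE x in lborel. \<forall>k. k \<ge> K \<longrightarrow> norm x \<le> 2 * real k \<longrightarrow> W x \<ge> \<delta> / (real k)\<^sup>2"
    using K by (auto simp: AE_all_countable)
  then have "AE x in lborel. W x > 0"
  proof eventually_elim
    case (elim x)
    obtain k0 where k0: "norm x \<le> real k0" using real_arch_simple by blast
    define k where "k = max (max K k0) 1"
    have "W x \<ge> \<delta> / (real k)\<^sup>2"
      by (rule elim[rule_format]) (use k0 in \<open>auto simp: k_def\<close>)
    moreover have "\<delta> / (real k)\<^sup>2 > 0"
      using \<delta> by (simp add: k_def)
    ultimately show ?case by linarith
  qed
  from AE_lborel_fst[OF this, where 'b = real] A1
  have "AE z in lborel. U z = 0"
  proof eventually_elim
    case (elim z)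
    then have "w 1 (fst z) > 0" by (simp add: w_def)
    then show ?case using elim by simp
  qed
  then have "AE z in lebesgue. U z = 0"
    by (rule AE_completion)
  with uU show ?thesis
    by eventually_elim simp
qed

end
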